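(* Let $G$ be a locally compact Hausdorff group and suppose that $\alpha=(\{D_t\}_{t\in G},\{\alpha_t\}_{t\in G})$ is a partial action of $G$ on the $C^*$-algebra $A$, with Morita enveloping action $(\beta,B)$. If the primitive ideal space $\mathrm{Prim}(A)$ is compact (this is true if $A$ is unital), then there exists an open subgroup $H$ of $G$ such that the restriction of $\alpha$ to $H$ is a global action (i.e. $D_t=A$ for all $t\in H$). In particular, if $G$ is a connected group, then $\alpha$ is a global action.
   Context: A partial action of $G$ on a $C^*$-algebra $A$ is a pair $\alpha=(\{D_t\}_{t\in G},\{\alpha_t\}_{t\in G})$ where each $D_t$ is a closed two-sided ideal of $A$, each $\alpha_t:D_{t^{-1}}\to D_t$ is a $*$-isomorphism, $D_e=A$, $\alpha_{st}$ extends $\alpha_s\alpha_t$ for all $s,t$, the set $\{t: U\cap D_t\neq\emptyset\}$ is open in $G$ for every open $U\subseteq A$, and $(t,a)\mapsto\alpha_t(a)$ is continuous on $\{(t,a)\in G\times A: a\in D_{t^{-1}}\}$. If $\beta$ is a continuous global action of $G$ on $B$ and $I$ is an ideal of $B$, then $\beta|_I$ is the partial action on $I$ with $D_t=I\cap\beta_t(I)$ and $\alpha_t=\beta_t|_{D_{t^{-1}}}$. $\mathrm{Prim}(A)$ carries the Jacobson (hull-kernel) topology; compactness does not include the Hausdorff property. A positive $C^*$-tring is a full Hilbert $(E^l$-$E^r)$-bimodule $E$ (for $C^*$-algebras $E^l,E^r$, with full inner products satisfying $\langle x,y\rangle_l z=x\langle y,z\rangle_r$) with ternary product $(x,y,z)=\langle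 x,y\rangle_lz$. An ideal $F$ of $E$ is a closed sub-bimodule; $F^l=\overline{\mathrm{span}}\langle F,F\rangle_l$, $F^r=\overline{\mathrm{span}}\langle F,F\rangle_r$. An isomorphism of $C^*$-trings $\pi:F\to F'$ is a linear bijection preserving ternary products; it induces $*$-isomorphisms $\pi^l:F^l\to F'^l$, $\pi^r:F^r\to F'^r$ with $\pi^l(\langle x,y\rangle_l)=\langle\pi(x),\pi(y)\rangle_l$, $\pi^r(\langle x,y\rangle_r)=\langle\pi(x),\pi(y)\rangle_r$. A partial action of $G$ on $E$ is a pair $\gamma=(\{E_t\},\{\gamma_t\})$ with $E_t$ ideals of $E$, $\gamma_t:E_{t^{-1}}\to E_t$ isomorphisms of $C^*$-trings, $E_e=E$, $\gamma_{st}$ extending $\gamma_s\gamma_t$, $\{t:U\cap E_t\ne\emptyset\}$ open for every open $U\subseteq E$, and $(t,x)\mapsto\gamma_t(x)$ continuous on $\{(t,x):x\in E_{t^{-1}}\}\subseteq G\times E$. Put $\gamma^l=(\{E_t^l\},\{\gamma_t^l\})$, $\gamma^r=(\{E_t^r\},\{\gamma_t^r\})$. Partial actions $\alpha$ on $A$ and $\beta$ on $B$ are Morita equivalent if there is a partial action $\gamma$ on a positive $C^*$-tring $E$ with $\gamma^l=\alpha$ and $\gamma^r=\beta$ (in particular $E^l=A$, $E^r=B$). A continuous action $\beta$ of $G$ on a $C^*$-algebra $B$ is a Morita enveloping action of $\alpha$ if there is an ideal $I$ of $B$ such that $\mathrm{span}\{\beta_t(x):t\in G,x\in I\}$ is dense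 in $B$ and $\alpha$ is Morita equivalent to $\beta|_I$. *)

theory Defs
  imports "HOL-Analysis.Analysis"
begin

section \<open>C*-algebras\<close>

class complex_banach = banach +
  fixes scaleC :: "complex \<Rightarrow> 'a \<Rightarrow> 'a" (infixr \<open>*\<^sub>C\<close> 75)
  assumes scaleC_add_right: "c *\<^sub>C (x + y) = c *\<^sub>C x + c *\<^sub>C y"
    and scaleC_add_left: "(c + d) *\<^sub>C x = c *\<^sub>C x + d *\<^sub>C x"
    and scaleC_scaleC: "c *\<^sub>C d *\<^sub>C x = (c * d) *\<^sub>C x"
    and scaleC_of_real: "complex_of_real r *\<^sub>C x = r *\<^sub>R x"
    and norm_scaleC: "norm (c *\<^sub>C x) = cmod c * norm x"

global_interpretation complex_vector:
  vector_space "scaleC :: complex \<Rightarrow> 'a \<Rightarrow> 'a::complex_banach"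
  defines csubspace = complex_vector.subspace
    and cspan = complex_vector.span
proof unfold_locales
  fix x :: 'a
  show "1 *\<^sub>C x = x"
    using scaleC_of_real[of 1 x] by simp
qed (auto simp: scaleC_add_right scaleC_add_left scaleC_scaleC)

text \<open>C*-algebras are not assumed to have a unit.\<close>

class cstar_algebra = complex_banach + real_normed_algebra +
  fixes adj :: "'a \<Rightarrow> 'a"
  assumes mult_scaleC_left: "(c *\<^sub>C a) * b = c *\<^sub>C (a * b)"
    and mult_scaleC_right: "a * (c *\<^sub>C b) = c *\<^sub>C (a * b)"
    and adj_add: "adj (a + b) = adj a + adj b"
    and adj_scaleC: "adj (c *\<^sub>C a) = cnj c *\<^sub>C adj a"
    and adj_mult: "adj (a * b) = adj b * adj a"
    and adj_adj: "adj (adj a) = a"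
    and cstar_identity: "norm (adj a * a) = (norm a)\<^sup>2"

text \<open>A C*-algebra of which another one is an ideal is not a type of its own, so C*-algebras
  occur in general as C*-subalgebras of a type of class \<^class>\<open>cstar_algebra\<close>.\<close>

definition cstar_subalgebra :: "'a::cstar_algebra set \<Rightarrow> bool" where
  "cstar_subalgebra X \<longleftrightarrow> closed X \<and> csubspace X \<and>
     (\<forall>a\<in>X. \<forall>b\<in>X. a * b \<in> X) \<and> (\<forall>a\<in>X. adj a \<in> X)"

definition closed_ideal :: "'a::cstar_algebra set \<Rightarrow> 'a set \<Rightarrow> bool" where
  "closed_ideal X J \<longleftrightarrow> J \<subseteq> X \<and> closed J \<and> csubspace J \<and>
     (\<forall>a\<in>X. \<forall>j\<in>J. a * j \<in> J \<and> j * a \<in> J)"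

definition clinear_on :: "'x::complex_banach set \<Rightarrow> ('x \<Rightarrow> 'y::complex_banach) \<Rightarrow> bool" where
  "clinear_on S f \<longleftrightarrow> (\<forall>x\<in>S. \<forall>y\<in>S. f (x + y) = f x + f y) \<and> (\<forall>c. \<forall>x\<in>S. f (c *\<^sub>C x) = c *\<^sub>C f x)"

definition star_isomorphism ::
    "'a::cstar_algebra set \<Rightarrow> 'b::cstar_algebra set \<Rightarrow> ('a \<Rightarrow> 'b) \<Rightarrow> bool" where
  "star_isomorphism S T f \<longleftrightarrow> bij_betw f S T \<and> clinear_on S f \<and>
     (\<forall>a\<in>S. \<forall>b\<in>S. f (a * b) = f a * f b) \<and> (\<forall>a\<in>S. f (adj a) = adj (f a))"

definition positive_in :: "'a::cstar_algebra set \<Rightarrow> 'a \<Rightarrow> bool" where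
  "positive_in X a \<longleftrightarrow> (\<exists>c\<in>X. a = adj c * c)"

section \<open>The primitive ideal space\<close>

text \<open>The inner product is linear in the first variable.\<close>

record 'h hilbert_data =
  hcarrier :: "'h set"
  hzero :: 'h
  hadd :: "'h \<Rightarrow> 'h \<Rightarrow> 'h"
  hscale :: "complex \<Rightarrow> 'h \<Rightarrow> 'h"
  hinner :: "'h \<Rightarrow> 'h \<Rightarrow> complex"

definition hnorm :: "'h hilbert_data \<Rightarrow> 'h \<Rightarrow> real" where
  "hnorm H x = sqrt (Re (hinner H x x))"

definition hdist :: "'h hilbert_data \<Rightarrow> 'h \<Rightarrow> 'h \<Rightarrow> real" where
  "hdist H x y = hnorm H (hadd H x (hscale H (-1) y))"

locale complex_hilbert_space =
  fixes H :: "'h hilbert_data"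
  assumes zero_closed: "hzero H \<in> hcarrier H"
    and add_closed: "\<lbrakk>x \<in> hcarrier H; y \<in> hcarrier H\<rbrakk> \<Longrightarrow> hadd H x y \<in> hcarrier H"
    and scale_closed: "x \<in> hcarrier H \<Longrightarrow> hscale H c x \<in> hcarrier H"
    and add_assoc: "\<lbrakk>x \<in> hcarrier H; y \<in> hcarrier H; z \<in> hcarrier H\<rbrakk>
          \<Longrightarrow> hadd H (hadd H x y) z = hadd H x (hadd H y z)"
    and add_commute: "\<lbrakk>x \<in> hcarrier H; y \<in> hcarrier H\<rbrakk> \<Longrightarrow> hadd H x y = hadd H y x"
    and add_zero: "x \<in> hcarrier H \<Longrightarrow> hadd H x (hzero H) = x"
    and add_inverse: "x \<in> hcarrier H \<Longrightarrow> hadd H x (hscale H (-1) x) = hzero H"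
    and scale_add_right: "\<lbrakk>x \<in> hcarrier H; y \<in> hcarrier H\<rbrakk>
          \<Longrightarrow> hscale H c (hadd H x y) = hadd H (hscale H c x) (hscale H c y)"
    and scale_add_left: "x \<in> hcarrier H
          \<Longrightarrow> hscale H (c + d) x = hadd H (hscale H c x) (hscale H d x)"
    and scale_scale: "x \<in> hcarrier H \<Longrightarrow> hscale H c (hscale H d x) = hscale H (c * d) x"
    and scale_one: "x \<in> hcarrier H \<Longrightarrow> hscale H 1 x = x"
    and inner_add: "\<lbrakk>x \<in> hcarrier H; y \<in> hcarrier H; z \<in> hcarrier H\<rbrakk>
          \<Longrightarrow> hinner H (hadd H x y) z = hinner H x z + hinner H y z"
    and inner_scale: "\<lbrakk>x \<in> hcarrier H; y \<in> hcarrier H\<rbrakk>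
          \<Longrightarrow> hinner H (hscale H c x) y = c * hinner H x y"
    and inner_commute: "\<lbrakk>x \<in> hcarrier H; y \<in> hcarrier H\<rbrakk> \<Longrightarrow> hinner H x y = cnj (hinner H y x)"
    and inner_ge_zero: "x \<in> hcarrier H \<Longrightarrow> 0 \<le> Re (hinner H x x)"
    and inner_eq_zero: "\<lbrakk>x \<in> hcarrier H; hinner H x x = 0\<rbrakk> \<Longrightarrow> x = hzero H"
    and complete: "\<lbrakk>\<forall>n. u n \<in> hcarrier H; \<forall>e>0. \<exists>N. \<forall>m\<ge>N. \<forall>n\<ge>N. hdist H (u m) (u n) < e\<rbrakk>
          \<Longrightarrow> \<exists>x\<in>hcarrier H. (\<lambda>n. hdist H (u n) x) \<longlonglongrightarrow> 0"

definition closed_hsubspace :: "'h hilbert_data \<Rightarrow> 'h set \<Rightarrow> bool" where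
  "closed_hsubspace H W \<longleftrightarrow> W \<subseteq> hcarrier H \<and> hzero H \<in> W \<and>
     (\<forall>x\<in>W. \<forall>y\<in>W. hadd H x y \<in> W) \<and> (\<forall>c. \<forall>x\<in>W. hscale H c x \<in> W) \<and>
     (\<forall>u. \<forall>x\<in>hcarrier H. (\<forall>n::nat. u n \<in> W) \<and> (\<lambda>n. hdist H (u n) x) \<longlonglongrightarrow> 0 \<longrightarrow> x \<in> W)"

locale star_representation = complex_hilbert_space H
  for H :: "'h hilbert_data" +
  fixes \<pi> :: "'a::cstar_algebra \<Rightarrow> 'h \<Rightarrow> 'h"
  assumes rep_closed: "x \<in> hcarrier H \<Longrightarrow> \<pi> a x \<in> hcarrier H"
    and rep_vec_add: "\<lbrakk>x \<in> hcarrier H; y \<in> hcarrier H\<rbrakk> \<Longrightarrow> \<pi> a (hadd H x y) = hadd H (\<pi> a x) (\<pi> a y)"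
    and rep_vec_scale: "x \<in> hcarrier H \<Longrightarrow> \<pi> a (hscale H c x) = hscale H c (\<pi> a x)"
    and rep_bounded: "\<exists>K. \<forall>x\<in>hcarrier H. hnorm H (\<pi> a x) \<le> K * hnorm H x"
    and rep_add: "x \<in> hcarrier H \<Longrightarrow> \<pi> (a + b) x = hadd H (\<pi> a x) (\<pi> b x)"
    and rep_scale: "x \<in> hcarrier H \<Longrightarrow> \<pi> (c *\<^sub>C a) x = hscale H c (\<pi> a x)"
    and rep_mult: "x \<in> hcarrier H \<Longrightarrow> \<pi> (a * b) x = \<pi> a (\<pi> b x)"
    and rep_adj: "\<lbrakk>x \<in> hcarrier H; y \<in> hcarrier H\<rbrakk> \<Longrightarrow> hinner H (\<pi> (adj a) x) y = hinner H x (\<pi> a y)"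

locale irreducible_representation = star_representation H \<pi>
  for H :: "'h hilbert_data" and \<pi> :: "'a::cstar_algebra \<Rightarrow> 'h \<Rightarrow> 'h" +
  assumes nonzero: "\<exists>a. \<exists>x\<in>hcarrier H. \<pi> a x \<noteq> hzero H"
    and irreducible: "\<lbrakk>closed_hsubspace H W; \<forall>a. \<forall>x\<in>W. \<pi> a x \<in> W\<rbrakk> \<Longrightarrow> W = {hzero H} \<or> W = hcarrier H"

definition rep_kernel :: "'h hilbert_data \<Rightarrow> ('a::cstar_algebra \<Rightarrow> 'h \<Rightarrow> 'h) \<Rightarrow> 'a set" where
  "rep_kernel H \<pi> = {a. \<forall>x\<in>hcarrier H. \<pi> a x = hzero H}"

text \<open>Kernels of irreducible representations. HOL cannot quantify over the type underlying the
  Hilbert space, but taking its vectors from the type of functions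
  \<^typ>\<open>'a \<Rightarrow> complex\<close> loses nothing: given an irreducible representation \<open>\<pi>\<close> on \<open>H\<close> and a nonzero
  vector \<open>v\<close>, the vectors \<open>\<pi> a v\<close> are dense in \<open>H\<close>, so that sending \<open>x\<close> to the function
  \<open>\<lambda>a. hinner H x (\<pi> a v)\<close> is injective, and the structure of \<open>H\<close> can be transported along this
  map.\<close>

definition primitive_ideals :: "'a::cstar_algebra set set" where
  "primitive_ideals = {P. \<exists>(H :: ('a \<Rightarrow> complex) hilbert_data) \<pi>.
     irreducible_representation H \<pi> \<and> P = rep_kernel H \<pi>}"

definition hull_kernel_closed :: "'a::cstar_algebra set set \<Rightarrow> bool" where
  "hull_kernel_closed C \<longleftrightarrow> C = {P \<in> primitive_ideals. \<Inter>C \<subseteq> P}"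

definition jacobson_topology :: "'a::cstar_algebra set topology" where
  "jacobson_topology = topology (\<lambda>U. U \<subseteq> primitive_ideals \<and> hull_kernel_closed (primitive_ideals - U))"

context complex_hilbert_space
begin

lemma scale_zero: "hscale H c (hzero H) = hzero H"
proof -
  have "hscale H c (hzero H) = hscale H c (hadd H (hzero H) (hscale H (-1) (hzero H)))"
    using add_inverse zero_closed by simp
  also have "\<dots> = hadd H (hscale H c (hzero H)) (hscale H (-1) (hscale H c (hzero H)))"
    using scale_add_right zero_closed scale_closed scale_scale by simp
  also have "\<dots> = hzero H"
    using add_inverse zero_closed scale_closed by simp
  finally show ?thesis .
qed

lemma hnorm_uminus:
  assumes "x \<in> hcarrier H" shows "hnorm H (hscale H (-1) x) = hnorm H x"
proof -
  have "hinner H (hscale H (-1) x) (hscale H (-1) x) = - hinner H x (hscale H (-1) x)"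
    using assms inner_scale scale_closed by simp
  also have "\<dots> = - cnj (hinner H (hscale H (-1) x) x)"
    using assms inner_commute scale_closed by metis
  also have "\<dots> = hinner H x x"
    using assms inner_scale inner_commute[of x x] by simp
  finally show ?thesis by (simp add: hnorm_def)
qed

lemma hnorm_zero: "hnorm H (hzero H) = 0"
  using inner_scale[of "hzero H" "hzero H" 0] zero_closed scale_zero[of 0] by (simp add: hnorm_def)

lemma hnorm_eq_zero:
  assumes "x \<in> hcarrier H" "hnorm H x = 0" shows "x = hzero H"
proof -
  have "Im (hinner H x x) = 0"
    using arg_cong[OF inner_commute[of x x], of Im] assms(1) by simp
  then show ?thesis
    using assms inner_eq_zero by (simp add: hnorm_def complex_eq_iff)
qed

end

context irreducible_representation
begin

lemma rep_zero_vec: "\<pi> a (hzero H) = hzero H"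
  by (metis add_inverse rep_closed rep_vec_add rep_vec_scale scale_closed zero_closed)

lemma kernel_prime:
  assumes J: "\<And>a x. x \<in> J \<Longrightarrow> x * a \<in> J"
    and JK: "\<And>x y. x \<in> J \<Longrightarrow> y \<in> K \<Longrightarrow> x * y \<in> rep_kernel H \<pi>"
  shows "J \<subseteq> rep_kernel H \<pi> \<or> K \<subseteq> rep_kernel H \<pi>"
proof -
  define W where "W = {x \<in> hcarrier H. \<forall>j\<in>J. \<pi> j x = hzero H}"
  have "closed_hsubspace H W"
    unfolding closed_hsubspace_def
  proof (intro conjI allI ballI impI)
    show "W \<subseteq> hcarrier H" "hzero H \<in> W"
      using zero_closed rep_zero_vec by (auto simp: W_def)
    show "hadd H x y \<in> W" if "x \<in> W" "y \<in> W" for x y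
      using that by (auto simp: W_def add_closed rep_vec_add add_zero zero_closed)
    show "hscale H c x \<in> W" if "x \<in> W" for c x
      using that by (auto simp: W_def scale_closed rep_vec_scale scale_zero)
    fix u :: "nat \<Rightarrow> 'h" and x
    assume x: "x \<in> hcarrier H" and u: "(\<forall>n. u n \<in> W) \<and> (\<lambda>n. hdist H (u n) x) \<longlonglongrightarrow> 0"
    have "\<pi> j x = hzero H" if j: "j \<in> J" for j
    proof -
      obtain B where B: "\<And>y. y \<in> hcarrier H \<Longrightarrow> hnorm H (\<pi> j y) \<le> B * hnorm H y"
        using rep_bounded by meson
      have bound: "hnorm H (\<pi> j x) \<le> B * hdist H (u n) x" for n
      proof -
        have un: "u n \<in> hcarrier H" "\<pi> j (u n) = hzero H"
          using u j by (auto simp: W_def)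
        have "\<pi> j (hadd H (u n) (hscale H (-1) x)) = hadd H (hzero H) (hscale H (-1) (\<pi> j x))"
          using un x by (simp add: rep_vec_add rep_vec_scale scale_closed)
        also have "\<dots> = hscale H (-1) (\<pi> j x)"
          using x by (metis add_commute add_zero rep_closed scale_closed zero_closed)
        finally have "hnorm H (\<pi> j (hadd H (u n) (hscale H (-1) x))) = hnorm H (\<pi> j x)"
          using x by (simp add: hnorm_uminus rep_closed)
        then show ?thesis
          using B[of "hadd H (u n) (hscale H (-1) x)"] un x by (simp add: hdist_def add_closed scale_closed)
      qed
      have "(\<lambda>n. B * hdist H (u n) x) \<longlonglongrightarrow> B * 0"
        using u by (intro tendsto_mult_left) auto
      then have "hnorm H (\<pi> j x) \<le> B * 0"
        by (rule LIMSEQ_le_const) (use bound in auto)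
      moreover have "hnorm H (\<pi> j x) \<ge> 0"
        using inner_ge_zero[OF rep_closed[OF x]] by (simp add: hnorm_def)
      ultimately show ?thesis
        using hnorm_eq_zero rep_closed x by simp
    qed
    then show "x \<in> W"
      using x by (simp add: W_def)
  qed
  moreover have "\<forall>a. \<forall>x\<in>W. \<pi> a x \<in> W"
    using J by (auto simp: W_def rep_closed simp flip: rep_mult)
  ultimately have "W = {hzero H} \<or> W = hcarrier H"
    by (rule irreducible)
  then show ?thesis
  proof
    assume "W = hcarrier H"
    then have "J \<subseteq> rep_kernel H \<pi>"
      by (auto simp: W_def rep_kernel_def)
    then show ?thesis ..
  next
    assume W: "W = {hzero H}"
    have "\<pi> k x \<in> W" if "k \<in> K" "x \<in> hcarrier H" for k x
      using that JK by (auto simp: W_def rep_closed rep_kernel_def simp flip: rep_mult)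
    then have "K \<subseteq> rep_kernel H \<pi>"
      using W by (auto simp: rep_kernel_def)
    then show ?thesis ..
  qed
qed

lemma kernel_ideal:
  assumes "x \<in> rep_kernel H \<pi>" shows "a * x \<in> rep_kernel H \<pi>" "x * a \<in> rep_kernel H \<pi>"
  using assms by (auto simp: rep_kernel_def rep_mult rep_zero_vec rep_closed)

lemma kernel_proper: "rep_kernel H \<pi> \<noteq> UNIV"
  using nonzero by (auto simp: rep_kernel_def)

end

lemma istopology_jacobson:
  "istopology (\<lambda>U :: 'a::cstar_algebra set set.
     U \<subseteq> primitive_ideals \<and> hull_kernel_closed (primitive_ideals - U))"
proof -
  define Pr where "Pr = (primitive_ideals :: 'a set set)"
  have ideal: "a * x \<in> P" "x * a \<in> P" if "P \<in> Pr" "x \<in> P" for P x a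
    using that irreducible_representation.kernel_ideal by (fastforce simp: Pr_def primitive_ideals_def)+
  have prime: "J \<subseteq> P \<or> K \<subseteq> P"
    if "P \<in> Pr" "\<And>a x. x \<in> J \<Longrightarrow> x * a \<in> J" "\<And>x y. x \<in> J \<Longrightarrow> y \<in> K \<Longrightarrow> x * y \<in> P" for J K P
    using that irreducible_representation.kernel_prime[of _ _ J K]
    unfolding Pr_def primitive_ideals_def by blast
  have closedI: "hull_kernel_closed C" if "C \<subseteq> Pr" "\<And>P. P \<in> Pr \<Longrightarrow> \<Inter>C \<subseteq> P \<Longrightarrow> P \<in> C" for C
    using that unfolding hull_kernel_closed_def Pr_def by blast
  have closedD: "P \<in> C" if "hull_kernel_closed C" "P \<in> Pr" "\<Inter>C \<subseteq> P" for C P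
    using that unfolding hull_kernel_closed_def Pr_def by blast
  have "hull_kernel_closed (Pr - S \<inter> T)"
    if S: "S \<subseteq> Pr" "hull_kernel_closed (Pr - S)" and T: "T \<subseteq> Pr" "hull_kernel_closed (Pr - T)" for S T
  proof (rule closedI)
    fix P assume P: "P \<in> Pr" "\<Inter>(Pr - S \<inter> T) \<subseteq> P"
    have "\<Inter>(Pr - S) \<subseteq> P \<or> \<Inter>(Pr - T) \<subseteq> P"
    proof (rule prime[OF P(1)])
      show "x * a \<in> \<Inter>(Pr - S)" if "x \<in> \<Inter>(Pr - S)" for a x
        using that ideal by blast
      show "x * y \<in> P" if "x \<in> \<Inter>(Pr - S)" "y \<in> \<Inter>(Pr - T)" for x y
      proof -
        have "x * y \<in> \<Inter>(Pr - S \<inter> T)"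
          using that ideal by blast
        then show ?thesis using P by blast
      qed
    qed
    then show "P \<in> Pr - S \<inter> T"
      using closedD[OF S(2) P(1)] closedD[OF T(2) P(1)] by blast
  qed auto
  moreover have "hull_kernel_closed (Pr - \<Union>\<U>)"
    if "\<forall>U\<in>\<U>. U \<subseteq> Pr \<and> hull_kernel_closed (Pr - U)" for \<U>
  proof (rule closedI)
    fix P assume P: "P \<in> Pr" "\<Inter>(Pr - \<Union>\<U>) \<subseteq> P"
    have "P \<in> Pr - U" if "U \<in> \<U>" for U
    proof (rule closedD[OF _ P(1)])
      show "\<Inter>(Pr - U) \<subseteq> P"
        using P that by blast
    qed (use that \<open>\<forall>U\<in>\<U>. U \<subseteq> Pr \<and> hull_kernel_closed (Pr - U)\<close> in blast)
    then show "P \<in> Pr - \<Union>\<U>"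
      using P by blast
  qed auto
  ultimately show ?thesis
    unfolding istopology_def Pr_def[symmetric] by (meson Sup_least inf.coboundedI1)
qed

lemma openin_jacobson:
  "openin jacobson_topology U \<longleftrightarrow> U \<subseteq> primitive_ideals \<and> hull_kernel_closed (primitive_ideals - U)"
  by (simp add: jacobson_topology_def istopology_jacobson)

lemma topspace_jacobson: "topspace jacobson_topology = primitive_ideals"
proof -
  have "hull_kernel_closed {}"
    using irreducible_representation.kernel_proper
    by (auto simp: hull_kernel_closed_def primitive_ideals_def)
  then have "openin jacobson_topology primitive_ideals"
    by (simp add: openin_jacobson)
  then show ?thesis
    by (meson openin_jacobson openin_subset openin_topspace subset_antisym)
qed

section \<open>Partial actions\<close>

text \<open>The group is written additively, as in \<^class>\<open>topological_group_add\<close>, but need not be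
  commutative. A partially defined map is given by a total function, of which only the values on
  the relevant domain matter; \<open>f t\<close> is defined on \<open>D (- t)\<close>.\<close>

definition topological_partial_action ::
    "'x::topological_space set \<Rightarrow> ('g::topological_group_add \<Rightarrow> 'x set) \<Rightarrow> ('g \<Rightarrow> 'x \<Rightarrow> 'x) \<Rightarrow> bool" where
  "topological_partial_action X D f \<longleftrightarrow>
     D 0 = X \<and> (\<forall>t. D t \<subseteq> X) \<and> (\<forall>t. bij_betw (f t) (D (- t)) (D t)) \<and>
     (\<forall>s t. \<forall>x\<in>D (- t). f t x \<in> D (- s) \<longrightarrow> x \<in> D (- (s + t)) \<and> f (s + t) x = f s (f t x)) \<and>
     (\<forall>U. openin (top_of_set X) U \<longrightarrow> open {t. U \<inter> D t \<noteq> {}}) \<and>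
     continuous_on {(t, x). x \<in> D (- t)} (\<lambda>(t, x). f t x)"

definition cstar_partial_action ::
    "'a::cstar_algebra set \<Rightarrow> ('g::topological_group_add \<Rightarrow> 'a set) \<Rightarrow> ('g \<Rightarrow> 'a \<Rightarrow> 'a) \<Rightarrow> bool" where
  "cstar_partial_action X D \<alpha> \<longleftrightarrow> cstar_subalgebra X \<and> topological_partial_action X D \<alpha> \<and>
     (\<forall>t. closed_ideal X (D t)) \<and> (\<forall>t. star_isomorphism (D (- t)) (D t) (\<alpha> t))"

definition cstar_action :: "('g::topological_group_add \<Rightarrow> 'b::cstar_algebra \<Rightarrow> 'b) \<Rightarrow> bool" where
  "cstar_action \<beta> \<longleftrightarrow> (\<forall>t. star_isomorphism UNIV UNIV (\<beta> t)) \<and>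
     (\<forall>b. \<beta> 0 b = b) \<and> (\<forall>s t b. \<beta> (s + t) b = \<beta> s (\<beta> t b)) \<and>
     continuous_on UNIV (\<lambda>(t, b). \<beta> t b)"

definition restriction_domain :: "('g \<Rightarrow> 'b \<Rightarrow> 'b) \<Rightarrow> 'b set \<Rightarrow> 'g \<Rightarrow> 'b set" where
  "restriction_domain \<beta> I t = I \<inter> \<beta> t ` I"

definition open_subgroup :: "'g::topological_group_add set \<Rightarrow> bool" where
  "open_subgroup H \<longleftrightarrow> open H \<and> 0 \<in> H \<and> (\<forall>s\<in>H. \<forall>t\<in>H. s + t \<in> H) \<and> (\<forall>t\<in>H. - t \<in> H)"

definition global_on :: "'g set \<Rightarrow> 'a set \<Rightarrow> ('g \<Rightarrow> 'a set) \<Rightarrow> bool" where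
  "global_on H X D \<longleftrightarrow> (\<forall>t\<in>H. D t = X)"

section \<open>Positive C*-trings\<close>

record ('a, 'e, 'b) bimodule =
  lact :: "'a \<Rightarrow> 'e \<Rightarrow> 'e"
  ract :: "'e \<Rightarrow> 'b \<Rightarrow> 'e"
  linner :: "'e \<Rightarrow> 'e \<Rightarrow> 'a"
  rinner :: "'e \<Rightarrow> 'e \<Rightarrow> 'b"

definition ideal_left :: "('a::cstar_algebra, 'e, 'b) bimodule \<Rightarrow> 'e set \<Rightarrow> 'a set" where
  "ideal_left E F = closure (cspan {linner E x y | x y. x \<in> F \<and> y \<in> F})"

definition ideal_right :: "('a, 'e, 'b::cstar_algebra) bimodule \<Rightarrow> 'e set \<Rightarrow> 'b set" where
  "ideal_right E F = closure (cspan {rinner E x y | x y. x \<in> F \<and> y \<in> F})"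

definition left_hilbert_module ::
    "'a::cstar_algebra set \<Rightarrow> ('a, 'e::complex_banach, 'b) bimodule \<Rightarrow> bool" where
  "left_hilbert_module A E \<longleftrightarrow>
     (\<forall>a\<in>A. clinear_on UNIV (lact E a)) \<and> (\<forall>x. clinear_on A (\<lambda>a. lact E a x)) \<and>
     (\<forall>a\<in>A. \<forall>b\<in>A. \<forall>x. lact E (a * b) x = lact E a (lact E b x)) \<and>
     (\<forall>x y. linner E x y \<in> A) \<and> (\<forall>y. clinear_on UNIV (\<lambda>x. linner E x y)) \<and>
     (\<forall>a\<in>A. \<forall>x y. linner E (lact E a x) y = a * linner E x y) \<and>
     (\<forall>x y. linner E y x = adj (linner E x y)) \<and>
     (\<forall>x. positive_in A (linner E x x)) \<and> (\<forall>x. (norm x)\<^sup>2 = norm (linner E x x))"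

definition right_hilbert_module ::
    "'b::cstar_algebra set \<Rightarrow> ('a, 'e::complex_banach, 'b) bimodule \<Rightarrow> bool" where
  "right_hilbert_module B E \<longleftrightarrow>
     (\<forall>b\<in>B. clinear_on UNIV (\<lambda>x. ract E x b)) \<and> (\<forall>x. clinear_on B (ract E x)) \<and>
     (\<forall>a\<in>B. \<forall>b\<in>B. \<forall>x. ract E x (a * b) = ract E (ract E x a) b) \<and>
     (\<forall>x y. rinner E x y \<in> B) \<and> (\<forall>x. clinear_on UNIV (rinner E x)) \<and>
     (\<forall>b\<in>B. \<forall>x y. rinner E x (ract E y b) = rinner E x y * b) \<and>
     (\<forall>x y. rinner E y x = adj (rinner E x y)) \<and>
     (\<forall>x. positive_in B (rinner E x x)) \<and> (\<forall>x. (norm x)\<^sup>2 = norm (rinner E x x))"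

text \<open>The underlying Banach space is the whole type \<^typ>\<open>'e\<close>, so completeness of the bimodule for
  the norm defined by the inner products is part of the class \<^class>\<open>complex_banach\<close>.\<close>

definition positive_tring ::
    "'a::cstar_algebra set \<Rightarrow> 'b::cstar_algebra set \<Rightarrow> ('a, 'e::complex_banach, 'b) bimodule \<Rightarrow> bool" where
  "positive_tring A B E \<longleftrightarrow> cstar_subalgebra A \<and> cstar_subalgebra B \<and>
     left_hilbert_module A E \<and> right_hilbert_module B E \<and>
     (\<forall>a\<in>A. \<forall>b\<in>B. \<forall>x. ract E (lact E a x) b = lact E a (ract E x b)) \<and>
     ideal_left E UNIV = A \<and> ideal_right E UNIV = B \<and>
     (\<forall>x y z. lact E (linner E x y) z = ract E x (rinner E y z))"

definition ternary :: "('a, 'e, 'b) bimodule \<Rightarrow> 'e \<Rightarrow> 'e \<Rightarrow> 'e \<Rightarrow> 'e" where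
  "ternary E x y z = lact E (linner E x y) z"

definition tring_ideal ::
    "'a set \<Rightarrow> 'b set \<Rightarrow> ('a, 'e::complex_banach, 'b) bimodule \<Rightarrow> 'e set \<Rightarrow> bool" where
  "tring_ideal A B E F \<longleftrightarrow> closed F \<and> csubspace F \<and>
     (\<forall>a\<in>A. \<forall>x\<in>F. lact E a x \<in> F) \<and> (\<forall>b\<in>B. \<forall>x\<in>F. ract E x b \<in> F)"

definition tring_isomorphism ::
    "('a, 'e::complex_banach, 'b) bimodule \<Rightarrow> 'e set \<Rightarrow> 'e set \<Rightarrow> ('e \<Rightarrow> 'e) \<Rightarrow> bool" where
  "tring_isomorphism E F F' \<pi> \<longleftrightarrow> bij_betw \<pi> F F' \<and> clinear_on F \<pi> \<and>
     (\<forall>x\<in>F. \<forall>y\<in>F. \<forall>z\<in>F. \<pi> (ternary E x y z) = ternary E (\<pi> x) (\<pi> y) (\<pi> z))"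

text \<open>\<open>induced_left E F F' \<pi> \<phi>\<close> means that \<open>\<phi>\<close> restricted to \<open>ideal_left E F\<close> is the *-isomorphism
  onto \<open>ideal_left E F'\<close> induced by \<open>\<pi>\<close>; it is determined by its values on inner products.\<close>

definition induced_left ::
    "('a::cstar_algebra, 'e, 'b) bimodule \<Rightarrow> 'e set \<Rightarrow> 'e set \<Rightarrow> ('e \<Rightarrow> 'e) \<Rightarrow> ('a \<Rightarrow> 'a) \<Rightarrow> bool" where
  "induced_left E F F' \<pi> \<phi> \<longleftrightarrow> star_isomorphism (ideal_left E F) (ideal_left E F') \<phi> \<and>
     (\<forall>x\<in>F. \<forall>y\<in>F. \<phi> (linner E x y) = linner E (\<pi> x) (\<pi> y))"

definition induced_right ::
    "('a, 'e, 'b::cstar_algebra) bimodule \<Rightarrow> 'e set \<Rightarrow> 'e set \<Rightarrow> ('e \<Rightarrow> 'e) \<Rightarrow> ('b \<Rightarrow> 'b) \<Rightarrow> bool" where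
  "induced_right E F F' \<pi> \<phi> \<longleftrightarrow> star_isomorphism (ideal_right E F) (ideal_right E F') \<phi> \<and>
     (\<forall>x\<in>F. \<forall>y\<in>F. \<phi> (rinner E x y) = rinner E (\<pi> x) (\<pi> y))"

definition tring_partial_action ::
    "'a::cstar_algebra set \<Rightarrow> 'b::cstar_algebra set \<Rightarrow> ('a, 'e::complex_banach, 'b) bimodule \<Rightarrow>
     ('g::topological_group_add \<Rightarrow> 'e set) \<Rightarrow> ('g \<Rightarrow> 'e \<Rightarrow> 'e) \<Rightarrow> bool" where
  "tring_partial_action A B E Et \<gamma> \<longleftrightarrow> topological_partial_action UNIV Et \<gamma> \<and>
     (\<forall>t. tring_ideal A B E (Et t)) \<and> (\<forall>t. tring_isomorphism E (Et (- t)) (Et t) (\<gamma> t))"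

section \<open>Morita enveloping actions\<close>

text \<open>HOL cannot quantify existentially over types inside a formula. The Banach space underlying
  the C*-tring is therefore a parameter; a theorem in which it occurs as a type variable in a
  hypothesis covers every choice of it.\<close>

definition morita_equivalent ::
    "'e::complex_banach itself \<Rightarrow>
     'a::cstar_algebra set \<Rightarrow> ('g::topological_group_add \<Rightarrow> 'a set) \<Rightarrow> ('g \<Rightarrow> 'a \<Rightarrow> 'a) \<Rightarrow>
     'b::cstar_algebra set \<Rightarrow> ('g \<Rightarrow> 'b set) \<Rightarrow> ('g \<Rightarrow> 'b \<Rightarrow> 'b) \<Rightarrow> bool" where
  "morita_equivalent _ A D \<alpha> B D' \<beta> \<longleftrightarrow>
     (\<exists>(E :: ('a, 'e, 'b) bimodule) Et \<gamma>. positive_tring A B E \<and> tring_partial_action A B E Et \<gamma> \<and>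
        (\<forall>t. D t = ideal_left E (Et t) \<and> induced_left E (Et (- t)) (Et t) (\<gamma> t) (\<alpha> t)) \<and>
        (\<forall>t. D' t = ideal_right E (Et t) \<and> induced_right E (Et (- t)) (Et t) (\<gamma> t) (\<beta> t)))"

definition morita_enveloping_action ::
    "'e::complex_banach itself \<Rightarrow>
     'a::cstar_algebra set \<Rightarrow> ('g::topological_group_add \<Rightarrow> 'a set) \<Rightarrow> ('g \<Rightarrow> 'a \<Rightarrow> 'a) \<Rightarrow>
     ('g \<Rightarrow> 'b::cstar_algebra \<Rightarrow> 'b) \<Rightarrow> bool" where
  "morita_enveloping_action T A D \<alpha> \<beta> \<longleftrightarrow> cstar_action \<beta> \<and>
     (\<exists>I. closed_ideal UNIV I \<and> closure (cspan {\<beta> t x | t x. x \<in> I}) = UNIV \<and>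
        morita_equivalent T A D \<alpha> I (restriction_domain \<beta> I) \<beta>)"

end

(* A primitive ideal P omits some c having a local unit e, that is c e = c; such a c lies in every closed
   ideal that meets the unit ball around e. By compactness finitely many pairs (c, e) are enough to avoid
   all primitive ideals. The set V of those t for which D_t meets the unit balls around these finitely many
   e is an open neighbourhood of the identity, and for t in V no primitive ideal contains D_t, so
   that D_t = A. Hence the t for which D_t and D_{-t} are both A form an open subgroup.

   The substance is that a proper closed ideal J is contained in a primitive ideal. In the unitization, the
   gauge of the cone of elements that are positive modulo J is a nonzero sublinear functional; a minimal
   sublinear functional that generates a face below it is an extreme linear functional, that is a
   pure state vanishing on J, and its GNS representation is irreducible. *)

theory Submission
  imports Defs
begin

text \<open>The openness condition on a partial action only yields elements of D_t near a prescribed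
  one, whereas avoiding P asks for an element of D_t outside P. Local units bridge this gap: if c e
  = c and b lies in D_t with norm (e - b) < 1, then c equals c (e - b)^n modulo D_t. Enough such c
  exist because the positive part of a - t has a local unit for every t > 0 and approximates the
  positive part of a. Order and functional calculus rest on a single square root iteration, and
  positive means square of a selfadjoint element; no spectra occur. Ideals are handled by cones and
  distances in the algebra itself, with no quotient C*-algebra. The state is chosen to attain the
  gauge at z^2, where z is selfadjoint and outside J. If m is this value, then z^2 / m acts as a
  unit under the state, so the cyclic vector is the class of an element of A. The GNS space is thus
  built over A and not over its unitization, and its vectors are functions on A, as
  \<open>primitive_ideals\<close> demands.\<close>

section \<open>Square roots in Banach algebras\<close>

text \<open>The limit \<open>rt y\<close> of the iteration is \<open>1 - sqrt (1 - y)\<close>. The scalar iteration for \<open>y = 1\<close> is a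
  majorant, so that \<open>norm y = 1\<close> is admissible and the square roots of noninvertible elements are covered.\<close>

fun rt_approx :: "'a::real_normed_algebra \<Rightarrow> nat \<Rightarrow> 'a" where
  "rt_approx y 0 = 0"
| "rt_approx y (Suc n) = (1/2) *\<^sub>R (y + rt_approx y n * rt_approx y n)"

definition rt :: "'a::real_normed_algebra \<Rightarrow> 'a" where
  "rt y = lim (rt_approx y)"

lemma rt_approx_commute:
  assumes "x * y = y * x" shows "x * rt_approx y n = rt_approx y n * x"
proof (induction n)
  case (Suc n)
  have "x * (rt_approx y n * rt_approx y n) = rt_approx y n * rt_approx y n * x"
    by (metis Suc mult.assoc)
  then show ?case by (simp add: assms algebra_simps)
qed simp

lemma rt_approx_one_le: "0 \<le> rt_approx (1::real) n" "rt_approx (1::real) n \<le> 1"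
proof (induction n)
  case (Suc n)
  { case 1 show ?case using Suc by simp }
  { case 2 show ?case using Suc mult_mono[of "rt_approx (1::real) n" 1 "rt_approx (1::real) n" 1] by simp }
qed auto

lemma norm_rt_approx_le:
  assumes "norm y \<le> 1" shows "norm (rt_approx y n) \<le> rt_approx 1 n"
proof (induction n)
  case (Suc n)
  have "norm (y + rt_approx y n * rt_approx y n) \<le> norm y + norm (rt_approx y n) * norm (rt_approx y n)"
    by (meson norm_triangle_le add_left_mono norm_mult_ineq order_trans)
  also have "\<dots> \<le> 1 + rt_approx 1 n * rt_approx 1 n"
    using assms Suc by (intro add_mono mult_mono) (auto simp: rt_approx_one_le)
  finally show ?case by simp
qed simp

text \<open>The iterates commute with \<open>y\<close> and with each other, so the difference of two
  squares factors, and the norms of the increments obey the recursion of the majorant as an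
  inequality.\<close>

lemma norm_rt_approx_diff_le:
  assumes "norm y \<le> 1"
  shows "norm (rt_approx y (Suc n) - rt_approx y n) \<le> rt_approx 1 (Suc n) - rt_approx 1 n"
proof (induction n)
  case 0 show ?case using assms by simp
next
  case (Suc n)
  let ?r = "rt_approx y (Suc n)" and ?s = "rt_approx y n"
  let ?a = "rt_approx (1::real) (Suc n)" and ?b = "rt_approx (1::real) n"
  have "?r * ?s = ?s * ?r"
    using rt_approx_commute rt_approx_commute[of y y] by metis
  then have "?r * ?r - ?s * ?s = (?r - ?s) * (?r + ?s)"
    by (simp add: algebra_simps)
  moreover have "rt_approx y (Suc (Suc n)) - ?r = (1/2) *\<^sub>R (?r * ?r - ?s * ?s)"
    by (simp only: rt_approx.simps(2)[of y "Suc n"] rt_approx.simps(2)[of y n] flip: scaleR_diff_right)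
       (simp add: algebra_simps)
  ultimately have "norm (rt_approx y (Suc (Suc n)) - ?r) = norm ((?r - ?s) * (?r + ?s)) / 2"
    by simp
  also have "\<dots> \<le> (?a - ?b) * (?a + ?b) / 2"
  proof -
    have "norm (?r + ?s) \<le> ?a + ?b"
      using norm_rt_approx_le[OF assms] by (meson norm_triangle_le add_mono)
    then have "norm (?r - ?s) * norm (?r + ?s) \<le> (?a - ?b) * (?a + ?b)"
      using Suc by (intro mult_mono order_trans[OF norm_ge_zero Suc] norm_ge_zero)
    then show ?thesis
      using norm_mult_ineq[of "?r - ?s" "?r + ?s"] by linarith
  qed
  also have "\<dots> = rt_approx 1 (Suc (Suc n)) - ?a"
    by (simp add: field_simps)
  finally show ?case .
qed

lemma norm_rt_approx_diff_le':
  assumes "norm y \<le> 1" "m \<le> n"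
  shows "norm (rt_approx y n - rt_approx y m) \<le> rt_approx 1 n - rt_approx 1 m"
  using assms(2)
proof (induction rule: dec_induct)
  case (step k)
  then show ?case
    using norm_triangle_ineq[of "rt_approx y (Suc k) - rt_approx y k" "rt_approx y k - rt_approx y m"]
      norm_rt_approx_diff_le[OF assms(1), of k] by simp
qed simp

lemma rt_approx_one_LIMSEQ: "rt_approx (1::real) \<longlonglongrightarrow> 1"
proof -
  have "incseq (rt_approx (1::real))"
  proof (rule incseq_SucI)
    \<comment> \<open>For \<open>y = 1\<close> the increment of the majorant dominates a norm, hence
      is nonnegative.\<close>
    fix n show "rt_approx (1::real) n \<le> rt_approx 1 (Suc n)"
      using norm_rt_approx_diff_le[of "1::real" n] norm_ge_zero order_trans by fastforce
  qed
  then obtain l where l: "rt_approx (1::real) \<longlonglongrightarrow> l"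
    using incseq_convergent[of "rt_approx (1::real)" 1] rt_approx_one_le by metis
  have "(\<lambda>n. rt_approx (1::real) (Suc n)) \<longlonglongrightarrow> (1/2) *\<^sub>R (1 + l * l)"
    unfolding rt_approx.simps by (intro tendsto_intros l)
  then have "l = (1/2) *\<^sub>R (1 + l * l)"
    using LIMSEQ_unique LIMSEQ_Suc[OF l] by blast
  then have "(l - 1) * (l - 1) = 0" by (simp add: algebra_simps)
  then show ?thesis using l by simp
qed

context
  fixes y :: "'a::{real_normed_algebra,banach}"
  assumes y: "norm y \<le> 1"
begin

lemma rt_LIMSEQ: "rt_approx y \<longlonglongrightarrow> rt y"
proof -
  have "Cauchy (rt_approx y)"
  proof (rule CauchyI)
    fix e :: real assume "e > 0"
    then obtain M where M: "\<And>m n. m \<ge> M \<Longrightarrow> n \<ge> M \<Longrightarrow> norm (rt_approx (1::real) m - rt_approx 1 n) < e"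
      using CauchyD[OF LIMSEQ_imp_Cauchy[OF rt_approx_one_LIMSEQ]] by blast
    have "norm (rt_approx y n - rt_approx y m) < e" if "m \<ge> M" "n \<ge> M" "m \<le> n" for m n
      using norm_rt_approx_diff_le'[OF y that(3)] M[of n m] that by simp
    then have "norm (rt_approx y m - rt_approx y n) < e" if "m \<ge> M" "n \<ge> M" for m n
      using that by (metis nat_le_linear norm_minus_commute)
    then show "\<exists>M. \<forall>m\<ge>M. \<forall>n\<ge>M. norm (rt_approx y m - rt_approx y n) < e" by blast
  qed
  then show ?thesis
    by (simp add: Cauchy_convergent_iff convergent_LIMSEQ_iff rt_def)
qed

lemma rt_in_closed:
  assumes "closed S" "0 \<in> S" "\<And>r. r \<in> S \<Longrightarrow> (1/2) *\<^sub>R (y + r * r) \<in> S"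
  shows "rt y \<in> S"
proof -
  have "rt_approx y n \<in> S" for n
    by (induction n) (use assms in auto)
  then show ?thesis
    using closed_sequentially[OF assms(1)] rt_LIMSEQ by blast
qed

lemma rt_equation: "2 *\<^sub>R rt y - rt y * rt y = y"
proof -
  have "(\<lambda>n. rt_approx y (Suc n)) \<longlonglongrightarrow> (1/2) *\<^sub>R (y + rt y * rt y)"
    unfolding rt_approx.simps by (intro tendsto_intros rt_LIMSEQ)
  then have "rt y = (1/2) *\<^sub>R (y + rt y * rt y)"
    using LIMSEQ_unique LIMSEQ_Suc[OF rt_LIMSEQ] by blast
  then have "2 *\<^sub>R rt y = 2 *\<^sub>R (1/2) *\<^sub>R (y + rt y * rt y)" by simp
  then show ?thesis by simp
qed

lemma norm_rt_le: "norm (rt y) \<le> 1"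
  by (rule LIMSEQ_le_const2[OF tendsto_norm[OF rt_LIMSEQ]])
     (use norm_rt_approx_le[OF y] rt_approx_one_le order_trans in blast)

lemma rt_commute:
  assumes "x * y = y * x" shows "x * rt y = rt y * x"
proof (rule LIMSEQ_unique)
  show "(\<lambda>n. x * rt_approx y n) \<longlonglongrightarrow> x * rt y"
    by (rule tendsto_mult_left[OF rt_LIMSEQ])
  show "(\<lambda>n. x * rt_approx y n) \<longlonglongrightarrow> rt y * x"
    using tendsto_mult_right[OF rt_LIMSEQ] by (simp only: rt_approx_commute[OF assms])
qed

text \<open>The bound does not depend on \<open>y\<close>, so the convergence is uniform on the unit
  ball and \<open>rt\<close> is continuous there.\<close>

lemma norm_rt_approx_le_tail: "norm (rt y - rt_approx y n) \<le> 1 - rt_approx 1 n"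
proof (rule LIMSEQ_le)
  show "(\<lambda>m. norm (rt_approx y m - rt_approx y n)) \<longlonglongrightarrow> norm (rt y - rt_approx y n)"
    by (intro tendsto_intros rt_LIMSEQ)
  show "(\<lambda>m. rt_approx (1::real) m - rt_approx 1 n) \<longlonglongrightarrow> 1 - rt_approx 1 n"
    by (rule tendsto_diff[OF rt_approx_one_LIMSEQ tendsto_const])
  show "\<exists>N. \<forall>m\<ge>N. norm (rt_approx y m - rt_approx y n) \<le> rt_approx 1 m - rt_approx 1 n"
    using norm_rt_approx_diff_le'[OF y] by blast
qed

end

lemma continuous_on_rt: "continuous_on (cball 0 1) (rt :: 'a::{real_normed_algebra,banach} \<Rightarrow> 'a)"
proof (rule uniform_limit_theorem[where F = sequentially and f = "\<lambda>n y. rt_approx y n"])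
  have "continuous_on (cball 0 1) (\<lambda>y::'a. rt_approx y n)" for n
    by (induction n) (auto intro!: continuous_intros simp del: rt_approx.simps(2) simp: rt_approx.simps(2)[abs_def])
  then show "\<forall>\<^sub>F n in sequentially. continuous_on (cball 0 1) (\<lambda>y::'a. rt_approx y n)" by simp
  show "uniform_limit (cball 0 1) (\<lambda>n y::'a. rt_approx y n) rt sequentially"
  proof (rule uniform_limitI)
    fix e :: real assume "e > 0"
    then have "\<forall>\<^sub>F n in sequentially. dist (rt_approx (1::real) n) 1 < e"
      using rt_approx_one_LIMSEQ by (simp add: tendsto_iff)
    then show "\<forall>\<^sub>F n in sequentially. \<forall>y\<in>cball 0 1. dist (rt_approx (y::'a) n) (rt y) < e"
    proof eventually_elim
      case (elim n)
      show ?case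
      proof
        fix y :: 'a assume "y \<in> cball 0 1"
        then show "dist (rt_approx y n) (rt y) < e"
          using norm_rt_approx_le_tail[of y n] elim rt_approx_one_le[of n]
          by (auto simp: dist_norm norm_minus_commute)
      qed
    qed
  qed
qed simp

section \<open>Positive elements\<close>

lemma scaleC_diff_right: "c *\<^sub>C (x - y) = c *\<^sub>C x - c *\<^sub>C y"
  by (rule complex_vector.scale_right_diff_distrib)

lemma adj_0 [simp]: "adj 0 = 0"
  using adj_scaleC[of 0 0] by simp

lemma adj_minus [simp]: "adj (- x) = - adj x"
  using adj_add[of x "- x"] by (simp add: eq_neg_iff_add_eq_0 add.commute)

lemma adj_diff: "adj (x - y) = adj x - adj y"
  using adj_add[of x "- y"] by simp

lemma adj_scaleR [simp]: "adj (r *\<^sub>R x) = r *\<^sub>R adj x"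
  using adj_scaleC[of "complex_of_real r" x] by (simp add: scaleC_of_real)

lemma norm_adj [simp]: "norm (adj x) = norm (x :: 'a::cstar_algebra)"
proof -
  have *: "norm x \<le> norm (adj x)" for x :: 'a
  proof (cases "x = 0")
    case False
    have "norm x * norm x \<le> norm (adj x) * norm x"
      using cstar_identity[of x] norm_mult_ineq[of "adj x" x] by (simp add: power2_eq_square)
    then show ?thesis using False by simp
  qed simp
  show ?thesis
    using *[of x] *[of "adj x"] by (simp add: adj_adj)
qed

lemma bounded_linear_adj: "bounded_linear adj"
  by (rule bounded_linear_intro[of _ 1]) (auto simp: adj_add)

lemma continuous_on_adj [continuous_intros]: "continuous_on S f \<Longrightarrow> continuous_on S (\<lambda>x. adj (f x))"
  by (rule bounded_linear.continuous_on[OF bounded_linear_adj])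

lemma closed_selfadj: "closed {x. adj x = x}"
  by (intro closed_Collect_eq continuous_intros)

lemma norm_selfadj_square:
  assumes "adj h = h" shows "norm (h * h) = (norm h)\<^sup>2"
  using cstar_identity[of h] assms by simp

lemma selfadj_rt:
  assumes "norm y \<le> 1" "adj y = y" shows "adj (rt y) = rt y"
proof -
  have "rt y \<in> {x. adj x = x}"
    by (rule rt_in_closed[OF assms(1) closed_selfadj]) (auto simp: adj_add adj_mult assms(2))
  then show ?thesis by simp
qed

lemma cartesian_decomposition:
  obtains h k where "adj h = h" "adj k = k" "x = h + \<i> *\<^sub>C k"
proof
  let ?h = "(1/2) *\<^sub>R (x + adj x)" and ?k = "(- \<i>/2) *\<^sub>C (x - adj x)"
  show "adj ?h = ?h" by (simp add: adj_add adj_adj add.commute)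
  show "adj ?k = ?k"
    by (simp add: adj_scaleC adj_diff adj_adj scaleC_diff_right)
  have "\<i> *\<^sub>C ?k = (1/2) *\<^sub>R (x - adj x)"
    using scaleC_of_real[of "1/2" "x - adj x"] by (simp add: scaleC_scaleC)
  then show "x = ?h + \<i> *\<^sub>C ?k"
    by (simp add: algebra_simps flip: scaleR_left.add)
qed

lemma adj_1 [simp]: "adj (1 :: 'a::{cstar_algebra,real_normed_algebra_1}) = 1"
  by (metis adj_adj adj_mult mult_1_right mult_1_left)

lemma adj_power: "adj (x ^ n) = adj (x :: 'a::{cstar_algebra,real_normed_algebra_1}) ^ n"
  by (induction n) (simp_all add: adj_mult power_commutes)

text \<open>For the normal element u = h + i k the sum of the squares is \<open>adj u * u\<close>,
  and h is the real part of u, so its norm is at most that of u.\<close>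

lemma norm_commuting_squares:
  fixes h k :: "'a::cstar_algebra"
  assumes "adj h = h" "adj k = k" "h * k = k * h"
  shows "(norm h)\<^sup>2 \<le> norm (h * h + k * k)"
proof -
  let ?u = "h + \<i> *\<^sub>C k"
  have adj_u: "adj ?u = h - \<i> *\<^sub>C k"
    using assms by (simp add: adj_add adj_scaleC)
  have "\<i> *\<^sub>C \<i> *\<^sub>C (k * k) = - (k * k)"
    using scaleC_of_real[of "-1" "k * k"] by (simp add: scaleC_scaleC)
  then have "adj ?u * ?u = h * h + k * k"
    unfolding adj_u using assms(3) by (simp add: algebra_simps mult_scaleC_left mult_scaleC_right)
  moreover have "norm h \<le> norm ?u"
  proof -
    have "?u + adj ?u = 2 *\<^sub>R h"
      unfolding adj_u by (simp add: scaleR_2)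
    then have "2 * norm h \<le> norm ?u + norm (adj ?u)"
      using norm_triangle_ineq[of ?u "adj ?u"] by simp
    then show ?thesis unfolding norm_adj by simp
  qed
  ultimately show ?thesis
    by (metis cstar_identity norm_ge_zero power_mono)
qed

lemma exists_sqrt:
  fixes y :: "'a::{cstar_algebra,real_normed_algebra_1}"
  assumes "norm y \<le> 1" "adj y = y"
  obtains s where "adj s = s" "s * s = 1 - y" "norm (1 - s) \<le> 1" "\<And>x. x * y = y * x \<Longrightarrow> x * s = s * x"
proof
  show "adj (1 - rt y) = 1 - rt y"
    by (simp add: adj_diff selfadj_rt assms)
  show "(1 - rt y) * (1 - rt y) = 1 - y"
    using rt_equation[OF assms(1)] by (simp add: algebra_simps scaleR_2)
  show "norm (1 - (1 - rt y)) \<le> 1"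
    by (simp add: norm_rt_le assms)
  show "x * (1 - rt y) = (1 - rt y) * x" if "x * y = y * x" for x
    using rt_commute[OF assms(1) that] by (simp add: algebra_simps)
qed

text \<open>A root s of 1 - h^2 commutes with h and the two squares sum to 1; a square has no larger
  norm than a sum of commuting squares. This does the work of the spectral mapping theorem.\<close>

lemma norm_one_minus_square:
  fixes h :: "'a::{cstar_algebra,real_normed_algebra_1}"
  assumes "adj h = h" "norm h \<le> 1"
  shows "norm (1 - h * h) \<le> 1"
proof -
  have "norm (h * h) \<le> 1"
    using assms by (simp add: norm_selfadj_square power_le_one)
  then obtain s where s: "adj s = s" "s * s = 1 - h * h" "h * s = s * h"
    using exists_sqrt[of "h * h"] assms(1) by (metis adj_mult mult.assoc)
  have "norm (s * s) \<le> norm (s * s + h * h)"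
    using norm_commuting_squares[OF s(1) assms(1) s(3)[symmetric]] norm_selfadj_square[OF s(1)] by simp
  then show ?thesis unfolding s(2) by simp
qed

text \<open>Squares of selfadjoint elements are taken because the iteration produces such roots;
  that every \<open>adj x * x\<close> qualifies is the hard part,
  \<open>pos_adj_mult_self\<close>.\<close>

definition pos :: "'a::cstar_algebra \<Rightarrow> bool" where
  "pos a \<longleftrightarrow> (\<exists>h. adj h = h \<and> a = h * h)"

lemma pos_selfadj: "pos a \<Longrightarrow> adj a = a"
  by (auto simp: pos_def adj_mult)

lemma pos_0 [simp]: "pos 0"
  unfolding pos_def by (rule exI[of _ 0]) simp

lemma pos_1 [simp]: "pos (1 :: 'a::{cstar_algebra,real_normed_algebra_1})"
  unfolding pos_def by (rule exI[of _ 1]) simp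

lemma pos_scaleR:
  assumes "pos a" "0 \<le> t" shows "pos (t *\<^sub>R a)"
proof -
  obtain h where "adj h = h" "a = h * h"
    using assms by (auto simp: pos_def)
  then show ?thesis
    unfolding pos_def using assms(2) by (intro exI[of _ "sqrt t *\<^sub>R h"]) simp
qed

lemma pos_selfadj_square: "adj h = h \<Longrightarrow> pos (h * h)"
  by (auto simp: pos_def)

text \<open>One half of a norm criterion for positivity, with converse \<open>posI_norm\<close>. A
  norm inequality passes to sums, which squares do not, and so the criterion makes the positive
  elements a convex cone.\<close>

lemma norm_diff_pos_le:
  fixes a :: "'a::{cstar_algebra,real_normed_algebra_1}"
  assumes "pos a" "norm a \<le> t" shows "norm (t *\<^sub>R 1 - a) \<le> t"
proof (cases "t = 0")
  case False
  then have t: "t > 0" using assms(2) norm_ge_zero[of a] by linarith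
  obtain h where h: "adj h = h" "a = h * h"
    using assms by (auto simp: pos_def)
  let ?k = "(1 / sqrt t) *\<^sub>R h"
  have "(norm h)\<^sup>2 \<le> t"
    using assms h norm_selfadj_square by metis
  then have "norm h \<le> sqrt t"
    using real_le_rsqrt by blast
  then have "norm ?k \<le> 1"
    using t by (simp add: divide_simps)
  then have "norm (1 - ?k * ?k) \<le> 1"
    by (intro norm_one_minus_square) (auto simp: h)
  moreover have "t *\<^sub>R 1 - a = t *\<^sub>R (1 - ?k * ?k)"
    using t by (simp add: h algebra_simps)
  ultimately show ?thesis
    using t by simp
qed (use assms in auto)

text \<open>After rescaling, 1 - a / t is in the unit ball, where \<open>rt\<close> is defined. The
  norm bound on the root, fed back into the criterion, makes the root itself positive.\<close>

lemma pos_root_of_norm_le: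
  fixes a :: "'a::{cstar_algebra,real_normed_algebra_1}"
  assumes "adj a = a" "norm (t *\<^sub>R 1 - a) \<le> t"
  obtains h where "adj h = h" "h * h = a" "norm (sqrt t *\<^sub>R 1 - h) \<le> sqrt t" "\<And>x. x * a = a * x \<Longrightarrow> x * h = h * x"
proof (cases "t = 0")
  case True
  then show ?thesis using that[of 0] assms by simp
next
  case False
  then have t: "t > 0" using assms(2) norm_ge_zero[of "t *\<^sub>R 1 - a"] by linarith
  let ?y = "1 - (1/t) *\<^sub>R a"
  have "?y = (1/t) *\<^sub>R (t *\<^sub>R 1 - a)"
    using t by (simp add: algebra_simps)
  then have "norm ?y = norm (t *\<^sub>R 1 - a) / t"
    using t by simp
  then have y: "norm ?y \<le> 1" "adj ?y = ?y"
    using t assms by (simp_all add: adj_diff)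
  then obtain s where s: "adj s = s" "s * s = 1 - ?y" "norm (1 - s) \<le> 1"
      "\<And>x. x * ?y = ?y * x \<Longrightarrow> x * s = s * x"
    by (rule exists_sqrt) blast
  show ?thesis
  proof (rule that[of "sqrt t *\<^sub>R s"])
    show "(sqrt t *\<^sub>R s) * (sqrt t *\<^sub>R s) = a"
      using t s(2) by simp
    have "sqrt t *\<^sub>R 1 - sqrt t *\<^sub>R s = sqrt t *\<^sub>R (1 - s)"
      by (simp add: algebra_simps)
    then show "norm (sqrt t *\<^sub>R 1 - sqrt t *\<^sub>R s) \<le> sqrt t"
      using s(3) t by simp
    show "x * sqrt t *\<^sub>R s = sqrt t *\<^sub>R s * x" if "x * a = a * x" for x
      using s(4)[of x] that by (simp add: algebra_simps)
  qed (simp add: s(1))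
qed

lemma posI_norm:
  fixes a :: "'a::{cstar_algebra,real_normed_algebra_1}"
  assumes "adj a = a" "norm (t *\<^sub>R 1 - a) \<le> t" shows "pos a"
  using pos_root_of_norm_le[OF assms] by (metis pos_def)

lemma pos_root:
  fixes a :: "'a::{cstar_algebra,real_normed_algebra_1}"
  assumes "pos a"
  obtains h where "pos h" "h * h = a" "\<And>x. x * a = a * x \<Longrightarrow> x * h = h * x"
  using pos_root_of_norm_le[OF pos_selfadj[OF assms] norm_diff_pos_le[OF assms order_refl]] posI_norm
  by metis

lemma pos_add:
  fixes a b :: "'a::{cstar_algebra,real_normed_algebra_1}"
  assumes "pos a" "pos b" shows "pos (a + b)"
proof (rule posI_norm)
  show "adj (a + b) = a + b"
    using assms by (simp add: adj_add pos_selfadj)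
  have "(norm a + norm b) *\<^sub>R 1 - (a + b) = (norm a *\<^sub>R 1 - a) + (norm b *\<^sub>R 1 - b)"
    by (simp add: algebra_simps)
  then show "norm ((norm a + norm b) *\<^sub>R 1 - (a + b)) \<le> norm a + norm b"
    using norm_diff_pos_le[OF assms(1) order_refl] norm_diff_pos_le[OF assms(2) order_refl]
    by (metis norm_triangle_mono)
qed

lemma pos_diff_of_norm_le:
  fixes a :: "'a::{cstar_algebra,real_normed_algebra_1}"
  assumes "adj a = a" "norm a \<le> t" shows "pos (t *\<^sub>R 1 - a)"
  by (rule posI_norm[of _ t]) (use assms in \<open>auto simp: adj_diff\<close>)

text \<open>Each root commutes with whatever commutes with its square, so the roots h and k commute
  and the product is the square of h k.\<close>

lemma pos_mult_commute:
  fixes a b :: "'a::{cstar_algebra,real_normed_algebra_1}"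
  assumes "pos a" "pos b" "a * b = b * a" shows "pos (a * b)"
proof -
  obtain h where h: "pos h" "h * h = a" "\<And>x. x * a = a * x \<Longrightarrow> x * h = h * x"
    using assms pos_root by metis
  obtain k where k: "pos k" "k * k = b" "\<And>x. x * b = b * x \<Longrightarrow> x * k = k * x"
    using assms pos_root by metis
  have hk: "h * k = k * h"
    using h k assms(3) by metis
  have "a * b = (h * k) * (h * k)"
    unfolding h(2)[symmetric] k(2)[symmetric] using hk by (metis mult.assoc)
  then show ?thesis
    using hk pos_selfadj[OF h(1)] pos_selfadj[OF k(1)] by (metis adj_mult pos_def)
qed

lemma pos_power:
  fixes a :: "'a::{cstar_algebra,real_normed_algebra_1}"
  assumes "pos a" shows "pos (a ^ n)"
  by (induction n) (auto intro!: pos_mult_commute assms simp: power_commutes)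

lemma norm_le_add_commuting_pos:
  fixes a b :: "'a::{cstar_algebra,real_normed_algebra_1}"
  assumes "pos a" "pos b" "a * b = b * a" shows "norm a \<le> norm (a + b)"
proof -
  obtain h where h: "pos h" "h * h = a" "\<And>x. x * a = a * x \<Longrightarrow> x * h = h * x"
    using assms pos_root by metis
  obtain k where k: "pos k" "k * k = b" "\<And>x. x * b = b * x \<Longrightarrow> x * k = k * x"
    using assms pos_root by metis
  have hk: "h * k = k * h"
    using h k assms(3) by metis
  then show ?thesis
    using norm_commuting_squares[of h k] h k pos_selfadj norm_selfadj_square by metis
qed

text \<open>For \<open>v\<close> of norm 1 put \<open>w = v * adj v\<close> and \<open>z = - (adj v * v)\<close>. If \<open>z\<close> is positive, then so is \<open>w\<close>, and
  \<open>adj v * (1 - w)\<^sup>2 * v = - z * (1 + z)\<^sup>2\<close> has norm at most 1 although \<open>2 * z\<^sup>2\<close> has norm 2.\<close>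

lemma eq_0_if_neg_square_pos:
  fixes y :: "'a::{cstar_algebra,real_normed_algebra_1}"
  assumes "pos (- (adj y * y))" shows "y = 0"
proof (rule ccontr)
  assume "y \<noteq> 0"
  define v where "v = (1 / norm y) *\<^sub>R y"
  define w where "w = v * adj v"
  define z where "z = - (adj v * v)"
  have v: "norm v = 1"
    using \<open>y \<noteq> 0\<close> by (simp add: v_def)
  have "z = (1 / (norm y)\<^sup>2) *\<^sub>R (- (adj y * y))"
    by (simp add: z_def v_def power2_eq_square)
  then have z: "pos z"
    using assms pos_scaleR[of "- (adj y * y)" "1 / (norm y)\<^sup>2"] by simp
  have norm_z: "norm z = 1" and norm_w: "norm w = 1"
    using cstar_identity[of v] cstar_identity[of "adj v"] v by (simp_all add: z_def w_def adj_adj)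
  \<comment> \<open>Here w - z is \<open>v * adj v + adj v * v\<close>, which for v = h + i k is 2
    h^2 + 2 k^2.\<close>
  have w: "pos w"
  proof -
    obtain h k where hk: "adj h = h" "adj k = k" "v = h + \<i> *\<^sub>C k"
      by (rule cartesian_decomposition)
    have "\<i> *\<^sub>C \<i> *\<^sub>C (k * k) = - (k * k)"
      using scaleC_of_real[of "-1" "k * k"] by (simp add: scaleC_scaleC)
    then have "w - z = 2 *\<^sub>R (h * h) + 2 *\<^sub>R (k * k)"
      by (simp add: w_def z_def hk adj_add adj_scaleC algebra_simps mult_scaleC_left mult_scaleC_right scaleR_2)
    then have "pos (w - z)"
      using hk by (simp add: pos_add pos_scaleR pos_selfadj_square)
    then show ?thesis
      using pos_add z by fastforce
  qed
  have "norm (1 - w) \<le> 1"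
    using norm_diff_pos_le[OF w, of 1] norm_w by simp
  have "adj v * (1 - w) = (1 + z) * adj v"
    by (simp add: w_def z_def algebra_simps)
  then have "adj v * ((1 - w) * (1 - w)) * v = (1 + z) * (1 + z) * (adj v * v)"
    by (metis mult.assoc)
  also have "\<dots> = - (2 *\<^sub>R (z * z) + (z + z * z * z))"
  proof -
    have "adj v * v = - z" by (simp add: z_def)
    then show ?thesis by (simp add: algebra_simps scaleR_2)
  qed
  finally have "norm (2 *\<^sub>R (z * z) + (z + z * z * z)) = norm (adj v * ((1 - w) * (1 - w)) * v)"
    by (metis norm_minus_cancel)
  also have "\<dots> \<le> 1 * (1 * 1) * 1"
    by (intro order_trans[OF norm_mult_ineq] mult_mono)
       (use v \<open>norm (1 - w) \<le> 1\<close> in auto)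
  finally have "norm (2 *\<^sub>R (z * z) + (z + z * z * z)) \<le> 1"
    by simp
  \<comment> \<open>The rest z + z^3 is positive and commutes with z^2, so leaving it out does not
    increase the norm.\<close>
  moreover have "norm (2 *\<^sub>R (z * z)) \<le> norm (2 *\<^sub>R (z * z) + (z + z * z * z))"
  proof (rule norm_le_add_commuting_pos)
    show "pos (2 *\<^sub>R (z * z))"
      using z by (intro pos_scaleR pos_selfadj_square pos_selfadj) auto
    have "pos (z ^ 3)" by (rule pos_power[OF z])
    then show "pos (z + z * z * z)"
      using z by (intro pos_add) (auto simp: power3_eq_cube)
  qed (simp add: algebra_simps)
  moreover have "norm (2 *\<^sub>R (z * z)) = 2"
    using norm_selfadj_square[OF pos_selfadj[OF z]] norm_z by simp
  ultimately show False by linarith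
qed

text \<open>Let m be the absolute value of \<open>b = adj x * x\<close>. Then d = m - b is twice the
  negative part of b, and \<open>adj (x * d) * (x * d)\<close> is d b d = - d m d, the negative of
  the square of k d with k^2 = m. The preceding lemma gives x d = 0, and from this d = 0.\<close>

lemma pos_adj_mult_self:
  fixes x :: "'a::{cstar_algebra,real_normed_algebra_1}"
  shows "pos (adj x * x)"
proof -
  define b where "b = adj x * x"
  have b: "adj b = b" by (simp add: b_def adj_mult adj_adj)
  obtain m where m: "pos m" "m * m = b * b" "\<And>x. x * (b * b) = (b * b) * x \<Longrightarrow> x * m = m * x"
    using pos_root[OF pos_selfadj_square[OF b]] by metis
  have bm: "b * m = m * b"
    by (rule m(3)) (simp add: mult.assoc)
  obtain k where k: "pos k" "k * k = m" "\<And>x. x * m = m * x \<Longrightarrow> x * k = k * x"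
    using pos_root[OF m(1)] by metis
  define d where "d = m - b"
  have d: "adj d = d"
    by (simp add: d_def adj_diff b pos_selfadj m(1))
  have "d * m = m * d"
    by (simp add: d_def algebra_simps bm)
  then have dk: "d * k = k * d"
    by (rule k(3))
  have db: "d * b = - (d * m)" "b * d = - (m * d)"
    by (simp_all add: d_def algebra_simps m(2) bm)
  have kd: "adj (k * d) = k * d"
    using dk by (simp add: adj_mult d pos_selfadj k(1))
  have dmd: "d * m * d = (k * d) * (k * d)"
    unfolding k(2)[symmetric] using dk by (metis mult.assoc)
  have "adj (x * d) * (x * d) = d * b * d"
    by (simp add: adj_mult d b_def mult.assoc)
  also have "\<dots> = - (k * d * (k * d))"
    by (simp add: db dmd)
  finally have eq: "adj (x * d) * (x * d) = - (k * d * (k * d))" .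
  then have "x * d = 0"
    using kd pos_selfadj_square[OF kd] by (intro eq_0_if_neg_square_pos) simp
  then have "k * d = 0"
    using eq norm_selfadj_square[OF kd] by simp
  then have "m * d = 0"
    by (metis k(2) mult.assoc mult_zero_right)
  then have "d * d = 0"
    using db(2) by (simp add: d_def left_diff_distrib)
  then have "d = 0"
    using norm_selfadj_square[OF d] by simp
  then show ?thesis
    using m(1) by (simp add: b_def d_def)
qed

lemma pos_conj:
  fixes a :: "'a::{cstar_algebra,real_normed_algebra_1}"
  assumes "pos a" shows "pos (adj x * a * x)"
proof -
  obtain h where "adj h = h" "a = h * h"
    using assms by (auto simp: pos_def)
  then have "adj x * a * x = adj (h * x) * (h * x)"
    by (simp add: adj_mult mult.assoc)
  then show ?thesis by (simp add: pos_adj_mult_self)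
qed

text \<open>The elements a and b need not commute, but a commutes with norm b - a, which is positive
  because b is below its norm.\<close>

lemma norm_mono_pos:
  fixes a b :: "'a::{cstar_algebra,real_normed_algebra_1}"
  assumes "pos a" "pos (b - a)" shows "norm a \<le> norm b"
proof -
  have "adj b = b"
    using pos_selfadj[OF pos_add[OF assms]] by simp
  then have "pos (norm b *\<^sub>R 1 - b)"
    by (simp add: pos_diff_of_norm_le)
  then have "pos (norm b *\<^sub>R 1 - a)"
    using pos_add[OF assms(2)] by fastforce
  then have "norm a \<le> norm (a + (norm b *\<^sub>R 1 - a))"
    using assms(1) by (intro norm_le_add_commuting_pos) (auto simp: algebra_simps)
  then show ?thesis by simp
qed

text \<open>For a number q in [0,1], 1 - (1 - q)^n is q times the sum of the (1 - q)^k with k < n,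
  hence at least n q (1 - q)^n. The induction carries this over to the operator order.\<close>

lemma norm_mult_one_minus_power_le:
  fixes q :: "'a::{cstar_algebra,real_normed_algebra_1}"
  assumes "pos q" "norm q \<le> 1"
  shows "real n * norm (q * (1 - q) ^ n) \<le> 1"
proof -
  have p: "pos (1 - q)"
    using pos_diff_of_norm_le[of q 1] assms by (simp add: pos_selfadj)
  have comm: "q * (1 - q) ^ n = (1 - q) ^ n * q" for n
    by (rule power_commuting_commutes[symmetric]) (simp add: algebra_simps)
  have qp: "pos (q * (1 - q) ^ n)" for n
    by (intro pos_mult_commute assms pos_power p comm)
  have "pos (1 - (1 - q) ^ n - real n *\<^sub>R (q * (1 - q) ^ n))"
  proof (induction n)
    case (Suc n)
    have "pos (q * (q * (1 - q) ^ n))"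
      by (rule pos_mult_commute[OF assms(1) qp]) (simp only: comm[symmetric] mult.assoc)
    then have "pos ((1 - (1 - q) ^ n - real n *\<^sub>R (q * (1 - q) ^ n)) + real (Suc n) *\<^sub>R (q * (q * (1 - q) ^ n)))"
      by (intro pos_add Suc pos_scaleR) auto
    moreover have "(1 - (1 - q) ^ n - real n *\<^sub>R (q * (1 - q) ^ n)) + real (Suc n) *\<^sub>R (q * (q * (1 - q) ^ n))
      = 1 - (1 - q) ^ Suc n - real (Suc n) *\<^sub>R (q * (1 - q) ^ Suc n)"
      by (simp add: algebra_simps)
    ultimately show ?case by metis
  qed simp
  then have "pos (1 - real n *\<^sub>R (q * (1 - q) ^ n))"
    using pos_add[OF _ pos_power[OF p, of n]] by fastforce
  then have "norm (real n *\<^sub>R (q * (1 - q) ^ n)) \<le> norm (1 :: 'a)"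
    by (intro norm_mono_pos pos_scaleR qp) auto
  then show ?thesis by simp
qed

section \<open>Closed ideals and the approximate units 1 - (1 - q)^n\<close>

lemma closed_ideal_mem:
  assumes "closed_ideal X J"
  shows "0 \<in> J" "x \<in> J \<Longrightarrow> y \<in> J \<Longrightarrow> x + y \<in> J" "x \<in> J \<Longrightarrow> y \<in> J \<Longrightarrow> x - y \<in> J" "x \<in> J \<Longrightarrow> - x \<in> J"
    "x \<in> J \<Longrightarrow> r *\<^sub>R x \<in> J" "x \<in> J \<Longrightarrow> c *\<^sub>C x \<in> J" "a \<in> X \<Longrightarrow> x \<in> J \<Longrightarrow> a * x \<in> J" "a \<in> X \<Longrightarrow> x \<in> J \<Longrightarrow> x * a \<in> J" "closed J"
  using assms complex_vector.subspace_0 complex_vector.subspace_add complex_vector.subspace_diff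
    complex_vector.subspace_neg complex_vector.subspace_scale scaleC_of_real[of r x]
  unfolding closed_ideal_def by metis+

lemma one_minus_power_in_ideal:
  fixes q :: "'a::{cstar_algebra,real_normed_algebra_1}"
  assumes J: "closed_ideal UNIV J" and "q \<in> J" shows "1 - (1 - q) ^ n \<in> J"
proof (induction n)
  case (Suc n)
  have "1 - (1 - q) ^ Suc n = (1 - (1 - q) ^ n) + q * (1 - q) ^ n"
    by (simp add: algebra_simps)
  then show ?case
    using Suc closed_ideal_mem[OF J] assms(2) by (metis UNIV_I)
qed (use closed_ideal_mem[OF J] in simp)

lemma tendsto_le_inverse_square:
  assumes "\<And>n. real n * (f n)\<^sup>2 \<le> 1" "\<And>n. 0 \<le> f n" shows "f \<longlonglongrightarrow> 0"
proof -
  have "f n \<le> sqrt (1 / real n)" if "n > 0" for n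
    using assms(1)[of n] that by (intro real_le_rsqrt) (simp add: field_simps)
  moreover have "(\<lambda>n. sqrt (1 / real n)) \<longlonglongrightarrow> sqrt 0"
    by (intro tendsto_intros lim_1_over_n)
  ultimately show ?thesis
    using assms(2) by (intro tendsto_sandwich[OF _ _ tendsto_const, of 0 f])
      (auto intro: eventually_sequentiallyI[of 1])
qed

text \<open>For \<open>q = adj x * x\<close> in J the elements 1 - (1 - q)^n lie in J, and their
  products with \<open>adj x\<close> on the right tend to \<open>adj x\<close>.\<close>

lemma closed_ideal_adj:
  fixes x :: "'a::{cstar_algebra,real_normed_algebra_1}"
  assumes J: "closed_ideal UNIV J" and "x \<in> J" shows "adj x \<in> J"
proof -
  have *: "adj x \<in> J" if "x \<in> J" "norm x \<le> 1" for x
  proof -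
    define q where "q = adj x * x"
    define E where "E n = (1 - q) ^ n" for n
    have q: "pos q" "norm q \<le> 1" "q \<in> J"
      using that cstar_identity[of x] closed_ideal_mem[OF J]
      by (auto simp: q_def pos_adj_mult_self power_le_one)
    have E: "adj (E n) = E n" "q * E n = E n * q" for n
      using power_commuting_commutes[of "1 - q" q n]
      by (auto simp: E_def adj_power adj_diff pos_selfadj q algebra_simps)
    have "real n * (norm (x * E n))\<^sup>2 \<le> 1" for n
    proof -
      have "adj (x * E n) * (x * E n) = E n * q * E n"
        by (simp add: adj_mult E(1) q_def mult.assoc)
      also have "\<dots> = q * (1 - q) ^ (2 * n)"
        by (simp only: E(2)[symmetric] mult.assoc) (simp add: E_def power_add mult_2)
      finally have "adj (x * E n) * (x * E n) = q * (1 - q) ^ (2 * n)" .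
      then have "real (2 * n) * (norm (x * E n))\<^sup>2 \<le> 1"
        using norm_mult_one_minus_power_le[OF q(1,2), of "2 * n"] cstar_identity[of "x * E n"] by simp
      then show ?thesis using zero_le_mult_iff[of "real n" "(norm (x * E n))\<^sup>2"] by simp
    qed
    then have "(\<lambda>n. norm (x * E n)) \<longlonglongrightarrow> 0"
      by (intro tendsto_le_inverse_square) auto
    moreover have "norm (x * E n) = norm ((1 - E n) * adj x - adj x)" for n
    proof -
      have "(1 - E n) * adj x - adj x = - adj (x * E n)"
        by (simp add: adj_mult E algebra_simps)
      then show ?thesis by simp
    qed
    ultimately have lim: "(\<lambda>n. (1 - E n) * adj x) \<longlonglongrightarrow> adj x"
      by (simp add: tendsto_norm_zero_iff LIM_zero_iff)
    have mem: "(1 - E n) * adj x \<in> J" for n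
      using one_minus_power_in_ideal[OF J q(3)] closed_ideal_mem(8)[OF J] by (simp add: E_def)
    show ?thesis
      by (rule closed_sequentially[OF closed_ideal_mem(9)[OF J] mem lim])
  qed
  show ?thesis
  proof (cases "x = 0")
    case False
    have "adj ((1 / norm x) *\<^sub>R x) \<in> J"
      by (rule *) (use assms closed_ideal_mem[OF J] in auto)
    then have "norm x *\<^sub>R adj ((1 / norm x) *\<^sub>R x) \<in> J"
      using closed_ideal_mem[OF J] by blast
    then show ?thesis using False by simp
  qed (use assms in simp)
qed

lemma commuting_mult_square:
  fixes a b :: "'a::semigroup_mult"
  assumes "a * b = b * a" shows "a * b * (b * a) = b * b * (a * a)"
proof -
  have "a * b * (b * a) = b * a * (b * a)"
    by (simp only: assms)
  also have "\<dots> = b * (a * b) * a"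
    by (simp only: mult.assoc)
  also have "\<dots> = b * b * (a * a)"
    by (simp only: assms mult.assoc)
  finally show ?thesis .
qed

text \<open>Modulo \<open>J\<close>, the square of \<open>z\<close> is at most \<open>l\<close>, so \<open>z\<close> should have distance at most \<open>sqrt l\<close> from \<open>J\<close>. The
  element of \<open>J\<close> is \<open>z * (1 - E)\<close> where \<open>E\<close> is a high power of \<open>1 - w\<^sup>2\<close> for the rescaled \<open>w = z * z + a - l\<close>.\<close>

lemma ideal_approx_sqrt:
  fixes z :: "'a::{cstar_algebra,real_normed_algebra_1}"
  assumes J: "closed_ideal UNIV J" and z: "adj z = z" and a: "pos a" and l: "0 \<le> l"
    and w: "z * z + a - l *\<^sub>R 1 \<in> J" and "d > 0"
  shows "\<exists>j\<in>J. (norm (z - j))\<^sup>2 \<le> l + d"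
proof -
  define w where "w = z * z + a - l *\<^sub>R 1"
  \<comment> \<open>The maximum with 1 avoids a division by 0 when w = 0.\<close>
  define M where "M = max 1 (norm w)"
  \<comment> \<open>The square is taken because w is merely selfadjoint, whereas the estimate for
    powers of 1 - q needs q positive.\<close>
  define q where "q = ((1/M) *\<^sub>R w) * ((1/M) *\<^sub>R w)"
  define E where "E n = (1 - q) ^ n" for n
  have M: "M \<ge> 1" "norm w \<le> M" by (auto simp: M_def)
  have w: "adj w = w"
    using z a by (simp add: w_def adj_diff adj_add adj_mult pos_selfadj)
  have wJ: "w \<in> J" using assms by (simp add: w_def)
  have q: "pos q"
    unfolding q_def by (rule pos_selfadj_square) (simp add: w)
  have "norm ((1/M) *\<^sub>R w) \<le> 1" using M by (simp add: divide_simps)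
  then have nq: "norm q \<le> 1"
    using norm_selfadj_square[of "(1/M) *\<^sub>R w"] by (simp add: q_def w power_le_one)
  have qJ: "q \<in> J"
    using closed_ideal_mem[OF J] wJ by (simp add: q_def)
  have p: "pos (1 - q)"
    using pos_diff_of_norm_le[of q 1] nq q by (simp add: pos_selfadj)
  have E: "adj (E n) = E n" "w * E n = E n * w" for n
    using power_commuting_commutes[of "1 - q" w n]
    by (auto simp: E_def adj_power adj_diff pos_selfadj q) (simp add: q_def algebra_simps)
  have nE: "norm (E n) \<le> 1" for n
  proof -
    have "norm (1 - q) \<le> 1" using norm_diff_pos_le[OF q nq] by simp
    then show ?thesis
      unfolding E_def using norm_power_ineq[of "1 - q" n] power_le_one[of "norm (1 - q)" n] by simp
  qed
  have "real n * (norm (((1/M) *\<^sub>R w) * E n))\<^sup>2 \<le> 1" for n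
  proof -
    have "adj (((1/M) *\<^sub>R w) * E n) * (((1/M) *\<^sub>R w) * E n) = q * (1 - q) ^ (2 * n)"
    proof -
      have "adj (((1/M) *\<^sub>R w) * E n) * (((1/M) *\<^sub>R w) * E n) = (1/M) *\<^sub>R (1/M) *\<^sub>R (E n * w * (w * E n))"
        by (simp add: adj_mult E(1) w)
      also have "E n * w * (w * E n) = w * w * (E n * E n)"
        by (rule commuting_mult_square) (simp only: E(2))
      also have "(1/M) *\<^sub>R (1/M) *\<^sub>R \<dots> = q * (E n * E n)"
        by (simp add: q_def)
      also have "\<dots> = q * (1 - q) ^ (2 * n)"
        by (simp add: E_def power_add mult_2)
      finally show ?thesis .
    qed
    then have "real (2 * n) * (norm (((1/M) *\<^sub>R w) * E n))\<^sup>2 \<le> 1"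
      using norm_mult_one_minus_power_le[OF q nq, of "2 * n"] cstar_identity[of "((1/M) *\<^sub>R w) * E n"] by simp
    then show ?thesis
      using zero_le_mult_iff[of "real n" "(norm (((1/M) *\<^sub>R w) * E n))\<^sup>2"] by simp
  qed
  then have "(\<lambda>n. norm (((1/M) *\<^sub>R w) * E n)) \<longlonglongrightarrow> 0"
    by (intro tendsto_le_inverse_square) auto
  then have "(\<lambda>n. M * norm (((1/M) *\<^sub>R w) * E n)) \<longlonglongrightarrow> M * 0"
    by (rule tendsto_mult_left)
  then have "(\<lambda>n. norm (w * E n)) \<longlonglongrightarrow> 0"
    using M by simp
  then obtain n where n: "norm (w * E n) < d"
    using \<open>d > 0\<close> by (auto simp: lim_sequentially dist_norm)
  \<comment> \<open>Since a is positive, adding it does not decrease the norm; z^2 + a is l + w, and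
    E w E becomes small while E l E has norm at most l.\<close>
  have "norm (E n * (z * z) * E n) \<le> norm (E n * (z * z + a) * E n)"
  proof (rule norm_mono_pos)
    show "pos (E n * (z * z) * E n)"
      using pos_conj[OF pos_selfadj_square[OF z], of "E n"] E by simp
    have "E n * (z * z + a) * E n - E n * (z * z) * E n = E n * a * E n"
      by (simp add: algebra_simps)
    then show "pos (E n * (z * z + a) * E n - E n * (z * z) * E n)"
      using pos_conj[OF a, of "E n"] E by simp
  qed
  also have "E n * (z * z + a) * E n = l *\<^sub>R (E n * E n) + E n * (w * E n)"
    by (simp add: w_def algebra_simps)
  also have "norm \<dots> \<le> l * 1 + d"
  proof -
    have "norm (E n * E n) \<le> 1 * 1"
      using nE by (intro order_trans[OF norm_mult_ineq] mult_mono) auto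
    moreover have "norm (E n * (w * E n)) \<le> 1 * d"
      using nE n by (intro order_trans[OF norm_mult_ineq[of "E n" "w * E n"]] mult_mono) auto
    ultimately show ?thesis
      using l by (intro norm_triangle_mono) (auto intro: mult_left_le)
  qed
  finally have "norm (E n * (z * z) * E n) \<le> l + d" by simp
  moreover have "adj (z * E n) * (z * E n) = E n * (z * z) * E n"
    by (simp add: adj_mult E z mult.assoc)
  ultimately have "(norm (z * E n))\<^sup>2 \<le> l + d"
    using cstar_identity[of "z * E n"] by simp
  moreover have "z * E n = z - z * (1 - E n)" by (simp add: algebra_simps)
  moreover have "z * (1 - E n) \<in> J"
    using one_minus_power_in_ideal[OF J qJ] closed_ideal_mem(7)[OF J] by (simp add: E_def)
  ultimately show ?thesis by metis
qed

section \<open>Unitization\<close>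

datatype 'a unitization = Unitize (vec_part: 'a) (scal_part: complex)

text \<open>Left multiplication on A, viewed as an ideal of its unitization; the norm of the
  unitization is built from the operator norm of this action.\<close>

definition unit_act :: "'a::cstar_algebra unitization \<Rightarrow> 'a \<Rightarrow> 'a" where
  "unit_act u x = vec_part u * x + scal_part u *\<^sub>C x"

lemma scaleC_scaleR_commute: "c *\<^sub>C r *\<^sub>R x = r *\<^sub>R c *\<^sub>C x"
  by (simp add: scaleC_scaleC mult.commute flip: scaleC_of_real)

lemma scaleR_scaleC: "(r *\<^sub>R c) *\<^sub>C x = r *\<^sub>R c *\<^sub>C x"
  by (simp add: scaleC_scaleC scaleR_conv_of_real flip: scaleC_of_real)

lemma bounded_linear_scaleC: "bounded_linear (\<lambda>x. c *\<^sub>C x)"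
  by (rule bounded_linear_intro[of _ "cmod c"])
    (simp_all add: scaleC_add_right scaleC_scaleR_commute norm_scaleC)

lemma bounded_linear_unit_act: "bounded_linear (unit_act u)"
  unfolding unit_act_def[abs_def]
  by (intro bounded_linear_add bounded_linear_mult_right bounded_linear_scaleC)

lemma onorm_scaleC_le:
  assumes "bounded_linear f" shows "onorm (\<lambda>x. c *\<^sub>C f x) \<le> cmod c * onorm f"
proof (rule onorm_bound)
  show "norm (c *\<^sub>C f x) \<le> cmod c * onorm f * norm x" for x
    using mult_left_mono[OF onorm[OF assms, of x], of "cmod c"] by (simp add: norm_scaleC)
qed (simp add: onorm_pos_le[OF assms])

lemma onorm_scaleC:
  assumes "bounded_linear f" shows "onorm (\<lambda>x. c *\<^sub>C f x) = cmod c * onorm f"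
proof (cases "c = 0")
  case True
  then show ?thesis
    using onorm_scaleC_le[OF assms, of 0] onorm_pos_le[of "\<lambda>x. 0 *\<^sub>C f x"] bounded_linear_compose[OF bounded_linear_scaleC assms]
    by fastforce
next
  case False
  have "bounded_linear (\<lambda>x. c *\<^sub>C f x)"
    by (rule bounded_linear_compose[OF bounded_linear_scaleC assms])
  then have "onorm (\<lambda>x. inverse c *\<^sub>C c *\<^sub>C f x) \<le> cmod (inverse c) * onorm (\<lambda>x. c *\<^sub>C f x)"
    by (rule onorm_scaleC_le)
  then have "cmod c * onorm f \<le> onorm (\<lambda>x. c *\<^sub>C f x)"
    using False by (simp add: scaleC_scaleC norm_divide field_simps)
  then show ?thesis
    using onorm_scaleC_le[OF assms, of c] by linarith
qed

instantiation unitization :: (cstar_algebra) ab_group_add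
begin

definition "0 = Unitize 0 0"
definition "u + v = Unitize (vec_part u + vec_part v) (scal_part u + scal_part v)"
definition "u - v = Unitize (vec_part u - vec_part v) (scal_part u - scal_part v)"
definition "- u = Unitize (- vec_part u) (- scal_part u)"

instance
  by standard (simp_all add: zero_unitization_def plus_unitization_def minus_unitization_def uminus_unitization_def)

end

text \<open>The maximum with the scalar part is needed because left multiplication is not faithful on the
  unitization of an algebra that has a unit already.\<close>

instantiation unitization :: (cstar_algebra) real_normed_vector
begin

definition "r *\<^sub>R u = Unitize (r *\<^sub>R vec_part u) (r *\<^sub>R scal_part u)"
definition "norm u = max (onorm (unit_act u)) (cmod (scal_part u))"
definition "dist u v = norm (u - v :: 'a unitization)"
definition "sgn u = inverse (norm u) *\<^sub>R (u :: 'a unitization)"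
definition "uniformity = (INF e\<in>{0 <..}. principal {(u, v :: 'a unitization). dist u v < e})"
definition "open (U :: 'a unitization set) \<longleftrightarrow>
  (\<forall>x\<in>U. \<forall>\<^sub>F (x', y) in uniformity. x' = x \<longrightarrow> y \<in> U)"

instance
proof
  fix u v :: "'a unitization" and r s :: real
  have add: "unit_act (u + v) = (\<lambda>x. unit_act u x + unit_act v x)"
    by (auto simp: unit_act_def plus_unitization_def algebra_simps scaleC_add_left)
  show "norm u = 0 \<longleftrightarrow> u = 0"
  proof
    assume "norm u = 0"
    then have "scal_part u = 0" "onorm (unit_act u) = 0"
      using onorm_pos_le[OF bounded_linear_unit_act, of u] by (auto simp: norm_unitization_def max_def split: if_splits)
    then have "vec_part u * x = 0" for x
      using onorm_eq_0[OF bounded_linear_unit_act, of u] by (metis add.right_neutral complex_vector.scale_zero_left unit_act_def)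
    then have "adj (adj (vec_part u)) * adj (vec_part u) = 0"
      by (simp add: adj_adj)
    then have "norm (adj (vec_part u)) = 0"
      using cstar_identity[of "adj (vec_part u)"] by simp
    then show "u = 0"
      using \<open>scal_part u = 0\<close> by (simp add: zero_unitization_def unitization.expand)
  next
    assume "u = 0"
    then have "unit_act u = (\<lambda>x. 0)" "scal_part u = 0"
      by (auto simp: unit_act_def zero_unitization_def)
    then show "norm u = 0"
      by (simp add: norm_unitization_def onorm_zero)
  qed
  show "norm (u + v) \<le> norm u + norm v"
  proof -
    have "onorm (unit_act (u + v)) \<le> onorm (unit_act u) + onorm (unit_act v)"
      unfolding add by (intro onorm_triangle bounded_linear_unit_act)
    moreover have "cmod (scal_part (u + v)) \<le> cmod (scal_part u) + cmod (scal_part v)"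
      by (simp add: plus_unitization_def norm_triangle_ineq)
    ultimately show ?thesis
      unfolding norm_unitization_def by linarith
  qed
  have scal: "unit_act (r *\<^sub>R u) = (\<lambda>x. r *\<^sub>R unit_act u x)"
    by (auto simp: unit_act_def scaleR_unitization_def algebra_simps scaleR_scaleC)
  show "norm (r *\<^sub>R u) = \<bar>r\<bar> * norm u"
    unfolding norm_unitization_def scal
    by (simp add: onorm_scaleR[OF bounded_linear_unit_act] scaleR_unitization_def max_mult_distrib_left)
qed (simp_all add: scaleR_unitization_def plus_unitization_def algebra_simps dist_unitization_def
      sgn_unitization_def uniformity_unitization_def open_unitization_def unitization.expand)

end

definition embed :: "'a::cstar_algebra \<Rightarrow> 'a unitization" where
  "embed a = Unitize a 0"

lemma vec_part_embed [simp]: "vec_part (embed a) = a"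
  and scal_part_embed [simp]: "scal_part (embed a) = 0"
  by (simp_all add: embed_def)

lemma unit_act_embed: "unit_act (embed a) x = a * x"
  by (simp add: unit_act_def embed_def)

lemma norm_embed [simp]: "norm (embed a) = norm a"
proof -
  have "onorm (unit_act (embed a)) \<le> norm a"
    by (rule onorm_bound) (auto simp: unit_act_embed norm_mult_ineq)
  moreover have "norm a \<le> onorm (unit_act (embed a))"
  proof (cases "a = 0")
    case False
    \<comment> \<open>The vector \<open>adj a\<close> shows that the operator norm of left
      multiplication by a is at least norm a.\<close>
    have "norm (a * adj a) = (norm a)\<^sup>2"
      using cstar_identity[of "adj a"] by (simp add: adj_adj)
    then have "norm a * norm a \<le> onorm (unit_act (embed a)) * norm a"
      using onorm[OF bounded_linear_unit_act[of "embed a"], of "adj a"]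
      by (simp add: unit_act_embed power2_eq_square)
    then show ?thesis using False by simp
  qed (simp add: onorm_pos_le[OF bounded_linear_unit_act])
  ultimately show ?thesis
    using norm_ge_zero[of a] by (simp add: norm_unitization_def max_absorb1)
qed

lemma norm_scal_part_le: "cmod (scal_part u) \<le> norm u"
  by (simp add: norm_unitization_def)

lemma embed_add: "embed (a + b) = embed a + embed b"
  by (simp add: embed_def plus_unitization_def)

lemma embed_diff: "embed (a - b) = embed a - embed b"
  by (simp add: embed_def minus_unitization_def)

lemma embed_minus: "embed (- a) = - embed a"
  by (simp add: embed_def uminus_unitization_def)

lemma embed_scaleR: "embed (r *\<^sub>R a) = r *\<^sub>R embed a"
  by (simp add: embed_def scaleR_unitization_def)

lemma embed_0 [simp]: "embed 0 = 0"
  by (simp add: embed_def zero_unitization_def)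

lemma bounded_linear_embed: "bounded_linear embed"
  by (rule bounded_linear_intro[of _ 1]) (auto simp: embed_add embed_scaleR)

lemma inj_embed: "inj embed"
  by (auto simp: inj_on_def embed_def)

lemma norm_Unitize_le: "norm (Unitize a l) \<le> norm a + cmod l"
proof -
  have "norm (Unitize 0 l :: 'a unitization) \<le> cmod l"
    unfolding norm_unitization_def
    by (rule max.boundedI) (auto intro!: onorm_bound simp: unit_act_def norm_scaleC)
  moreover have "Unitize a l = embed a + Unitize 0 l"
    by (simp add: embed_def plus_unitization_def)
  ultimately show ?thesis
    using norm_triangle_ineq[of "embed a" "Unitize 0 l"] by simp
qed

text \<open>With \<open>norm_Unitize_le\<close> and \<open>norm_scal_part_le\<close> this makes the
  norm equivalent to that of the direct sum, so completeness is inherited from the two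
  components.\<close>

lemma norm_vec_part_le: "norm (vec_part u) \<le> 2 * norm u"
proof -
  have "embed (vec_part u) = u - Unitize 0 (scal_part u)"
    by (simp add: embed_def minus_unitization_def unitization.expand)
  then have "norm (embed (vec_part u)) \<le> norm u + norm (Unitize 0 (scal_part u) :: 'a unitization)"
    using norm_triangle_ineq4 by metis
  then show ?thesis
    using norm_Unitize_le[of "0::'a" "scal_part u"] norm_scal_part_le[of u] by simp
qed

lemma vec_part_diff: "vec_part (u - v) = vec_part u - vec_part v"
  and scal_part_diff: "scal_part (u - v) = scal_part u - scal_part v"
  by (simp_all add: minus_unitization_def)

instantiation unitization :: (cstar_algebra) complex_banach
begin

definition "c *\<^sub>C u = Unitize (c *\<^sub>C vec_part u) (c * scal_part u)"

instance
proof
  fix X :: "nat \<Rightarrow> 'a unitization" assume X: "Cauchy X"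
  have "Cauchy (\<lambda>n. vec_part (X n))"
  proof (rule CauchyI)
    fix e :: real assume "e > 0"
    then obtain M where "\<forall>m\<ge>M. \<forall>n\<ge>M. norm (X m - X n) < e / 2"
      using CauchyD[OF X, of "e / 2"] by auto
    then show "\<exists>M. \<forall>m\<ge>M. \<forall>n\<ge>M. norm (vec_part (X m) - vec_part (X n)) < e"
      using norm_vec_part_le[of "X _ - X _"] unfolding vec_part_diff by (smt (verit) field_sum_of_halves)
  qed
  then obtain a where a: "(\<lambda>n. vec_part (X n)) \<longlonglongrightarrow> a"
    using Cauchy_convergent convergent_def by blast
  have "Cauchy (\<lambda>n. scal_part (X n))"
  proof (rule CauchyI)
    fix e :: real assume "e > 0"
    then obtain M where "\<forall>m\<ge>M. \<forall>n\<ge>M. norm (X m - X n) < e"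
      using CauchyD[OF X \<open>e > 0\<close>] by blast
    then show "\<exists>M. \<forall>m\<ge>M. \<forall>n\<ge>M. norm (scal_part (X m) - scal_part (X n)) < e"
      using norm_scal_part_le[of "X _ - X _"] unfolding scal_part_diff by (meson order_le_less_trans)
  qed
  then obtain l where l: "(\<lambda>n. scal_part (X n)) \<longlonglongrightarrow> l"
    using Cauchy_convergent convergent_def by blast
  have "X \<longlonglongrightarrow> Unitize a l"
  proof (rule LIM_zero_cancel, rule tendsto_norm_zero_cancel, rule tendsto_sandwich[OF _ _ tendsto_const])
    have "(\<lambda>n. norm (vec_part (X n) - a) + cmod (scal_part (X n) - l)) \<longlonglongrightarrow> norm (a - a) + cmod (l - l)"
      by (intro tendsto_intros a l)
    then show "(\<lambda>n. norm (vec_part (X n) - a) + cmod (scal_part (X n) - l)) \<longlonglongrightarrow> 0" by simp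
    show "\<forall>\<^sub>F n in sequentially. norm (X n - Unitize a l) \<le> norm (vec_part (X n) - a) + cmod (scal_part (X n) - l)"
      by (simp add: minus_unitization_def norm_Unitize_le)
  qed auto
  then show "convergent X" by (auto simp: convergent_def)
next
  fix c d :: complex and u v :: "'a unitization"
  show "norm (c *\<^sub>C u) = cmod c * norm u"
  proof -
    have "unit_act (c *\<^sub>C u) = (\<lambda>x. c *\<^sub>C unit_act u x)"
      by (auto simp: unit_act_def scaleC_unitization_def scaleC_add_right scaleC_scaleC mult_scaleC_left)
    then show ?thesis
      by (simp add: norm_unitization_def onorm_scaleC[OF bounded_linear_unit_act] scaleC_unitization_def
          norm_mult max_mult_distrib_left)
  qed
qed (auto simp: scaleC_unitization_def plus_unitization_def scaleR_unitization_def scaleC_add_right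
      scaleC_add_left scaleC_scaleC scaleC_of_real algebra_simps scaleR_conv_of_real)

end

lemma embed_scaleC: "embed (c *\<^sub>C a) = c *\<^sub>C embed a"
  by (simp add: embed_def scaleC_unitization_def)

instantiation unitization :: (cstar_algebra) real_normed_algebra_1
begin

definition "1 = Unitize 0 1"
definition "u * v = Unitize (vec_part u * vec_part v + scal_part u *\<^sub>C vec_part v + scal_part v *\<^sub>C vec_part u)
  (scal_part u * scal_part v)"

instance
proof
  fix u v w :: "'a unitization" and r :: real
  have comp: "unit_act (u * v) = unit_act u \<circ> unit_act v"
    by (auto simp: unit_act_def times_unitization_def mult_scaleC_left mult_scaleC_right scaleC_add_right
        scaleC_scaleC algebra_simps)
  show "norm (u * v) \<le> norm u * norm v"
  proof -
    have "onorm (unit_act (u * v)) \<le> onorm (unit_act u) * onorm (unit_act v)"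
      unfolding comp by (intro onorm_compose bounded_linear_unit_act)
    also have "\<dots> \<le> norm u * norm v"
      by (intro mult_mono) (auto simp: norm_unitization_def le_max_iff_disj intro: onorm_pos_le bounded_linear_unit_act)
    finally have "onorm (unit_act (u * v)) \<le> norm u * norm v" .
    moreover have "cmod (scal_part u * scal_part v) \<le> norm u * norm v"
      by (simp add: norm_mult mult_mono norm_scal_part_le)
    ultimately show ?thesis
      unfolding norm_unitization_def[of "u * v"] by (simp add: times_unitization_def)
  qed
  show "norm (1 :: 'a unitization) = 1"
  proof -
    have "onorm (unit_act (1 :: 'a unitization)) \<le> 1"
      by (rule onorm_bound) (auto simp: unit_act_def one_unitization_def norm_scaleC)
    then show ?thesis by (simp add: norm_unitization_def one_unitization_def)
  qed
  show "u * v * w = u * (v * w)"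
    by (simp add: times_unitization_def mult_scaleC_left mult_scaleC_right scaleC_add_right scaleC_scaleC algebra_simps)
qed (auto simp: times_unitization_def one_unitization_def zero_unitization_def plus_unitization_def scaleR_unitization_def
      unitization.expand scaleC_add_right scaleC_add_left algebra_simps scaleC_scaleR_commute scaleR_scaleC)

end

lemma embed_mult: "embed (a * b) = embed a * embed b"
  by (simp add: embed_def times_unitization_def)

lemma unit_act_mult: "unit_act (u * v) x = unit_act u (unit_act v x)"
  by (auto simp: unit_act_def times_unitization_def mult_scaleC_left mult_scaleC_right scaleC_add_right
        scaleC_scaleC algebra_simps)

instantiation unitization :: (cstar_algebra) cstar_algebra
begin

definition "adj u = Unitize (adj (vec_part u)) (cnj (scal_part u))"

text \<open>For the A-valued inner product \<open>adj x * y\<close>, the action of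
  \<open>adj u\<close> is adjoint to that of u. This carries the C*-identity of A over to the
  operator norm.\<close>

lemma adj_unit_act_mult: "adj (unit_act u x) * y = adj x * unit_act (adj u) y" for u :: "'a unitization"
  by (simp add: unit_act_def adj_unitization_def adj_add adj_mult adj_scaleC mult_scaleC_left mult_scaleC_right
      algebra_simps)

instance
proof
  fix u v :: "'a unitization" and c
  show cstar: "norm (adj u * u) = (norm u)\<^sup>2"
  proof -
    have sq: "(onorm (unit_act u))\<^sup>2 \<le> onorm (unit_act (adj u * u))" for u :: "'a unitization"
    proof -
      have "norm (unit_act u x) \<le> sqrt (onorm (unit_act (adj u * u))) * norm x" for x
      proof -
        have "(norm (unit_act u x))\<^sup>2 = norm (adj x * unit_act (adj u * u) x)"
          by (simp add: unit_act_mult adj_unit_act_mult flip: cstar_identity)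
        also have "\<dots> \<le> norm x * (onorm (unit_act (adj u * u)) * norm x)"
          using norm_mult_ineq[of "adj x" "unit_act (adj u * u) x"]
            mult_left_mono[OF onorm[OF bounded_linear_unit_act, of "adj u * u" x] norm_ge_zero[of x]] by simp
        also have "\<dots> = (sqrt (onorm (unit_act (adj u * u))) * norm x)\<^sup>2"
          using onorm_pos_le[OF bounded_linear_unit_act, of "adj u * u"] by (simp add: power2_eq_square)
        finally show ?thesis
          by (rule power2_le_imp_le) (simp add: onorm_pos_le[OF bounded_linear_unit_act])
      qed
      then have "onorm (unit_act u) \<le> sqrt (onorm (unit_act (adj u * u)))"
        by (rule onorm_bound[rotated]) (simp add: onorm_pos_le[OF bounded_linear_unit_act])
      then show ?thesis
        using onorm_pos_le[OF bounded_linear_unit_act] real_le_rsqrt real_sqrt_le_iff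
        by (metis real_sqrt_abs abs_of_nonneg)
    qed
    have le: "onorm (unit_act (adj u * u)) \<le> onorm (unit_act (adj u)) * onorm (unit_act u)" for u :: "'a unitization"
    proof -
      have "unit_act (adj u * u) = unit_act (adj u) \<circ> unit_act u"
        by (auto simp: unit_act_mult)
      then show ?thesis
        using onorm_compose[OF bounded_linear_unit_act bounded_linear_unit_act] by metis
    qed
    have le': "onorm (unit_act u) \<le> onorm (unit_act (adj u))" for u :: "'a unitization"
    proof (cases "onorm (unit_act u) = 0")
      case False
      then show ?thesis
        using order_trans[OF sq[of u] le[of u]] onorm_pos_le[OF bounded_linear_unit_act, of u]
        by (simp add: power2_eq_square)
    qed (simp add: onorm_pos_le[OF bounded_linear_unit_act])
    have "adj (adj u) = u"
      by (simp add: adj_unitization_def adj_adj)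
    then have "onorm (unit_act (adj u)) = onorm (unit_act u)"
      using le'[of u] le'[of "adj u"] by simp
    then have eq: "onorm (unit_act (adj u * u)) = (onorm (unit_act u))\<^sup>2"
      using sq[of u] le[of u] by (simp add: power2_eq_square)
    have "cmod (scal_part (adj u * u)) = (cmod (scal_part u))\<^sup>2"
      by (simp add: times_unitization_def adj_unitization_def norm_mult power2_eq_square)
    then show ?thesis
      using onorm_pos_le[OF bounded_linear_unit_act, of u]
      by (auto simp: norm_unitization_def eq max_def power2_le_iff_abs_le abs_le_square_iff[symmetric])
  qed
qed (auto simp: adj_unitization_def times_unitization_def plus_unitization_def scaleC_unitization_def adj_adj adj_add
      adj_mult adj_scaleC mult_scaleC_left mult_scaleC_right scaleC_scaleC scaleC_add_right algebra_simps)

end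

lemma embed_adj: "embed (adj a) = adj (embed a)"
  by (simp add: embed_def adj_unitization_def)

lemma unitization_decomp: "u = embed (vec_part u) + scal_part u *\<^sub>C 1"
  by (simp add: embed_def plus_unitization_def scaleC_unitization_def one_unitization_def)

lemma mult_embed: "u * embed a = embed (unit_act u a)"
  by (simp add: embed_def times_unitization_def unit_act_def)

lemma embed_mult_right: "embed a * u = embed (a * vec_part u + scal_part u *\<^sub>C a)"
  by (simp add: embed_def times_unitization_def)

section \<open>Extreme linear functionals below a sublinear functional\<close>

definition sublinear :: "('v::real_vector \<Rightarrow> real) \<Rightarrow> bool" where
  "sublinear q \<longleftrightarrow> (\<forall>x y. q (x + y) \<le> q x + q y) \<and> (\<forall>t\<ge>0. \<forall>x. q (t *\<^sub>R x) = t * q x)"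

lemma sublinear_add: "sublinear q \<Longrightarrow> q (x + y) \<le> q x + q y"
  and sublinear_scaleR: "sublinear q \<Longrightarrow> 0 \<le> t \<Longrightarrow> q (t *\<^sub>R x) = t * q x"
  by (simp_all add: sublinear_def)

lemma sublinear_0: "sublinear q \<Longrightarrow> q 0 = 0"
  using sublinear_scaleR[of q 0 0] by simp

lemma sublinear_ge: "sublinear q \<Longrightarrow> - q (- x) \<le> q x"
  using sublinear_add[of q x "- x"] by (simp add: sublinear_0)

text \<open>The linear functionals below \<open>q\<close> form a face of those below \<open>p\<close>.\<close>

definition face_functional :: "('v::real_vector \<Rightarrow> real) \<Rightarrow> ('v \<Rightarrow> real) \<Rightarrow> bool" where
  "face_functional p q \<longleftrightarrow> sublinear q \<and> q \<le> p \<and>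
    (\<forall>g h t. linear g \<longrightarrow> linear h \<longrightarrow> g \<le> p \<longrightarrow> h \<le> p \<longrightarrow> 0 < t \<longrightarrow> t < 1 \<longrightarrow>
       (\<forall>x. t * g x + (1 - t) * h x \<le> q x) \<longrightarrow> g \<le> q \<and> h \<le> q)"

text \<open>A sublinear functional stands for the set of linear functionals below it. This one
  stands for those below q that attain the value of q at y; see \<open>exposed_le_self\<close>,
  \<open>exposed_uminus\<close> and \<open>le_exposed\<close>.\<close>

definition exposed :: "('v::real_vector \<Rightarrow> real) \<Rightarrow> 'v \<Rightarrow> 'v \<Rightarrow> real" where
  "exposed q y x = (INF t\<in>{0..}. q (x + t *\<^sub>R y) - t * q y)"

context
  fixes q :: "'v::real_vector \<Rightarrow> real" and y :: 'v
  assumes q: "sublinear q"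
begin

lemma exposed_bdd: "bdd_below ((\<lambda>t. q (x + t *\<^sub>R y) - t * q y) ` {0..})"
proof (rule bdd_belowI2[of _ "- q (- x)"])
  fix t :: real assume "t \<in> {0..}"
  then show "- q (- x) \<le> q (x + t *\<^sub>R y) - t * q y"
    using sublinear_add[OF q, of "x + t *\<^sub>R y" "- x"] sublinear_scaleR[OF q, of t y] by simp
qed

lemma exposed_le: "0 \<le> t \<Longrightarrow> exposed q y x \<le> q (x + t *\<^sub>R y) - t * q y"
  unfolding exposed_def using exposed_bdd by (intro cINF_lower) auto

lemma exposed_greatest: "(\<And>t. 0 \<le> t \<Longrightarrow> c \<le> q (x + t *\<^sub>R y) - t * q y) \<Longrightarrow> c \<le> exposed q y x"
  unfolding exposed_def by (intro cINF_greatest) auto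

lemma exposed_le_self: "exposed q y \<le> q"
  using exposed_le[of 0] by (simp add: le_fun_def)

lemma exposed_uminus: "exposed q y (- y) \<le> - q y"
  using exposed_le[of 1 "- y"] by (simp add: sublinear_0[OF q])

lemma sublinear_exposed: "sublinear (exposed q y)"
  unfolding sublinear_def
proof (intro conjI allI impI)
  fix u v
  have *: "exposed q y (u + v) \<le> (q (u + s *\<^sub>R y) - s * q y) + (q (v + t *\<^sub>R y) - t * q y)"
    if "0 \<le> s" "0 \<le> t" for s t
    using exposed_le[of "s + t" "u + v"] that sublinear_add[OF q, of "u + s *\<^sub>R y" "v + t *\<^sub>R y"]
    by (simp add: algebra_simps)
  have "exposed q y (u + v) - (q (u + s *\<^sub>R y) - s * q y) \<le> exposed q y v" if "0 \<le> s" for s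
    using *[OF that] by (intro exposed_greatest) (simp add: algebra_simps)
  then have "exposed q y (u + v) - exposed q y v \<le> exposed q y u"
    by (intro exposed_greatest) (simp add: algebra_simps)
  then show "exposed q y (u + v) \<le> exposed q y u + exposed q y v" by simp
next
  fix c :: real and u assume "0 \<le> c"
  have zero: "exposed q y 0 = 0"
    using exposed_greatest[of 0 0] exposed_le[of 0 0] sublinear_scaleR[OF q, of _ y] sublinear_0[OF q] by force
  have le: "exposed q y (c *\<^sub>R u) \<le> c * exposed q y u" if "c > 0" for c u
  proof -
    have "exposed q y (c *\<^sub>R u) / c \<le> exposed q y u"
    proof (rule exposed_greatest)
      fix t :: real assume "0 \<le> t"
      have "exposed q y (c *\<^sub>R u) \<le> q (c *\<^sub>R (u + t *\<^sub>R y)) - c * t * q y"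
        using exposed_le[of "c * t" "c *\<^sub>R u"] that \<open>0 \<le> t\<close> by (simp add: scaleR_add_right)
      also have "\<dots> = c * (q (u + t *\<^sub>R y) - t * q y)"
        using sublinear_scaleR[OF q, of c "u + t *\<^sub>R y"] that by (simp add: right_diff_distrib)
      finally show "exposed q y (c *\<^sub>R u) / c \<le> q (u + t *\<^sub>R y) - t * q y"
        using that by (simp add: field_simps)
    qed
    then show ?thesis using that by (simp add: field_simps)
  qed
  show "exposed q y (c *\<^sub>R u) = c * exposed q y u"
  proof (cases "c = 0")
    case False
    then have "c > 0" using \<open>0 \<le> c\<close> by simp
    then have "c * exposed q y u \<le> exposed q y (c *\<^sub>R u)"
      using le[of "1 / c" "c *\<^sub>R u"] by (simp add: field_simps)
    then show ?thesis using le[OF \<open>c > 0\<close>, of u] by simp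
  qed (simp add: zero)
qed

lemma le_exposed:
  assumes "linear g" "g \<le> q" "g y = q y" shows "g \<le> exposed q y"
proof (rule le_funI, rule exposed_greatest)
  fix x and t :: real
  have "g (x + t *\<^sub>R y) = g x + t * g y"
    using assms(1) by (simp add: linear_add linear_scale)
  then show "g x \<le> q (x + t *\<^sub>R y) - t * q y"
    using le_funD[OF assms(2), of "x + t *\<^sub>R y"] assms(3) by simp
qed

end

text \<open>If a proper convex combination of g and h reaches q at y, then so do both g and h,
  because neither exceeds q there.\<close>

lemma face_functional_exposed:
  assumes "face_functional p q" shows "face_functional p (exposed q y)"
  unfolding face_functional_def
proof (intro conjI allI impI)
  have q: "sublinear q" and "q \<le> p"
    using assms by (auto simp: face_functional_def)
  show "sublinear (exposed q y)"
    by (rule sublinear_exposed[OF q])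
  show "exposed q y \<le> p"
    using exposed_le_self[OF q] \<open>q \<le> p\<close> by (rule order_trans)
  fix g h and t :: real
  assume g: "linear g" "g \<le> p" and h: "linear h" "h \<le> p" and t: "0 < t" "t < 1"
    and le: "\<forall>x. t * g x + (1 - t) * h x \<le> exposed q y x"
  then have "t * g x + (1 - t) * h x \<le> q x" for x
    using le_funD[OF exposed_le_self[OF q, of y]] order_trans by blast
  then have gh: "g \<le> q" "h \<le> q"
    using assms g h t unfolding face_functional_def by blast+
  have "t * g (- y) + (1 - t) * h (- y) \<le> - q y"
    using le exposed_uminus[OF q, of y] order_trans by blast
  then have "q y \<le> t * g y + (1 - t) * h y"
    using g h by (simp add: linear_neg)
  moreover have "g y \<le> q y" "h y \<le> q y"
    using gh by (auto simp: le_fun_def)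
  ultimately have "t * (q y - g y) + (1 - t) * (q y - h y) \<le> 0" "q y - g y \<ge> 0" "q y - h y \<ge> 0"
    by (simp_all add: algebra_simps)
  then have "t * (q y - g y) \<le> 0" "(1 - t) * (q y - h y) \<le> 0"
    using t mult_nonneg_nonneg[of "1 - t" "q y - h y"] mult_nonneg_nonneg[of t "q y - g y"] by linarith+
  then have "g y = q y" "h y = q y"
    using \<open>q y - g y \<ge> 0\<close> \<open>q y - h y \<ge> 0\<close> t by (auto simp: mult_le_0_iff)
  then show "g \<le> exposed q y" "h \<le> exposed q y"
    using le_exposed[OF q] g h gh by blast+
qed

text \<open>An infimum of sublinear functionals need not be subadditive, but in a chain the smaller
  of two members serves both summands. A combination below the infimum is below every member, so the
  face property survives. This is the chain condition for Zorn's lemma.\<close>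

lemma face_functional_Inf:
  assumes "C \<noteq> {}" and chain: "\<And>q r. q \<in> C \<Longrightarrow> r \<in> C \<Longrightarrow> q \<le> r \<or> r \<le> q"
    and C: "\<And>q. q \<in> C \<Longrightarrow> face_functional p q"
  shows "\<exists>r. face_functional p r \<and> (\<forall>q\<in>C. r \<le> q)"
proof -
  have sub: "sublinear q" "q \<le> p" if "q \<in> C" for q
    using C[OF that] by (auto simp: face_functional_def)
  define r where "r x = (INF q\<in>C. q x)" for x
  have bdd: "bdd_below ((\<lambda>q. q x) ` C)" for x
  proof (rule bdd_belowI2[of _ "- p (- x)"])
    fix q assume "q \<in> C"
    then show "- p (- x) \<le> q x"
      using sublinear_ge[of q x] sub[of q] le_funD[of q p "- x"] by auto
  qed
  have le: "r x \<le> q x" if "q \<in> C" for q x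
    unfolding r_def using bdd that by (intro cINF_lower)
  have greatest: "c \<le> r x" if "\<And>q. q \<in> C \<Longrightarrow> c \<le> q x" for c x
    unfolding r_def using assms(1) that by (intro cINF_greatest)
  have "sublinear r"
    unfolding sublinear_def
  proof (intro conjI allI impI)
    fix u v
    have *: "r (u + v) \<le> q u + q' v" if qq': "q \<in> C" "q' \<in> C" for q q'
    proof -
      obtain s where "s \<in> C" "s \<le> q" "s \<le> q'"
        using chain[OF qq'] qq' by blast
      then show ?thesis
        using le[of s "u + v"] sublinear_add[OF sub(1)[of s], of u v] le_funD[of s q u] le_funD[of s q' v] by linarith
    qed
    have "r (u + v) - q u \<le> r v" if "q \<in> C" for q
      using *[OF that] by (intro greatest) (simp add: algebra_simps)
    then have "r (u + v) - r v \<le> r u"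
      by (intro greatest) (simp add: algebra_simps)
    then show "r (u + v) \<le> r u + r v" by simp
  next
    fix c :: real and u assume "0 \<le> c"
    show "r (c *\<^sub>R u) = c * r u"
    proof (cases "c = 0")
      case True
      have "r 0 = (INF q\<in>C. 0)"
        unfolding r_def using sub by (intro INF_cong) (auto simp: sublinear_0)
      then show ?thesis using True assms(1) by simp
    next
      case False
      then have c: "c > 0" using \<open>0 \<le> c\<close> by simp
      have "r (c *\<^sub>R u) \<le> c * q u" if "q \<in> C" for q
        using le[OF that, of "c *\<^sub>R u"] sublinear_scaleR[OF sub(1)[OF that]] c by simp
      then have "r (c *\<^sub>R u) / c \<le> r u"
        using c by (intro greatest) (simp add: field_simps)
      moreover have "c * r u \<le> r (c *\<^sub>R u)"
      proof (rule greatest)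
        fix q assume "q \<in> C"
        then show "c * r u \<le> q (c *\<^sub>R u)"
          using le[of q u] sublinear_scaleR[OF sub(1), of q c u] c by simp
      qed
      ultimately show ?thesis using c by (simp add: field_simps)
    qed
  qed
  moreover have "r \<le> p"
  proof -
    obtain q where "q \<in> C" using assms(1) by blast
    then show ?thesis using le[of q] le_funD[OF sub(2)[of q]] order_trans by (intro le_funI) blast
  qed
  moreover have "g \<le> r \<and> h \<le> r"
    if "linear g" "linear h" "g \<le> p" "h \<le> p" "0 < t" "t < 1" "\<forall>x. t * g x + (1 - t) * h x \<le> r x" for g h t
  proof -
    have *: "g \<le> q \<and> h \<le> q" if q: "q \<in> C" for q
    proof -
      have "t * g x + (1 - t) * h x \<le> q x" for x
        using \<open>\<forall>x. t * g x + (1 - t) * h x \<le> r x\<close> le[OF q, of x] order_trans by blast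
      then show ?thesis
        using C[OF q] \<open>linear g\<close> \<open>linear h\<close> \<open>g \<le> p\<close> \<open>h \<le> p\<close> \<open>0 < t\<close> \<open>t < 1\<close>
        unfolding face_functional_def by blast
    qed
    show ?thesis
    proof (intro conjI le_funI greatest)
      fix x q assume "q \<in> C"
      then show "g x \<le> q x" "h x \<le> q x"
        using *[of q] by (auto simp: le_fun_def)
    qed
  qed
  ultimately have "face_functional p r"
    unfolding face_functional_def by blast
  then show ?thesis
    using le by (auto simp: le_fun_def)
qed

text \<open>Hahn-Banach and Krein-Milman at once: a minimal face functional cannot be reduced by
  exposing it in any direction, which forces it to be linear, and a face consisting of one
  functional is an extreme point. Starting from \<open>exposed p y\<close> secures the value at
  y.\<close>

theorem extreme_functional_exists:
  fixes p :: "'v::real_vector \<Rightarrow> real"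
  assumes p: "sublinear p"
  obtains f where "linear f" "f \<le> p" "f y = p y"
    "\<And>g h t. linear g \<Longrightarrow> linear h \<Longrightarrow> g \<le> p \<Longrightarrow> h \<le> p \<Longrightarrow> 0 < t \<Longrightarrow> t < 1 \<Longrightarrow>
       (\<And>x. f x = t * g x + (1 - t) * h x) \<Longrightarrow> g = f"
proof -
  have "face_functional p p"
    using p by (auto simp: face_functional_def)
  then have start: "face_functional p (exposed p y)"
    by (rule face_functional_exposed)
  define S where "S = {q. face_functional p q \<and> q \<le> exposed p y}"
  have "\<exists>m\<in>S. \<forall>a\<in>S. a \<le> m \<longrightarrow> a = m"
  proof (rule predicate_Zorn)
    show "partial_order_on S (relation_of (\<lambda>a b. b \<le> a) S)"
      by (rule partial_order_on_relation_ofI) auto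
    fix C assume C: "C \<in> Chains (relation_of (\<lambda>a b. b \<le> a) S)"
    then have CS: "C \<subseteq> S" and chain: "\<And>q r. q \<in> C \<Longrightarrow> r \<in> C \<Longrightarrow> q \<le> r \<or> r \<le> q"
      by (auto simp: Chains_def relation_of_def)
    show "\<exists>u\<in>S. \<forall>q\<in>C. u \<le> q"
    proof (cases "C = {}")
      case True
      then show ?thesis using start by (auto simp: S_def)
    next
      case False
      then obtain r where r: "face_functional p r" "\<forall>q\<in>C. r \<le> q"
        using face_functional_Inf[OF False chain, of p] CS by (auto simp: S_def)
      obtain q where "q \<in> C" using False by blast
      then have "r \<le> exposed p y"
        using CS r(2) order_trans unfolding S_def by blast
      then show ?thesis using r by (auto simp: S_def)
    qed
  qed
  then obtain f where fS: "f \<in> S" and minS: "\<And>q. q \<in> S \<Longrightarrow> q \<le> f \<Longrightarrow> q = f"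
    by blast
  have f: "face_functional p f" "f \<le> exposed p y"
    using fS by (auto simp: S_def)
  have min: "q = f" if "face_functional p q" "q \<le> f" for q
    using that order_trans[OF that(2) f(2)] by (intro minS) (auto simp: S_def)
  have sub: "sublinear f" and "f \<le> p"
    using f by (auto simp: face_functional_def)
  \<comment> \<open>With \<open>exposed_uminus\<close> this says that f is odd, and an odd sublinear
    functional is linear.\<close>
  have "exposed f z = f" for z
    using min face_functional_exposed[OF f(1)] exposed_le_self[OF sub] by blast
  then have "f (- z) \<le> - f z" for z
    using exposed_uminus[OF sub, of z] by metis
  then have neg: "f (- z) = - f z" for z
    using sublinear_ge[OF sub, of "- z"] by (intro order_antisym) auto
  have add: "f (u + v) = f u + f v" for u v
    using sublinear_add[OF sub, of u v] sublinear_add[OF sub, of "u + v" "- v"] neg[of v] by simp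
  have scale: "f (c *\<^sub>R u) = c * f u" for c u
    using sublinear_scaleR[OF sub, of c u] sublinear_scaleR[OF sub, of "- c" u] neg[of "(- c) *\<^sub>R u"]
    by (cases "c \<ge> 0") auto
  have lin: "linear f"
    by (rule linearI) (auto simp: add scale)
  have "f (- y) \<le> - p y"
    using f(2) exposed_uminus[OF p, of y] order_trans by (auto simp: le_fun_def)
  then have fy: "f y = p y"
    using neg[of y] le_funD[OF \<open>f \<le> p\<close>, of y] by simp
  show thesis
  proof (rule that[OF lin \<open>f \<le> p\<close> fy])
    fix g h and t :: real
    assume g: "linear g" "g \<le> p" and h: "linear h" "h \<le> p" and t: "0 < t" "t < 1"
      and eq: "\<And>x. f x = t * g x + (1 - t) * h x"
    have "g \<le> f"
      using f(1) g h t eq unfolding face_functional_def by (metis order_refl)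
    \<comment> \<open>An inequality between linear functionals is an equality, as the argument may
      be negated.\<close>
    moreover have "f \<le> g"
    proof (rule le_funI)
      fix x show "f x \<le> g x"
        using le_funD[OF \<open>g \<le> f\<close>, of "- x"] g(1) neg[of x] by (simp add: linear_neg)
    qed
    ultimately show "g = f" by simp
  qed
qed

section \<open>Pure states\<close>

text \<open>Only real parts are required to be nonnegative on the \<open>adj x * x\<close>, so
  hermitian symmetry is a condition of its own. The set J is a parameter so that a functional on the
  quotient by J needs no quotient algebra; with the empty set it is a positive functional on the
  algebra.\<close>

definition positive_functional :: "'u::cstar_algebra set \<Rightarrow> ('u \<Rightarrow> complex) \<Rightarrow> bool" where
  "positive_functional J \<phi> \<longleftrightarrow> (\<forall>x y. \<phi> (x + y) = \<phi> x + \<phi> y) \<and> (\<forall>c x. \<phi> (c *\<^sub>C x) = c * \<phi> x) \<and>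
     (\<forall>x. \<phi> (adj x) = cnj (\<phi> x)) \<and> (\<forall>x. 0 \<le> Re (\<phi> (adj x * x))) \<and> (\<forall>j\<in>J. \<phi> j = 0)"

lemma positive_functionalD:
  assumes "positive_functional J \<phi>"
  shows "\<phi> (x + y) = \<phi> x + \<phi> y" "\<phi> (c *\<^sub>C x) = c * \<phi> x" "\<phi> (adj x) = cnj (\<phi> x)"
    "0 \<le> Re (\<phi> (adj x * x))" "j \<in> J \<Longrightarrow> \<phi> j = 0" "\<phi> (r *\<^sub>R x) = r * \<phi> x" "\<phi> (x - y) = \<phi> x - \<phi> y"
    "\<phi> (- x) = - \<phi> x" "\<phi> 0 = 0"
proof -
  have add: "\<phi> (x + y) = \<phi> x + \<phi> y" and scale: "\<phi> (c *\<^sub>C x) = c * \<phi> x" for x y c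
    using assms by (auto simp: positive_functional_def)
  show "\<phi> (x + y) = \<phi> x + \<phi> y" "\<phi> (c *\<^sub>C x) = c * \<phi> x" "\<phi> (adj x) = cnj (\<phi> x)"
    "0 \<le> Re (\<phi> (adj x * x))" "j \<in> J \<Longrightarrow> \<phi> j = 0"
    using assms by (auto simp: positive_functional_def)
  show scaleR: "\<phi> (r *\<^sub>R x) = r * \<phi> x" for r x
    using scale[of "complex_of_real r" x] by (simp add: scaleC_of_real)
  show minus: "\<phi> (- x) = - \<phi> x" for x
    using scaleR[of "-1" x] by simp
  show "\<phi> (x - y) = \<phi> x - \<phi> y"
    using add[of x "- y"] minus[of y] by simp
  show "\<phi> 0 = 0"
    using scaleR[of 0 0] by simp
qed

text \<open>J and the skew elements are real subspaces inside this cone, so a real linear functional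
  that is nonnegative on the cone vanishes on both. It then vanishes on J and is invariant under
  \<open>adj\<close>, as the real part of a state of the quotient should be.\<close>

definition pos_mod :: "'u::cstar_algebra set \<Rightarrow> 'u \<Rightarrow> bool" where
  "pos_mod J x \<longleftrightarrow> (\<exists>a j k. pos a \<and> j \<in> J \<and> adj k = - k \<and> x = a + j + k)"

lemma pos_modI: "pos a \<Longrightarrow> j \<in> J \<Longrightarrow> adj k = - k \<Longrightarrow> x = a + j + k \<Longrightarrow> pos_mod J x"
  by (auto simp: pos_mod_def)

context
  fixes J :: "'u::{cstar_algebra,real_normed_algebra_1} set"
  assumes J: "closed_ideal UNIV J"
begin

lemma pos_mod_of_pos: "pos a \<Longrightarrow> pos_mod J a"
  by (rule pos_modI[of a 0 _ 0]) (use closed_ideal_mem[OF J] in auto)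

lemma pos_mod_of_ideal: "j \<in> J \<Longrightarrow> pos_mod J j"
  by (rule pos_modI[of 0 j _ 0]) auto

lemma pos_mod_of_skew: "adj k = - k \<Longrightarrow> pos_mod J k"
  by (rule pos_modI[of 0 0 _ k]) (use closed_ideal_mem[OF J] in auto)

lemma pos_mod_add:
  assumes "pos_mod J x" "pos_mod J y" shows "pos_mod J (x + y)"
proof -
  obtain a j k a' j' k' where "pos a" "j \<in> J" "adj k = - k" "x = a + j + k"
    "pos a'" "j' \<in> J" "adj k' = - k'" "y = a' + j' + k'"
    using assms unfolding pos_mod_def by metis
  then show ?thesis
    by (intro pos_modI[of "a + a'" "j + j'" _ "k + k'"])
      (auto simp: pos_add adj_add closed_ideal_mem[OF J])
qed

lemma pos_mod_scaleR:
  assumes "pos_mod J x" "0 \<le> t" shows "pos_mod J (t *\<^sub>R x)"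
proof -
  obtain a j k where "pos a" "j \<in> J" "adj k = - k" "x = a + j + k"
    using assms unfolding pos_mod_def by metis
  then show ?thesis
    by (intro pos_modI[of "t *\<^sub>R a" "t *\<^sub>R j" _ "t *\<^sub>R k"])
      (auto simp: pos_scaleR assms closed_ideal_mem[OF J] scaleR_add_right)
qed

lemma pos_mod_conj:
  assumes "pos_mod J x" shows "pos_mod J (adj v * x * v)"
proof -
  obtain a j k where "pos a" "j \<in> J" "adj k = - k" "x = a + j + k"
    using assms unfolding pos_mod_def by metis
  then show ?thesis
    by (intro pos_modI[of "adj v * a * v" "adj v * j * v" _ "adj v * k * v"])
      (use pos_conj[of a v] in \<open>auto simp: closed_ideal_mem[OF J] adj_mult adj_adj algebra_simps\<close>)
qed

lemma pos_mod_shift: "pos_mod J (l *\<^sub>R 1 - x) \<Longrightarrow> l \<le> l' \<Longrightarrow> pos_mod J (l' *\<^sub>R 1 - x)"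
  using pos_mod_add[of "l *\<^sub>R 1 - x" "(l' - l) *\<^sub>R 1"] pos_mod_scaleR[OF pos_mod_of_pos[OF pos_1], of "l' - l"]
  by (simp add: algebra_simps)

lemma pos_mod_norm: "pos_mod J (norm x *\<^sub>R 1 - x)"
proof -
  define h where "h = (1/2) *\<^sub>R (x + adj x)"
  have h: "adj h = h"
    by (simp add: h_def adj_add adj_adj add.commute)
  have "norm h \<le> norm x"
    using norm_triangle_ineq[of x "adj x"] by (simp add: h_def)
  then have "pos (norm x *\<^sub>R 1 - h)"
    by (rule pos_diff_of_norm_le[OF h])
  moreover have "adj (h - x) = - (h - x)"
  proof -
    have "x + adj x = 2 *\<^sub>R h" by (simp add: h_def)
    then have "adj x = 2 *\<^sub>R h - x" by (simp add: algebra_simps)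
    then show ?thesis by (simp add: adj_diff h scaleR_2)
  qed
  ultimately have "pos_mod J ((norm x *\<^sub>R 1 - h) + (h - x))"
    by (intro pos_mod_add pos_mod_of_pos pos_mod_of_skew)
  then show ?thesis by simp
qed

lemma pos_mod_dist:
  assumes z: "adj z = z" and pm: "pos_mod J (l *\<^sub>R 1 - z * z)" and "0 \<le> l" "d > 0"
  shows "\<exists>j\<in>J. (norm (z - j))\<^sup>2 \<le> l + d"
proof -
  obtain a j k where *: "pos a" "j \<in> J" "adj k = - k" "l *\<^sub>R 1 - z * z = a + j + k"
    using pm unfolding pos_mod_def by metis
  \<comment> \<open>Adding the adjoint equation cancels the skew part k, and what remains besides a
    lies in J because J is closed under \<open>adj\<close>.\<close>
  have "adj (l *\<^sub>R 1 - z * z) = a + adj j - k"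
    unfolding *(4) by (simp add: adj_add pos_selfadj * )
  then have "l *\<^sub>R 1 - z * z = a + adj j - k"
    using z by (simp add: adj_diff adj_mult)
  then have "2 *\<^sub>R (z * z + a - l *\<^sub>R 1) = - (j + adj j)"
    using *(4) unfolding scaleR_2 by (simp add: algebra_simps)
  moreover have "- (j + adj j) \<in> J"
    by (rule closed_ideal_mem(4)[OF J closed_ideal_mem(2)[OF J *(2) closed_ideal_adj[OF J *(2)]]])
  ultimately have "2 *\<^sub>R (z * z + a - l *\<^sub>R 1) \<in> J" by simp
  then have "(1/2) *\<^sub>R 2 *\<^sub>R (z * z + a - l *\<^sub>R 1) \<in> J"
    using closed_ideal_mem[OF J] by blast
  then show ?thesis
    using ideal_approx_sqrt[OF J z *(1) assms(3) _ assms(4)] by simp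
qed

context
  fixes z :: 'u
  assumes z: "adj z = z" "z \<notin> J"
begin

text \<open>If e0 > 0 is such that no point of J is nearer to z than e0, then
  \<open>pos_mod_dist\<close> forces l to be at least e0^2. This keeps the gauge of z^2 away from
  0.\<close>

lemma pos_mod_lower_bound: obtains e where "e > 0" "\<And>l. pos_mod J (l *\<^sub>R 1 - z * z) \<Longrightarrow> e \<le> l"
proof -
  have "open (- J)" "z \<in> - J"
    using closed_ideal_mem[OF J] z by auto
  then obtain e where e: "e > 0" "\<And>y. dist y z < e \<Longrightarrow> y \<notin> J"
    unfolding open_dist by auto
  have nonneg: "e\<^sup>2 \<le> l" if l: "pos_mod J (l *\<^sub>R 1 - z * z)" "0 \<le> l" for l
  proof (rule field_le_epsilon)
    fix d :: real assume "d > 0"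
    then obtain j where j: "j \<in> J" "(norm (z - j))\<^sup>2 \<le> l + d"
      using pos_mod_dist[OF z(1) l] by blast
    then have "e \<le> norm (z - j)"
      using e(2)[of j] by (force simp: dist_norm norm_minus_commute)
    then have "e\<^sup>2 \<le> (norm (z - j))\<^sup>2"
      using e(1) by (intro power_mono) auto
    then show "e\<^sup>2 \<le> l + d" using j by linarith
  qed
  show thesis
  proof (rule that[of "e\<^sup>2"])
    fix l assume l: "pos_mod J (l *\<^sub>R 1 - z * z)"
    show "e\<^sup>2 \<le> l"
    proof (cases "0 \<le> l")
      \<comment> \<open>A negative l could be raised to 0, and then the bound for nonnegative l
        fails.\<close>
      case False
      then show ?thesis
        using nonneg[OF pos_mod_shift[OF l, of 0]] e(1) by simp
    qed (use nonneg[OF l] in simp)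
  qed (use e in simp)
qed

text \<open>A negative multiple of 1 in the cone, scaled and added to norm (z^2) - z^2, would put -
  z^2 into the cone, against the lower bound.\<close>

lemma pos_mod_scalar_nonneg:
  assumes "pos_mod J (t *\<^sub>R 1)" shows "0 \<le> t"
proof (rule ccontr)
  assume "\<not> 0 \<le> t"
  then have t: "t < 0" by simp
  obtain e where e: "e > 0" "\<And>l. pos_mod J (l *\<^sub>R 1 - z * z) \<Longrightarrow> e \<le> l"
    by (rule pos_mod_lower_bound) blast
  define s where "s = norm (z * z) / - t"
  have "s \<ge> 0" using t by (simp add: s_def divide_nonneg_neg)
  then have "pos_mod J (s *\<^sub>R t *\<^sub>R 1 + (norm (z * z) *\<^sub>R 1 - z * z))"
    by (intro pos_mod_add pos_mod_scaleR assms pos_mod_norm)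
  moreover have "s *\<^sub>R t *\<^sub>R 1 + (norm (z * z) *\<^sub>R 1 - z * z) = 0 *\<^sub>R 1 - z * z"
    using t by (simp add: s_def)
  ultimately have "pos_mod J (0 *\<^sub>R 1 - z * z)" by argo
  then show False
    using e(1) e(2)[of 0] by simp
qed

section \<open>The gauge modulo J and its linear minorants\<close>

definition gauge :: "'u \<Rightarrow> real" where
  "gauge x = Inf {l. pos_mod J (l *\<^sub>R 1 - x)}"

lemma gauge_bdd: "bdd_below {l. pos_mod J (l *\<^sub>R 1 - x)}"
proof (rule bdd_belowI)
  fix l assume "l \<in> {l. pos_mod J (l *\<^sub>R 1 - x)}"
  then have "pos_mod J ((l *\<^sub>R 1 - x) + (norm (- x) *\<^sub>R 1 - (- x)))"
    by (intro pos_mod_add pos_mod_norm) auto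
  then have "pos_mod J ((l + norm x) *\<^sub>R 1)"
    by (simp add: algebra_simps)
  then show "- norm x \<le> l"
    using pos_mod_scalar_nonneg by fastforce
qed

lemma gauge_le: "pos_mod J (l *\<^sub>R 1 - x) \<Longrightarrow> gauge x \<le> l"
  unfolding gauge_def by (rule cInf_lower[OF _ gauge_bdd]) simp

lemma gauge_greatest: "(\<And>l. pos_mod J (l *\<^sub>R 1 - x) \<Longrightarrow> c \<le> l) \<Longrightarrow> c \<le> gauge x"
  unfolding gauge_def using pos_mod_norm by (intro cInf_greatest) auto

lemma sublinear_gauge: "sublinear gauge"
  unfolding sublinear_def
proof (intro conjI allI impI)
  fix x y
  have *: "gauge (x + y) \<le> l + m" if "pos_mod J (l *\<^sub>R 1 - x)" "pos_mod J (m *\<^sub>R 1 - y)" for l m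
    using gauge_le[of "l + m" "x + y"] pos_mod_add[OF that] by (simp add: algebra_simps)
  have "gauge (x + y) - l \<le> gauge y" if "pos_mod J (l *\<^sub>R 1 - x)" for l
    using *[OF that] by (intro gauge_greatest) (simp add: algebra_simps)
  then have "gauge (x + y) - gauge y \<le> gauge x"
    by (intro gauge_greatest) (simp add: algebra_simps)
  then show "gauge (x + y) \<le> gauge x + gauge y" by simp
next
  have le: "gauge (t *\<^sub>R x) \<le> t * gauge x" if "t > 0" for t x
  proof -
    have "gauge (t *\<^sub>R x) / t \<le> gauge x"
    proof (rule gauge_greatest)
      fix l assume "pos_mod J (l *\<^sub>R 1 - x)"
      then have "pos_mod J (t *\<^sub>R (l *\<^sub>R 1 - x))"
        using that by (intro pos_mod_scaleR) auto
      then have "gauge (t *\<^sub>R x) \<le> t * l"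
        by (intro gauge_le) (simp add: algebra_simps)
      then show "gauge (t *\<^sub>R x) / t \<le> l"
        using that by (simp add: field_simps)
    qed
    then show ?thesis using that by (simp add: field_simps)
  qed
  fix t :: real and x assume "0 \<le> t"
  show "gauge (t *\<^sub>R x) = t * gauge x"
  proof (cases "t = 0")
    case True
    have "gauge 0 = 0"
      using gauge_le[of 0 0] pos_mod_of_pos[OF pos_0] pos_mod_scalar_nonneg
      by (intro order_antisym gauge_greatest) auto
    then show ?thesis using True by simp
  next
    case False
    then have t: "t > 0" using \<open>0 \<le> t\<close> by simp
    then have "t * gauge x \<le> gauge (t *\<^sub>R x)"
      using le[of "1 / t" "t *\<^sub>R x"] by (simp add: field_simps)
    then show ?thesis using le[OF t, of x] by simp
  qed
qed

text \<open>Being below the gauge is thus being the real part of a state that vanishes on J, and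
  extremality below the gauge becomes purity.\<close>

lemma le_gauge_iff:
  assumes "linear f"
  shows "f \<le> gauge \<longleftrightarrow> (\<forall>x. pos_mod J x \<longrightarrow> 0 \<le> f x) \<and> f 1 = 1"
proof (intro iffI conjI allI impI)
  assume le: "f \<le> gauge"
  show "0 \<le> f x" if "pos_mod J x" for x
    using le_funD[OF le, of "- x"] gauge_le[of 0 "- x"] that by (simp add: linear_neg[OF assms])
  have "f 1 \<le> 1"
    using le_funD[OF le, of 1] gauge_le[of 1 1] pos_mod_of_pos[OF pos_0] by simp
  moreover have "f (- 1) \<le> - 1"
    using le_funD[OF le, of "- 1"] gauge_le[of "-1" "- 1"] pos_mod_of_pos[OF pos_0] by simp
  ultimately show "f 1 = 1" by (simp add: linear_neg[OF assms])
next
  assume *: "(\<forall>x. pos_mod J x \<longrightarrow> 0 \<le> f x) \<and> f 1 = 1"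
  show "f \<le> gauge"
  proof (rule le_funI, rule gauge_greatest)
    fix x l assume "pos_mod J (l *\<^sub>R 1 - x)"
    then have "0 \<le> f (l *\<^sub>R 1 - x)" using * by blast
    then show "f x \<le> l"
      using * by (simp add: linear_diff[OF assms] linear_scale[OF assms])
  qed
qed

text \<open>Dividing the two summands of a state by their values at 1 turns the sum into a convex
  combination of functionals below the gauge, to which extremality applies.\<close>

lemma Re_positive_functional_le_gauge:
  assumes "positive_functional J \<psi>" "t > 0" "Re (\<psi> 1) = t"
  shows "linear (\<lambda>x. Re (\<psi> x) / t)" "(\<lambda>x. Re (\<psi> x) / t) \<le> gauge"
proof -
  note D = positive_functionalD[OF assms(1)]
  show lin: "linear (\<lambda>x. Re (\<psi> x) / t)"
    by (rule linearI) (auto simp: D add_divide_distrib)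
  have "0 \<le> Re (\<psi> x)" if pm: "pos_mod J x" for x
  proof -
    obtain a j k where *: "pos a" "j \<in> J" "adj k = - k" "x = a + j + k"
      using pm unfolding pos_mod_def by metis
    obtain h where "adj h = h" "a = h * h"
      using * by (auto simp: pos_def)
    then have "0 \<le> Re (\<psi> a)" using D(4)[of h] by simp
    moreover have "Re (\<psi> k) = 0" using D(3)[of k] *(3) by (simp add: D complex_eq_iff)
    ultimately show ?thesis by (simp add: * D)
  qed
  then show "(\<lambda>x. Re (\<psi> x) / t) \<le> gauge"
    using assms(2,3) by (simp add: le_gauge_iff[OF lin])
qed

text \<open>The functional attains the gauge m at z^2, while its value at z^4 is at most m^2; so the
  variance of z^2 vanishes, which is the equation for 1 - z^2 / m. Purity is stated for sums, ready
  for the vector functionals of an invariant subspace and of its complement.\<close>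

theorem pure_state_exists:
  obtains \<phi> :: "'u \<Rightarrow> complex" and m :: real where "positive_functional J \<phi>" "\<phi> 1 = 1" "m > 0"
    "\<phi> ((1 - (1/m) *\<^sub>R (z * z)) * (1 - (1/m) *\<^sub>R (z * z))) = 0"
    "\<And>\<psi> \<psi>' x. positive_functional J \<psi> \<Longrightarrow> positive_functional J \<psi>' \<Longrightarrow> (\<And>x. \<phi> x = \<psi> x + \<psi>' x) \<Longrightarrow>
       Re (\<psi> 1) > 0 \<Longrightarrow> Re (\<psi>' 1) > 0 \<Longrightarrow> \<psi> x = complex_of_real (Re (\<psi> 1)) * \<phi> x"
proof -
  obtain f where f: "linear f" "f \<le> gauge" "f (z * z) = gauge (z * z)"
    and ext: "\<And>g h t. linear g \<Longrightarrow> linear h \<Longrightarrow> g \<le> gauge \<Longrightarrow> h \<le> gauge \<Longrightarrow> 0 < t \<Longrightarrow> t < 1 \<Longrightarrow>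
       (\<And>x. f x = t * g x + (1 - t) * h x) \<Longrightarrow> g = f"
    using extreme_functional_exists[OF sublinear_gauge, of "z * z"] by metis
  have fpos: "0 \<le> f x" if "pos_mod J x" for x
    using that f le_gauge_iff[OF f(1)] by blast
  have f1: "f 1 = 1"
    using f le_gauge_iff[OF f(1)] by blast
  have fl: "f (x + y) = f x + f y" "f (x - y) = f x - f y" "f (- x) = - f x" "f (r *\<^sub>R x) = r * f x" "f 0 = 0" for x y r
    using f(1) by (simp_all add: linear_add linear_diff linear_neg linear_scale linear_0)
  have fskew: "f k = 0" if "adj k = - k" for k
    using fpos[OF pos_mod_of_skew[of k]] fpos[OF pos_mod_of_skew[of "- k"]] that by (simp add: fl)
  have fJ: "f j = 0" if "j \<in> J" for j
    using fpos[OF pos_mod_of_ideal[of j]] fpos[OF pos_mod_of_ideal[of "- j"]] that closed_ideal_mem[OF J]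
    by (simp add: fl)
  have fadj: "f (adj x) = f x" for x
    using fskew[of "adj x - x"] by (simp add: adj_diff adj_adj fl)
  \<comment> \<open>A complex linear functional is determined by its real part, here f.\<close>
  define \<phi> where "\<phi> x = Complex (f x) (- f (\<i> *\<^sub>C x))" for x
  have \<phi>: "positive_functional J \<phi>"
    unfolding positive_functional_def
  proof (intro conjI allI ballI)
    show "\<phi> (x + y) = \<phi> x + \<phi> y" for x y
      by (simp add: \<phi>_def fl scaleC_add_right complex_eq_iff)
    show "\<phi> (c *\<^sub>C x) = c * \<phi> x" for c x
    proof -
      have "c *\<^sub>C x = Re c *\<^sub>R x + Im c *\<^sub>R \<i> *\<^sub>C x"
        by (simp add: scaleC_scaleC complex_eq_iff flip: scaleC_of_real scaleC_add_left)
      moreover have "\<i> *\<^sub>C c *\<^sub>C x = Re c *\<^sub>R \<i> *\<^sub>C x - Im c *\<^sub>R x"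
        by (simp add: scaleC_scaleC flip: scaleC_of_real scaleC_add_left complex_vector.scale_left_diff_distrib)
           (simp add: complex_eq_iff)
      ultimately show ?thesis
        by (simp add: \<phi>_def fl complex_eq_iff)
    qed
    show "\<phi> (adj x) = cnj (\<phi> x)" for x
    proof -
      have "adj (\<i> *\<^sub>C x) = - (\<i> *\<^sub>C adj x)"
        by (simp add: adj_scaleC)
      then show ?thesis
        using fadj[of "\<i> *\<^sub>C x"] by (simp add: \<phi>_def fadj fl complex_eq_iff)
    qed
    show "0 \<le> Re (\<phi> (adj x * x))" for x
      by (simp add: \<phi>_def fpos pos_mod_of_pos pos_adj_mult_self)
    show "\<phi> j = 0" if "j \<in> J" for j
      using that closed_ideal_mem[OF J] by (simp add: \<phi>_def fJ complex_eq_iff)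
  qed
  have selfadj: "\<phi> x = complex_of_real (f x)" if "adj x = x" for x
    using positive_functionalD(3)[OF \<phi>, of x] that by (simp add: \<phi>_def complex_eq_iff)
  define m where "m = gauge (z * z)"
  obtain e where e: "e > 0" "\<And>l. pos_mod J (l *\<^sub>R 1 - z * z) \<Longrightarrow> e \<le> l"
    by (rule pos_mod_lower_bound) blast
  have m: "m > 0"
    using gauge_greatest[of "z * z" e] e by (force simp: m_def)
  \<comment> \<open>If z^2 is at most l modulo J, conjugation by z bounds the value at z^4 by l
    times the value m at z^2; the infimum of these l is m again.\<close>
  have "f (z * (z * z) * z) / m \<le> gauge (z * z)"
  proof (rule gauge_greatest)
    fix l assume "pos_mod J (l *\<^sub>R 1 - z * z)"
    then have "0 \<le> f (adj z * (l *\<^sub>R 1 - z * z) * z)"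
      by (intro fpos pos_mod_conj)
    then have "f (z * (z * z) * z) \<le> l * f (z * z)"
      by (simp add: z fl algebra_simps)
    then show "f (z * (z * z) * z) / m \<le> l"
      using m by (simp add: f(3) m_def field_simps)
  qed
  then have m2: "f (z * (z * z) * z) \<le> m * m"
    using m by (simp add: m_def field_simps)
  let ?d = "1 - (1/m) *\<^sub>R (z * z)"
  have d: "adj ?d = ?d"
    by (simp add: adj_diff adj_mult z)
  have "f (?d * ?d) = 1 - 2 / m * f (z * z) + f (z * (z * z) * z) / (m * m)"
    by (simp add: algebra_simps fl f1)
  moreover have "f (z * (z * z) * z) / (m * m) \<le> 1"
    using m m2 by (simp add: divide_simps)
  moreover have "2 / m * f (z * z) = 2"
    using m f(3) by (simp add: m_def)
  ultimately have "f (?d * ?d) \<le> 0" by linarith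
  moreover have "0 \<le> f (?d * ?d)"
    by (intro fpos pos_mod_of_pos pos_selfadj_square d)
  ultimately have "\<phi> (?d * ?d) = 0"
    using selfadj[of "?d * ?d"] d by (simp add: adj_mult)
  moreover have "\<psi> x = Re (\<psi> 1) * \<phi> x"
    if \<psi>: "positive_functional J \<psi>" and \<psi>': "positive_functional J \<psi>'" and eq: "\<And>x. \<phi> x = \<psi> x + \<psi>' x"
      and 1: "Re (\<psi> 1) > 0" "Re (\<psi>' 1) > 0" for \<psi> \<psi>' x
  proof -
    define t where "t = Re (\<psi> 1)"
    have Re\<phi>: "Re (\<phi> x) = f x" for x by (simp add: \<phi>_def)
    have t': "Re (\<psi>' 1) = 1 - t"
      using arg_cong[OF eq[of 1], of Re] by (simp add: Re\<phi> f1 t_def)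
    have t: "0 < t" "t < 1" using 1 t' by (auto simp: t_def)
    have "(\<lambda>x. Re (\<psi> x) / t) = f"
    proof (rule ext)
      show "f x = t * (Re (\<psi> x) / t) + (1 - t) * (Re (\<psi>' x) / (1 - t))" for x
        using t arg_cong[OF eq[of x], of Re] by (simp add: Re\<phi>)
    qed (use Re_positive_functional_le_gauge[OF \<psi> t(1)] Re_positive_functional_le_gauge[OF \<psi>' _ t'] t
          in \<open>auto simp: t_def\<close>)
    then have Re\<psi>: "Re (\<psi> x) = t * f x" for x
      using t by (auto simp: fun_eq_iff field_simps)
    \<comment> \<open>Extremality identifies the real parts only; the imaginary parts follow by
      complex linearity.\<close>
    have "Im (\<psi> x) = - Re (\<psi> (\<i> *\<^sub>C x))"
      using positive_functionalD(2)[OF \<psi>, of \<i> x] by simp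
    then show ?thesis
      using Re\<psi>[of x] Re\<psi>[of "\<i> *\<^sub>C x"] by (simp add: complex_eq_iff \<phi>_def t_def)
  qed
  moreover have "\<phi> 1 = 1"
    using selfadj[of 1] f1 by simp
  ultimately show thesis
    using that \<phi> m by blast
qed

end

end

section \<open>Orthogonal projections\<close>

text \<open>The quadratic is the squared norm of x - r <x,y> y, where c is the square of the modulus
  of <x,y>; it serves Cauchy-Schwarz for seminorms as well, hence the case b = 0.\<close>

lemma quadratic_discriminant_le:
  fixes a b c :: real
  assumes "\<And>r. 0 \<le> a - 2 * r * c + r\<^sup>2 * c * b" "0 \<le> b" "0 \<le> c"
  shows "c \<le> a * b"
proof (cases "b = 0")
  case True
  have "c = 0"
  proof (rule ccontr)
    assume "c \<noteq> 0"
    then show False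
      \<comment> \<open>For b = 0 this r gives the value -1.\<close>
      using assms(1)[of "(a + 1) / (2 * c)"] True by (simp add: field_simps)
  qed
  then show ?thesis using True by simp
next
  case False
  then have "b > 0" using assms(2) by simp
  then show ?thesis
    using assms(1)[of "1 / b"] by (simp add: field_simps power2_eq_square)
qed

context complex_hilbert_space
begin

abbreviation hminus :: "'h \<Rightarrow> 'h \<Rightarrow> 'h" where
  "hminus x y \<equiv> hadd H x (hscale H (-1) y)"

lemma inner_add_right:
  assumes "x \<in> hcarrier H" "y \<in> hcarrier H" "z \<in> hcarrier H"
  shows "hinner H z (hadd H x y) = hinner H z x + hinner H z y"
  using inner_commute[of z "hadd H x y"] inner_commute[of x z] inner_commute[of y z] inner_add[OF assms]
  by (simp add: assms add_closed)

lemma inner_scale_right: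
  assumes "x \<in> hcarrier H" "z \<in> hcarrier H"
  shows "hinner H z (hscale H c x) = cnj c * hinner H z x"
  using inner_commute[of z "hscale H c x"] inner_commute[of x z] inner_scale[OF assms]
  by (simp add: assms scale_closed)

lemmas hilbert_simps = add_closed scale_closed inner_add inner_scale inner_add_right inner_scale_right

lemma vector_eqI:
  assumes "x \<in> hcarrier H" "y \<in> hcarrier H" "\<And>z. z \<in> hcarrier H \<Longrightarrow> hinner H x z = hinner H y z"
  shows "x = y"
proof -
  have "hminus x y \<in> hcarrier H"
    using assms by (simp add: hilbert_simps)
  then have "hinner H (hminus x y) (hminus x y) = 0"
    using assms by (simp add: inner_add inner_scale scale_closed del: inner_commute)
  then have "hminus x y = hzero H"
    using assms by (intro inner_eq_zero) (simp_all add: hilbert_simps)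
  then have "hadd H (hminus x y) y = hadd H (hzero H) y" by simp
  moreover have "hadd H (hminus x y) y = hadd H x (hminus y y)"
    using assms by (simp add: add_assoc add_commute[of "hscale H (-1) y" y] scale_closed)
  ultimately show ?thesis
    using assms add_inverse add_zero add_commute[of "hzero H" y] zero_closed by simp
qed

lemma hnorm_nonneg: "x \<in> hcarrier H \<Longrightarrow> 0 \<le> hnorm H x"
  by (simp add: hnorm_def inner_ge_zero)

lemma hnorm_power2: "x \<in> hcarrier H \<Longrightarrow> (hnorm H x)\<^sup>2 = Re (hinner H x x)"
  by (simp add: hnorm_def inner_ge_zero)

lemma hnorm_expand:
  assumes "x \<in> hcarrier H" "y \<in> hcarrier H"
  shows "Re (hinner H (hadd H x (hscale H (- (of_real r * hinner H x y)) y)) (hadd H x (hscale H (- (of_real r * hinner H x y)) y)))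
    = Re (hinner H x x) - 2 * r * (cmod (hinner H x y))\<^sup>2 + r\<^sup>2 * (cmod (hinner H x y))\<^sup>2 * Re (hinner H y y)"
proof -
  let ?w = "hinner H x y"
  have yx: "hinner H y x = cnj ?w" using inner_commute assms by blast
  have yy: "Im (hinner H y y) = 0"
    using arg_cong[OF inner_commute[of y y], of Im] assms by simp
  have cm: "(cmod ?w)\<^sup>2 = (Re ?w)\<^sup>2 + (Im ?w)\<^sup>2" by (simp add: cmod_power2)
  show ?thesis
    using assms by (simp add: hilbert_simps yx yy cm) (simp add: algebra_simps power2_eq_square)
qed

lemma Cauchy_Schwarz:
  assumes "x \<in> hcarrier H" "y \<in> hcarrier H"
  shows "cmod (hinner H x y) \<le> hnorm H x * hnorm H y"
proof -
  have "(cmod (hinner H x y))\<^sup>2 \<le> Re (hinner H x x) * Re (hinner H y y)"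
  proof (rule quadratic_discriminant_le)
    fix r :: real
    show "0 \<le> Re (hinner H x x) - 2 * r * (cmod (hinner H x y))\<^sup>2 + r\<^sup>2 * (cmod (hinner H x y))\<^sup>2 * Re (hinner H y y)"
      unfolding hnorm_expand[OF assms, symmetric] using assms by (intro inner_ge_zero) (simp add: hilbert_simps)
  qed (use assms inner_ge_zero in auto)
  then have "(cmod (hinner H x y))\<^sup>2 \<le> (hnorm H x * hnorm H y)\<^sup>2"
    using assms by (simp add: power_mult_distrib hnorm_power2)
  then show ?thesis
    by (rule power2_le_imp_le) (use assms hnorm_nonneg in auto)
qed

lemma hnorm_triangle:
  assumes "x \<in> hcarrier H" "y \<in> hcarrier H"
  shows "hnorm H (hadd H x y) \<le> hnorm H x + hnorm H y"
proof -
  have "(hnorm H (hadd H x y))\<^sup>2 = Re (hinner H x x) + Re (hinner H y y) + (Re (hinner H x y) + Re (hinner H y x))"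
    using assms by (simp add: hnorm_power2 hilbert_simps)
  also have "Re (hinner H y x) = Re (hinner H x y)"
    using inner_commute[of y x] assms by simp
  also have "Re (hinner H x y) \<le> hnorm H x * hnorm H y"
    using Cauchy_Schwarz[OF assms] complex_Re_le_cmod order_trans by blast
  finally have "(hnorm H (hadd H x y))\<^sup>2 \<le> (hnorm H x + hnorm H y)\<^sup>2"
    using assms by (simp add: hnorm_power2[symmetric] power2_sum)
  then show ?thesis
    by (rule power2_le_imp_le) (use assms hnorm_nonneg in auto)
qed

lemma hdist_parallelogram:
  assumes "v \<in> hcarrier H" "x \<in> hcarrier H" "y \<in> hcarrier H"
  shows "(hdist H x y)\<^sup>2 = 2 * (hdist H v x)\<^sup>2 + 2 * (hdist H v y)\<^sup>2 - 4 * (hdist H v (hscale H (1/2) (hadd H x y)))\<^sup>2"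
  using assms
  by (simp add: hdist_def hnorm_power2 hilbert_simps) (simp add: field_simps)

theorem orthogonal_decomposition:
  assumes W: "closed_hsubspace H W" and v: "v \<in> hcarrier H"
  obtains w where "w \<in> W" "\<And>u. u \<in> W \<Longrightarrow> hinner H (hminus v w) u = 0"
proof -
  have WH: "x \<in> hcarrier H" if "x \<in> W" for x
    using W that by (auto simp: closed_hsubspace_def)
  have Wadd: "hadd H x y \<in> W" if "x \<in> W" "y \<in> W" for x y
    using W that by (auto simp: closed_hsubspace_def)
  have Wscale: "hscale H c x \<in> W" if "x \<in> W" for x c
    using W that by (auto simp: closed_hsubspace_def)
  define d where "d = (INF x\<in>W. (hdist H v x)\<^sup>2)"
  have W0: "hzero H \<in> W" using W by (auto simp: closed_hsubspace_def)
  have bdd: "bdd_below ((\<lambda>x. (hdist H v x)\<^sup>2) ` W)"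
    by (rule bdd_belowI2[of _ 0]) simp
  have d_le: "d \<le> (hdist H v x)\<^sup>2" if "x \<in> W" for x
    unfolding d_def using bdd that by (intro cINF_lower)
  have "\<exists>x\<in>W. (hdist H v x)\<^sup>2 < d + 1 / real (Suc n)" for n
    using cINF_less_iff[OF _ bdd, of "d + 1 / real (Suc n)"] W0 by (auto simp: d_def)
  then obtain w where w: "\<And>n. w n \<in> W" "\<And>n. (hdist H v (w n))\<^sup>2 < d + 1 / real (Suc n)"
    by metis
  \<comment> \<open>The midpoint of two approximants is again in W, so the parallelogram law leaves
    less than 2/(m+1) + 2/(n+1).\<close>
  have cau: "(hdist H (w m) (w n))\<^sup>2 < 4 / real (Suc N)" if "m \<ge> N" "n \<ge> N" for m n N
  proof -
    have "1 / real (Suc m) \<le> 1 / real (Suc N)" "1 / real (Suc n) \<le> 1 / real (Suc N)"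
      using that by (simp_all add: frac_le)
    moreover have "d \<le> (hdist H v (hscale H (1/2) (hadd H (w m) (w n))))\<^sup>2"
      by (intro d_le Wscale Wadd w)
    ultimately show ?thesis
      using hdist_parallelogram[OF v WH[OF w(1)] WH[OF w(1)], of m n] w(2)[of m] w(2)[of n]
      by linarith
  qed
  have "\<exists>N. \<forall>m\<ge>N. \<forall>n\<ge>N. hdist H (w m) (w n) < e" if "e > 0" for e :: real
  proof -
    obtain N where "4 / e\<^sup>2 < real N"
      using reals_Archimedean2 by blast
    then have "4 / real (Suc N) < e\<^sup>2"
      using that by (simp add: field_simps) (smt (verit) zero_less_power)
    then have "(hdist H (w m) (w n))\<^sup>2 < e\<^sup>2" if "m \<ge> N" "n \<ge> N" for m n
      using cau[OF that] by linarith
    then have "hdist H (w m) (w n) < e" if "m \<ge> N" "n \<ge> N" for m n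
      using that \<open>e > 0\<close> power2_less_imp_less[of "hdist H (w m) (w n)" e] by simp
    then show ?thesis by blast
  qed
  then obtain x where x: "x \<in> hcarrier H" "(\<lambda>n. hdist H (w n) x) \<longlonglongrightarrow> 0"
    using complete[of w] w(1) WH by blast
  have xW: "x \<in> W"
    using W w(1) x unfolding closed_hsubspace_def by blast
  have "hdist H v x \<le> sqrt d"
  proof (rule LIMSEQ_le_const)
    have "(\<lambda>n. sqrt (d + 1 / real (Suc n)) + hdist H (w n) x) \<longlonglongrightarrow> sqrt (d + 0) + 0"
      by (intro tendsto_intros x(2) LIMSEQ_Suc[OF lim_1_over_n])
    then show "(\<lambda>n. sqrt (d + 1 / real (Suc n)) + hdist H (w n) x) \<longlonglongrightarrow> sqrt d" by simp
    have "hdist H v x \<le> sqrt (d + 1 / real (Suc n)) + hdist H (w n) x" for n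
    proof -
      have wn: "w n \<in> hcarrier H" using w WH by blast
      have "hminus v x = hadd H (hminus v (w n)) (hminus (w n) x)"
        using v x(1) wn by (intro vector_eqI) (simp_all add: hilbert_simps)
      then have "hdist H v x \<le> hdist H v (w n) + hdist H (w n) x"
        unfolding hdist_def using v x(1) wn by (simp add: hnorm_triangle hilbert_simps)
      moreover have "hdist H v (w n) \<le> sqrt (d + 1 / real (Suc n))"
        using w(2)[of n] by (intro real_le_rsqrt) simp
      ultimately show ?thesis by linarith
    qed
    then show "\<exists>N. \<forall>n\<ge>N. hdist H v x \<le> sqrt (d + 1 / real (Suc n)) + hdist H (w n) x" by blast
  qed
  moreover have "0 \<le> d"
    unfolding d_def using W0 by (intro cINF_greatest) auto
  ultimately have dx: "(hdist H v x)\<^sup>2 \<le> d"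
    using v x hnorm_nonneg[of "hminus v x"]
    by (metis add_closed hdist_def power_mono real_sqrt_pow2 scale_closed)
  show thesis
  proof (rule that[OF xW])
    fix u assume u: "u \<in> W"
    let ?y = "hminus v x"
    have y: "?y \<in> hcarrier H" using v x by (simp add: hilbert_simps)
    \<comment> \<open>Since x attains the minimum d, the constant term cancels and the discriminant
      lemma applies with a = 0.\<close>
    have "(cmod (hinner H ?y u))\<^sup>2 \<le> 0 * Re (hinner H u u)"
    proof (rule quadratic_discriminant_le)
      fix r :: real
      let ?c = "of_real r * hinner H ?y u"
      have "hadd H ?y (hscale H (- ?c) u) = hminus v (hadd H x (hscale H ?c u))"
        using v x u WH by (intro vector_eqI) (simp_all add: hilbert_simps)
      then have "Re (hinner H (hadd H ?y (hscale H (- ?c) u)) (hadd H ?y (hscale H (- ?c) u)))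
          = (hdist H v (hadd H x (hscale H ?c u)))\<^sup>2"
        unfolding hdist_def using v x u WH by (simp add: hnorm_power2 hilbert_simps)
      then have "d \<le> Re (hinner H (hadd H ?y (hscale H (- ?c) u)) (hadd H ?y (hscale H (- ?c) u)))"
        using d_le[OF Wadd[OF xW Wscale[OF u, of ?c]]] by simp
      also have "\<dots> = Re (hinner H ?y ?y) - 2 * r * (cmod (hinner H ?y u))\<^sup>2
          + r\<^sup>2 * (cmod (hinner H ?y u))\<^sup>2 * Re (hinner H u u)"
        by (rule hnorm_expand[OF y WH[OF u]])
      finally show "0 \<le> 0 - 2 * r * (cmod (hinner H ?y u))\<^sup>2 + r\<^sup>2 * (cmod (hinner H ?y u))\<^sup>2 * Re (hinner H u u)"
        using dx hnorm_power2[OF y] by (simp add: hdist_def)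
    qed (use WH[OF u] inner_ge_zero in auto)
    then show "hinner H ?y u = 0" by simp
  qed
qed

end

section \<open>The GNS representation\<close>

text \<open>The completion of the algebra for the seminorm of a positive functional, realised as the space of
  limits of the antilinear functionals \<open>a \<mapsto> \<Phi> (adj a * x)\<close>.\<close>

locale gns =
  fixes \<Phi> :: "'a::cstar_algebra \<Rightarrow> complex"
  assumes positive: "positive_functional {} \<Phi>"
    and mult_bound: "Re (\<Phi> (adj (b * x) * (b * x))) \<le> (norm b)\<^sup>2 * Re (\<Phi> (adj x * x))"
begin

lemmas \<Phi>_simps = positive_functionalD(1,2,6-9)[OF positive]

definition gprod :: "'a \<Rightarrow> 'a \<Rightarrow> complex" where
  "gprod x y = \<Phi> (adj y * x)"

definition gnorm :: "'a \<Rightarrow> real" where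
  "gnorm x = sqrt (Re (gprod x x))"

lemma gprod_commute: "gprod y x = cnj (gprod x y)"
  using positive_functionalD(3)[OF positive, of "adj y * x"] by (simp add: gprod_def adj_mult adj_adj)

lemma gprod_simps:
  "gprod (x + x') y = gprod x y + gprod x' y" "gprod (x - x') y = gprod x y - gprod x' y"
  "gprod x (y + y') = gprod x y + gprod x y'" "gprod x (y - y') = gprod x y - gprod x y'"
  "gprod (c *\<^sub>C x) y = c * gprod x y" "gprod x (c *\<^sub>C y) = cnj c * gprod x y"
  "gprod (b * x) y = gprod x (adj b * y)"
  by (simp_all add: gprod_def \<Phi>_simps adj_add adj_diff adj_scaleC algebra_simps mult_scaleC_left
      mult_scaleC_right adj_mult adj_adj)

lemma gprod_nonneg: "0 \<le> Re (gprod x x)"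
  unfolding gprod_def by (rule positive_functionalD(4)[OF positive])

lemma gnorm_nonneg [simp]: "0 \<le> gnorm x"
  by (simp add: gnorm_def gprod_nonneg)

lemma gnorm_power2: "(gnorm x)\<^sup>2 = Re (gprod x x)"
  by (simp add: gnorm_def gprod_nonneg)

lemma gprod_self: "gprod x x = of_real ((gnorm x)\<^sup>2)"
  using gprod_commute[of x x] by (simp add: gnorm_power2 complex_eq_iff)

lemma gprod_Cauchy_Schwarz: "cmod (gprod x y) \<le> gnorm x * gnorm y"
proof -
  let ?w = "gprod x y"
  have "(cmod ?w)\<^sup>2 \<le> (gnorm x)\<^sup>2 * (gnorm y)\<^sup>2"
  proof (rule quadratic_discriminant_le)
    fix r :: real
    let ?v = "x - (of_real r * ?w) *\<^sub>C y"
    have "0 \<le> Re (gprod ?v ?v)" by (rule gprod_nonneg)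
    also have "Re (gprod ?v ?v) = (gnorm x)\<^sup>2 - 2 * r * (cmod ?w)\<^sup>2 + r\<^sup>2 * (cmod ?w)\<^sup>2 * (gnorm y)\<^sup>2"
      by (simp add: gprod_simps gprod_self[of x] gprod_self[of y] gprod_commute[of y x] cmod_power2)
        (simp add: algebra_simps power2_eq_square)
    finally show "0 \<le> (gnorm x)\<^sup>2 - 2 * r * (cmod ?w)\<^sup>2 + r\<^sup>2 * (cmod ?w)\<^sup>2 * (gnorm y)\<^sup>2" .
  qed auto
  then have "(cmod ?w)\<^sup>2 \<le> (gnorm x * gnorm y)\<^sup>2"
    by (simp add: power_mult_distrib)
  then show ?thesis
    by (rule power2_le_imp_le) simp
qed

lemma gnorm_triangle: "gnorm (x + y) \<le> gnorm x + gnorm y"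
proof -
  have "(gnorm (x + y))\<^sup>2 = (gnorm x)\<^sup>2 + (gnorm y)\<^sup>2 + 2 * Re (gprod x y)"
    by (simp add: gnorm_power2 gprod_simps gprod_commute[of y x])
  also have "Re (gprod x y) \<le> gnorm x * gnorm y"
    using gprod_Cauchy_Schwarz complex_Re_le_cmod order_trans by blast
  finally have "(gnorm (x + y))\<^sup>2 \<le> (gnorm x + gnorm y)\<^sup>2"
    by (simp add: power2_sum)
  then show ?thesis
    by (rule power2_le_imp_le) simp
qed

lemma gnorm_minus_commute: "gnorm (x - y) = gnorm (y - x)"
  by (simp add: gnorm_def gprod_simps)

lemma gnorm_triangle_diff: "gnorm (x - z) \<le> gnorm (x - y) + gnorm (y - z)"
  using gnorm_triangle[of "x - y" "y - z"] by simp

lemma gnorm_scaleC: "gnorm (c *\<^sub>C x) = cmod c * gnorm x"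
proof -
  have "gprod (c *\<^sub>C x) (c *\<^sub>C x) = (c * cnj c) * gprod x x"
    by (simp add: gprod_simps)
  then show ?thesis
    unfolding gnorm_def complex_norm_square[symmetric] by (simp add: real_sqrt_mult)
qed

lemma gnorm_mult_le: "gnorm (b * x) \<le> norm b * gnorm x"
proof -
  have "(gnorm (b * x))\<^sup>2 \<le> (norm b * gnorm x)\<^sup>2"
    using mult_bound[of b x] by (simp add: gnorm_power2 power_mult_distrib gprod_def)
  then show ?thesis
    by (rule power2_le_imp_le) simp
qed

section \<open>The completion: Cauchy sequences and the functions that represent their
  limits\<close>

definition gcauchy :: "(nat \<Rightarrow> 'a) \<Rightarrow> bool" where
  "gcauchy X \<longleftrightarrow> (\<forall>e>0. \<exists>N. \<forall>m\<ge>N. \<forall>n\<ge>N. gnorm (X m - X n) < e)"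

text \<open>The function g is the point of the completion given by X: \<open>g a\<close> is the
  inner product of that point with the class of a.\<close>

definition represents :: "(nat \<Rightarrow> 'a) \<Rightarrow> ('a \<Rightarrow> complex) \<Rightarrow> bool" where
  "represents X g \<longleftrightarrow> gcauchy X \<and> (\<forall>a. (\<lambda>n. gprod (X n) a) \<longlonglongrightarrow> g a)"

lemma represents_limit: "represents X g \<Longrightarrow> (\<lambda>n. gprod (X n) a) \<longlonglongrightarrow> g a"
  by (simp add: represents_def)

lemma gcauchy_const: "gcauchy (\<lambda>_. x)"
  by (auto simp: gcauchy_def gnorm_def gprod_def \<Phi>_simps)

lemma represents_const: "represents (\<lambda>_. x) (gprod x)"
  by (auto simp: represents_def gcauchy_const)

lemma gcauchy_add:
  assumes "gcauchy X" "gcauchy Y" shows "gcauchy (\<lambda>n. X n + Y n)"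
  unfolding gcauchy_def
proof (intro allI impI)
  fix e :: real assume "e > 0"
  then obtain M N where "\<forall>m\<ge>M. \<forall>n\<ge>M. gnorm (X m - X n) < e / 2" "\<forall>m\<ge>N. \<forall>n\<ge>N. gnorm (Y m - Y n) < e / 2"
    using assms unfolding gcauchy_def by (meson half_gt_zero)
  then have "gnorm (X m + Y m - (X n + Y n)) < e" if "m \<ge> max M N" "n \<ge> max M N" for m n
    using gnorm_triangle[of "X m - X n" "Y m - Y n"] that
    by (simp add: add_diff_add) (smt (verit) field_sum_of_halves)
  then show "\<exists>N. \<forall>m\<ge>N. \<forall>n\<ge>N. gnorm (X m + Y m - (X n + Y n)) < e" by blast
qed

lemma gcauchy_lipschitz:
  assumes "gcauchy X" and le: "\<And>m n. gnorm (Y m - Y n) \<le> K * gnorm (X m - X n)"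
  shows "gcauchy Y"
  unfolding gcauchy_def
proof (intro allI impI)
  fix e :: real assume "e > 0"
  then have "e / (\<bar>K\<bar> + 1) > 0" by simp
  then obtain N where N: "\<forall>m\<ge>N. \<forall>n\<ge>N. gnorm (X m - X n) < e / (\<bar>K\<bar> + 1)"
    using assms unfolding gcauchy_def by meson
  have "gnorm (Y m - Y n) < e" if "m \<ge> N" "n \<ge> N" for m n
  proof -
    have "gnorm (Y m - Y n) \<le> (\<bar>K\<bar> + 1) * gnorm (X m - X n)"
      by (rule order_trans[OF le]) (intro mult_right_mono, auto)
    also have "\<dots> < e"
      using N that by (simp add: field_simps)
    finally show ?thesis .
  qed
  then show "\<exists>N. \<forall>m\<ge>N. \<forall>n\<ge>N. gnorm (Y m - Y n) < e" by blast
qed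

lemma gcauchy_bounded:
  assumes "gcauchy X" obtains M where "M > 0" "\<And>n. gnorm (X n) \<le> M"
proof -
  obtain N where N: "\<forall>m\<ge>N. \<forall>n\<ge>N. gnorm (X m - X n) < 1"
    using assms unfolding gcauchy_def by (meson zero_less_one)
  define M where "M = Max ((\<lambda>n. gnorm (X n)) ` {..N}) + 1"
  have M: "gnorm (X n) + 1 \<le> M" if "n \<le> N" for n
    unfolding M_def using that by (simp add: Max_ge_iff)
  show thesis
  proof (rule that[of M])
    show "M > 0" using M[of N] gnorm_nonneg[of "X N"] by linarith
    show "gnorm (X n) \<le> M" for n
    proof (cases "n \<le> N")
      case False
      then have "gnorm (X n - X N) < 1" using N by simp
      then show ?thesis
        using gnorm_triangle[of "X n - X N" "X N"] M[of N] by simp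
    qed (use M[of n] in simp)
  qed
qed

lemma represents_add:
  assumes "represents X g" "represents Y h" shows "represents (\<lambda>n. X n + Y n) (\<lambda>a. g a + h a)"
  using assms by (auto simp: represents_def gcauchy_add gprod_simps intro!: tendsto_add)

lemma represents_scale:
  assumes "represents X g" shows "represents (\<lambda>n. c *\<^sub>C X n) (\<lambda>a. c * g a)"
proof -
  have "gnorm (c *\<^sub>C X m - c *\<^sub>C X n) \<le> cmod c * gnorm (X m - X n)" for m n
    using gnorm_scaleC[of c "X m - X n"] by (simp add: scaleC_diff_right)
  then have "gcauchy (\<lambda>n. c *\<^sub>C X n)"
    by (rule gcauchy_lipschitz[rotated]) (use assms in \<open>simp add: represents_def\<close>)
  then show ?thesis
    using assms by (auto simp: represents_def gprod_simps intro!: tendsto_mult_left)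
qed

lemma represents_mult:
  assumes "represents X g" shows "represents (\<lambda>n. b * X n) (\<lambda>a. g (adj b * a))"
proof -
  have "gnorm (b * X m - b * X n) \<le> norm b * gnorm (X m - X n)" for m n
    using gnorm_mult_le[of b "X m - X n"] by (simp add: algebra_simps)
  then have "gcauchy (\<lambda>n. b * X n)"
    by (rule gcauchy_lipschitz[rotated]) (use assms in \<open>simp add: represents_def\<close>)
  then show ?thesis
    using assms by (auto simp: represents_def gprod_simps)
qed

lemma represents_diff:
  assumes "represents X g" "represents Y h" shows "represents (\<lambda>n. X n - Y n) (\<lambda>a. g a - h a)"
  using represents_add[OF assms(1) represents_scale[OF assms(2), of "-1"]] by simp

lemma represented_antilinear:
  assumes "represents X g"
  shows "g (a + b) = g a + g b" "g (a - b) = g a - g b" "g (c *\<^sub>C a) = cnj c * g a"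
proof -
  note lim = represents_limit[OF assms]
  show "g (a + b) = g a + g b"
    using LIMSEQ_unique[OF lim[of "a + b"]] tendsto_add[OF lim[of a] lim[of b]] by (simp add: gprod_simps)
  show "g (a - b) = g a - g b"
    using LIMSEQ_unique[OF lim[of "a - b"]] tendsto_diff[OF lim[of a] lim[of b]] by (simp add: gprod_simps)
  show "g (c *\<^sub>C a) = cnj c * g a"
    using LIMSEQ_unique[OF lim[of "c *\<^sub>C a"]] tendsto_mult_left[OF lim[of a], of "cnj c"] by (simp add: gprod_simps)
qed

lemma represented_bounded:
  assumes "represents X g" obtains M where "M > 0" "\<And>a. cmod (g a) \<le> M * gnorm a"
proof -
  obtain M where M: "M > 0" "\<And>n. gnorm (X n) \<le> M"
    using assms gcauchy_bounded unfolding represents_def by blast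
  have "cmod (g a) \<le> M * gnorm a" for a
  proof (rule LIMSEQ_le_const2)
    show "(\<lambda>n. cmod (gprod (X n) a)) \<longlonglongrightarrow> cmod (g a)"
      by (intro tendsto_norm represents_limit[OF assms])
    have "cmod (gprod (X n) a) \<le> M * gnorm a" for n
      using gprod_Cauchy_Schwarz[of "X n" a] mult_right_mono[OF M(2)[of n] gnorm_nonneg[of a]] by linarith
    then show "\<exists>N. \<forall>n\<ge>N. cmod (gprod (X n) a) \<le> M * gnorm a" by blast
  qed
  then show thesis using that M by blast
qed

lemma represents_zero_gnorm:
  assumes "represents X (\<lambda>a. 0)" shows "(\<lambda>n. gnorm (X n)) \<longlonglongrightarrow> 0"
proof (rule LIMSEQ_I)
  fix r :: real assume "r > 0"
  have X: "gcauchy X" using assms by (simp add: represents_def)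
  obtain M where M: "M > 0" "\<And>n. gnorm (X n) \<le> M"
    using gcauchy_bounded[OF X] by blast
  define e where "e = r\<^sup>2 / (2 * M)"
  have "e > 0" using M \<open>r > 0\<close> by (simp add: e_def)
  then obtain N where N: "\<And>m n. m \<ge> N \<Longrightarrow> n \<ge> N \<Longrightarrow> gnorm (X m - X n) < e"
    using X unfolding gcauchy_def by meson
  have "r\<^sup>2 / 2 > 0" using \<open>r > 0\<close> by simp
  then obtain N' where N': "\<And>n. n \<ge> N' \<Longrightarrow> cmod (gprod (X n) (X N)) < r\<^sup>2 / 2"
    using LIMSEQ_D[OF represents_limit[OF assms, of "X N"]] by (metis diff_zero)
  have "gnorm (X n) < r" if n: "n \<ge> N" "n \<ge> N'" for n
  proof -
    have "(gnorm (X n))\<^sup>2 = Re (gprod (X n) (X N)) + Re (gprod (X n) (X n - X N))"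
      by (simp add: gnorm_power2 gprod_simps)
    also have "Re (gprod (X n) (X N)) < r\<^sup>2 / 2"
      using N'[OF n(2)] complex_Re_le_cmod order_le_less_trans by blast
    also have "Re (gprod (X n) (X n - X N)) \<le> M * e"
    proof -
      have "Re (gprod (X n) (X n - X N)) \<le> gnorm (X n) * gnorm (X n - X N)"
        using gprod_Cauchy_Schwarz complex_Re_le_cmod order_trans by blast
      also have "\<dots> \<le> M * e"
        using M N[of n N] n by (intro mult_mono) auto
      finally show ?thesis .
    qed
    also have "r\<^sup>2 / 2 + M * e = r\<^sup>2"
      using M by (simp add: e_def)
    finally have "(gnorm (X n))\<^sup>2 < r\<^sup>2" by simp
    then show ?thesis
      by (rule power2_less_imp_less) (use \<open>r > 0\<close> in simp)
  qed
  then show "\<exists>no. \<forall>n\<ge>no. norm (gnorm (X n) - 0) < r"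
    by (intro exI[of _ "max N N'"]) simp
qed

text \<open>The choice of Y is immaterial, since by \<open>ginner_limit\<close> every sequence that
  represents h gives the same limit.\<close>

definition ginner :: "('a \<Rightarrow> complex) \<Rightarrow> ('a \<Rightarrow> complex) \<Rightarrow> complex" where
  "ginner g h = lim (\<lambda>n. g ((SOME Y. represents Y h) n))"

lemma ginner_limit:
  assumes g: "represents X g" and h: "represents Y h"
  shows "(\<lambda>n. g (Y n)) \<longlonglongrightarrow> ginner g h"
proof -
  obtain M where M: "M > 0" "\<And>a. cmod (g a) \<le> M * gnorm a"
    using represented_bounded[OF g] by blast
  define Z where "Z = (SOME Y. represents Y h)"
  have Z: "represents Z h"
    unfolding Z_def using h by (rule someI[of "\<lambda>Y. represents Y h"])
  have "Cauchy (\<lambda>n. g (Z n))"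
  proof (rule CauchyI)
    fix e :: real assume "e > 0"
    then have "e / M > 0" using M by simp
    then obtain N where N: "\<And>m n. m \<ge> N \<Longrightarrow> n \<ge> N \<Longrightarrow> gnorm (Z m - Z n) < e / M"
      using Z unfolding represents_def gcauchy_def by meson
    have "cmod (g (Z m) - g (Z n)) < e" if "m \<ge> N" "n \<ge> N" for m n
      using M(2)[of "Z m - Z n"] N[OF that] M(1) by (simp add: represented_antilinear[OF g] field_simps)
    then show "\<exists>N. \<forall>m\<ge>N. \<forall>n\<ge>N. cmod (g (Z m) - g (Z n)) < e" by blast
  qed
  then have lim: "(\<lambda>n. g (Z n)) \<longlonglongrightarrow> ginner g h"
    unfolding ginner_def Z_def by (simp add: Cauchy_convergent_iff convergent_LIMSEQ_iff)
  have "represents (\<lambda>n. Y n - Z n) (\<lambda>a. 0)"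
    using represents_diff[OF h Z] by simp
  then have "(\<lambda>n. M * gnorm (Y n - Z n)) \<longlonglongrightarrow> M * 0"
    by (intro tendsto_mult_left represents_zero_gnorm)
  then have "(\<lambda>n. M * gnorm (Y n - Z n)) \<longlonglongrightarrow> 0" by simp
  then have "(\<lambda>n. g (Y n - Z n)) \<longlonglongrightarrow> 0"
    by (rule Lim_null_comparison[OF always_eventually[OF allI[OF M(2)]]])
  from tendsto_add[OF this lim] show ?thesis
    by (simp add: represented_antilinear[OF g])
qed

text \<open>This form treats both arguments alike, so that conjugate symmetry and positivity pass
  from \<open>gprod\<close> to the limit.\<close>

lemma ginner_gprod_limit:
  assumes g: "represents X g" and h: "represents Y h"
  shows "(\<lambda>n. gprod (X n) (Y n)) \<longlonglongrightarrow> ginner g h"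
proof -
  obtain M where M: "M > 0" "\<And>n. gnorm (Y n) \<le> M"
    using h gcauchy_bounded unfolding represents_def by blast
  have "(\<lambda>n. gprod (X n) (Y n) - g (Y n)) \<longlonglongrightarrow> 0"
  proof (rule LIMSEQ_I)
    fix r :: real assume "r > 0"
    then have "r / (2 * M) > 0" using M by simp
    then obtain N where N: "\<And>m n. m \<ge> N \<Longrightarrow> n \<ge> N \<Longrightarrow> gnorm (X m - X n) < r / (2 * M)"
      using g unfolding represents_def gcauchy_def by meson
    have "cmod (gprod (X n) (Y n) - g (Y n)) < r" if "n \<ge> N" for n
    proof -
      have "cmod (gprod (X n) (Y n) - g (Y n)) \<le> r / 2"
      proof (rule LIMSEQ_le_const2)
        show "(\<lambda>m. cmod (gprod (X n) (Y n) - gprod (X m) (Y n))) \<longlonglongrightarrow> cmod (gprod (X n) (Y n) - g (Y n))"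
          by (intro tendsto_intros represents_limit[OF g])
        have "cmod (gprod (X n) (Y n) - gprod (X m) (Y n)) \<le> r / 2" if "m \<ge> N" for m
        proof -
          have "cmod (gprod (X n - X m) (Y n)) \<le> gnorm (X n - X m) * gnorm (Y n)"
            by (rule gprod_Cauchy_Schwarz)
          also have "\<dots> \<le> r / (2 * M) * M"
            using M N[OF \<open>n \<ge> N\<close> that] \<open>r > 0\<close> by (intro mult_mono) auto
          finally show ?thesis using M by (simp add: gprod_simps)
        qed
        then show "\<exists>N. \<forall>m\<ge>N. cmod (gprod (X n) (Y n) - gprod (X m) (Y n)) \<le> r / 2" by blast
      qed
      then show ?thesis using \<open>r > 0\<close> by simp
    qed
    then show "\<exists>no. \<forall>n\<ge>no. norm (gprod (X n) (Y n) - g (Y n) - 0) < r" by auto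
  qed
  from tendsto_add[OF this ginner_limit[OF g h]] show ?thesis by simp
qed

definition gspace :: "('a \<Rightarrow> complex) hilbert_data" where
  "gspace = \<lparr>hcarrier = {g. \<exists>X. represents X g}, hzero = (\<lambda>a. 0), hadd = (\<lambda>g h a. g a + h a),
     hscale = (\<lambda>c g a. c * g a), hinner = ginner\<rparr>"

lemma gspace_simps [simp]:
  "g \<in> hcarrier gspace \<longleftrightarrow> (\<exists>X. represents X g)" "hzero gspace = (\<lambda>a. 0)"
  "hadd gspace g h = (\<lambda>a. g a + h a)" "hscale gspace c g = (\<lambda>a. c * g a)" "hinner gspace = ginner"
  by (simp_all add: gspace_def)

lemma gprod_in_gspace: "gprod x \<in> hcarrier gspace"
  using represents_const by auto

lemma ginner_gprod: "represents X g \<Longrightarrow> ginner g (gprod y) = g y"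
  using LIMSEQ_unique[OF ginner_limit[OF _ represents_const]] by auto

lemma hdist_limit:
  assumes g: "represents X g" and h: "represents Y h"
  shows "(\<lambda>n. gnorm (X n - Y n)) \<longlonglongrightarrow> hdist gspace g h"
proof -
  have d: "represents (\<lambda>n. X n - Y n) (\<lambda>a. g a + (-1) * h a)"
    using represents_diff[OF assms] by simp
  then show ?thesis
    unfolding gnorm_def hdist_def hnorm_def gspace_simps
    by (intro tendsto_real_sqrt tendsto_Re ginner_gprod_limit)
qed

lemma hdist_gspace_triangle:
  assumes "represents X g" "represents Y h" "represents Z k"
  shows "hdist gspace g k \<le> hdist gspace g h + hdist gspace h k"
  by (rule LIMSEQ_le[OF hdist_limit[OF assms(1,3)] tendsto_add[OF hdist_limit[OF assms(1,2)] hdist_limit[OF assms(2,3)]]])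
    (use gnorm_triangle_diff in blast)

lemma hdist_gprod_tendsto:
  assumes "represents X g"
  shows "(\<lambda>n. hdist gspace g (gprod (X n))) \<longlonglongrightarrow> 0"
proof (rule LIMSEQ_I)
  fix r :: real assume "r > 0"
  then have "r / 2 > 0" by simp
  then obtain N where N: "\<And>m n. m \<ge> N \<Longrightarrow> n \<ge> N \<Longrightarrow> gnorm (X m - X n) < r / 2"
    using assms unfolding represents_def gcauchy_def by meson
  have "0 \<le> hdist gspace g (gprod (X n)) \<and> hdist gspace g (gprod (X n)) < r" if "n \<ge> N" for n
  proof -
    note lim = hdist_limit[OF assms represents_const[of "X n"]]
    have "hdist gspace g (gprod (X n)) \<le> r / 2"
      by (rule LIMSEQ_le_const2[OF lim]) (use N that less_imp_le in blast)
    moreover have "0 \<le> hdist gspace g (gprod (X n))"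
      by (rule LIMSEQ_le_const[OF lim]) auto
    ultimately show ?thesis using \<open>r > 0\<close> by auto
  qed
  then show "\<exists>no. \<forall>n\<ge>no. norm (hdist gspace g (gprod (X n)) - 0) < r"
    by (intro exI[of _ N]) auto
qed

lemma hdist_gspace_commute:
  assumes "represents X g" "represents Y h" shows "hdist gspace g h = hdist gspace h g"
  using LIMSEQ_unique[OF hdist_limit[OF assms]] hdist_limit[OF assms(2,1)] gnorm_minus_commute by simp

text \<open>Each \<open>u n\<close> is replaced by the class of some \<open>x n\<close> at distance
  below 1/(n+1); the sequence x is again Cauchy, and the function that it represents is the
  limit.\<close>

lemma gspace_complete:
  assumes u: "\<And>n. \<exists>X. represents X (u n)"
    and cau: "\<forall>e>0. \<exists>N. \<forall>m\<ge>N. \<forall>n\<ge>N. hdist gspace (u m) (u n) < e"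
  shows "\<exists>g. (\<exists>X. represents X g) \<and> (\<lambda>n. hdist gspace (u n) g) \<longlonglongrightarrow> 0"
proof -
  have "\<exists>x. hdist gspace (u n) (gprod x) < 1 / real (Suc n)" for n
  proof -
    obtain X where "represents X (u n)" using u by blast
    then have "\<forall>\<^sub>F k in sequentially. hdist gspace (u n) (gprod (X k)) < 1 / real (Suc n)"
      by (intro order_tendstoD[OF hdist_gprod_tendsto]) auto
    then show ?thesis by (auto simp: eventually_sequentially)
  qed
  then obtain x where x: "\<And>n. hdist gspace (u n) (gprod (x n)) < 1 / real (Suc n)"
    by metis
  have xlim: "(\<lambda>n. 1 / real (Suc n)) \<longlonglongrightarrow> 0"
    by (rule LIMSEQ_Suc[OF lim_1_over_n])
  have gn: "gnorm (y - y') = hdist gspace (gprod y) (gprod y')" for y y'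
    using LIMSEQ_unique[OF hdist_limit[OF represents_const represents_const] tendsto_const] by auto
  have "gcauchy x"
    unfolding gcauchy_def
  proof (intro allI impI)
    fix e :: real assume "e > 0"
    then have e: "e / 3 > 0" by simp
    then obtain N where N: "\<forall>m\<ge>N. \<forall>n\<ge>N. hdist gspace (u m) (u n) < e / 3"
      using cau by meson
    obtain K where K: "\<And>n. n \<ge> K \<Longrightarrow> 1 / real (Suc n) < e / 3"
      using order_tendstoD(2)[OF xlim e] by (auto simp: eventually_sequentially)
    have "gnorm (x m - x n) < e" if mn: "m \<ge> max N K" "n \<ge> max N K" for m n
    proof -
      obtain X Y where XY: "represents X (u m)" "represents Y (u n)" using u by meson
      have "gnorm (x m - x n) \<le> hdist gspace (gprod (x m)) (u m) + (hdist gspace (u m) (u n) + hdist gspace (u n) (gprod (x n)))"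
        unfolding gn using hdist_gspace_triangle[OF represents_const XY(1) represents_const]
          hdist_gspace_triangle[OF XY represents_const] by (meson add_left_mono order_trans)
      also have "hdist gspace (gprod (x m)) (u m) < e / 3"
        using x[of m] K[of m] mn hdist_gspace_commute[OF XY(1) represents_const, of "x m"] by simp
      also have "hdist gspace (u n) (gprod (x n)) < e / 3"
        using x[of n] K[of n] mn by simp
      also have "hdist gspace (u m) (u n) < e / 3"
        using N mn by simp
      finally show ?thesis by simp
    qed
    then show "\<exists>N. \<forall>m\<ge>N. \<forall>n\<ge>N. gnorm (x m - x n) < e" by blast
  qed
  moreover have "convergent (\<lambda>n. gprod (x n) a)" for a
  proof -
    have "Cauchy (\<lambda>n. gprod (x n) a)"
    proof (rule CauchyI)
      fix e :: real assume "e > 0"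
      then have "e / (gnorm a + 1) > 0" by (simp add: add_nonneg_pos)
      then obtain N where N: "\<And>m n. m \<ge> N \<Longrightarrow> n \<ge> N \<Longrightarrow> gnorm (x m - x n) < e / (gnorm a + 1)"
        using \<open>gcauchy x\<close> unfolding gcauchy_def by meson
      have "cmod (gprod (x m) a - gprod (x n) a) < e" if "m \<ge> N" "n \<ge> N" for m n
      proof -
        have "cmod (gprod (x m - x n) a) \<le> gnorm (x m - x n) * gnorm a"
          by (rule gprod_Cauchy_Schwarz)
        also have "\<dots> \<le> gnorm (x m - x n) * (gnorm a + 1)"
          by (intro mult_left_mono) auto
        also have "\<dots> < e"
          using N[OF that] gnorm_nonneg[of a] by (simp add: pos_less_divide_eq add_nonneg_pos)
        finally show ?thesis by (simp add: gprod_simps)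
      qed
      then show "\<exists>N. \<forall>m\<ge>N. \<forall>n\<ge>N. cmod (gprod (x m) a - gprod (x n) a) < e" by blast
    qed
    then show ?thesis by (simp add: Cauchy_convergent_iff)
  qed
  ultimately have rep: "represents x (\<lambda>a. lim (\<lambda>n. gprod (x n) a))" (is "represents x ?g")
    by (simp add: represents_def convergent_LIMSEQ_iff)
  have "(\<lambda>n. hdist gspace (u n) ?g) \<longlonglongrightarrow> 0"
  proof (rule tendsto_sandwich[OF _ _ tendsto_const])
    show "(\<lambda>n. 1 / real (Suc n) + hdist gspace ?g (gprod (x n))) \<longlonglongrightarrow> 0"
      using tendsto_add[OF xlim hdist_gprod_tendsto[OF rep]] by simp
    have "hdist gspace (u n) ?g \<le> 1 / real (Suc n) + hdist gspace ?g (gprod (x n))" for n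
    proof -
      obtain X where X: "represents X (u n)" using u by blast
      show ?thesis
        using hdist_gspace_triangle[OF X represents_const rep, of "x n"] x[of n]
          hdist_gspace_commute[OF rep represents_const, of "x n"] by linarith
    qed
    then show "\<forall>\<^sub>F n in sequentially. hdist gspace (u n) ?g \<le> 1 / real (Suc n) + hdist gspace ?g (gprod (x n))"
      by simp
    have "0 \<le> hdist gspace (u n) ?g" for n
    proof -
      obtain X where X: "represents X (u n)" using u by blast
      show ?thesis by (rule LIMSEQ_le_const[OF hdist_limit[OF X rep]]) auto
    qed
    then show "\<forall>\<^sub>F n in sequentially. 0 \<le> hdist gspace (u n) ?g" by simp
  qed
  then show ?thesis using rep by blast
qed

text \<open>As \<open>g a\<close> stands for an inner product with the class of a, the operator b
  moves to the argument as its adjoint.\<close>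

definition grep :: "'a \<Rightarrow> ('a \<Rightarrow> complex) \<Rightarrow> 'a \<Rightarrow> complex" where
  "grep b g = (\<lambda>a. g (adj b * a))"

sublocale complex_hilbert_space gspace
proof
  show "hzero gspace \<in> hcarrier gspace"
    using represents_scale[OF represents_const, of 0 0] by auto
  fix x y z :: "'a \<Rightarrow> complex"
  assume x: "x \<in> hcarrier gspace"
  show "hscale gspace c x \<in> hcarrier gspace" for c
    using x represents_scale by auto
  show "hinner gspace x x = 0 \<Longrightarrow> x = hzero gspace"
  proof -
    assume 0: "hinner gspace x x = 0"
    obtain X where X: "represents X x" using x by auto
    have "(\<lambda>n. Re (gprod (X n) (X n))) \<longlonglongrightarrow> 0"
      using tendsto_Re[OF ginner_gprod_limit[OF X X]] 0 by simp
    then have "(\<lambda>n. sqrt (Re (gprod (X n) (X n)))) \<longlonglongrightarrow> sqrt 0"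
      by (rule tendsto_real_sqrt)
    then have lim: "(\<lambda>n. gnorm (X n)) \<longlonglongrightarrow> 0"
      by (simp add: gnorm_def)
    have "x a = 0" for a
    proof -
      have "(\<lambda>n. gnorm (X n) * gnorm a) \<longlonglongrightarrow> 0 * gnorm a"
        by (intro tendsto_mult_right lim)
      then have "(\<lambda>n. gnorm (X n) * gnorm a) \<longlonglongrightarrow> 0" by simp
      then have "(\<lambda>n. gprod (X n) a) \<longlonglongrightarrow> 0"
        by (rule Lim_null_comparison[OF always_eventually[OF allI[OF gprod_Cauchy_Schwarz]]])
      then show ?thesis
        using LIMSEQ_unique represents_limit[OF X] by blast
    qed
    then show ?thesis by auto
  qed
  show "0 \<le> Re (hinner gspace x x)"
  proof -
    obtain X where X: "represents X x" using x by auto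
    show ?thesis
      using LIMSEQ_le_const[OF tendsto_Re[OF ginner_gprod_limit[OF X X]], of 0] gprod_nonneg by auto
  qed
  assume y: "y \<in> hcarrier gspace"
  show "hadd gspace x y \<in> hcarrier gspace"
    using x y represents_add unfolding gspace_simps by blast
  obtain X Y where X: "represents X x" and Y: "represents Y y"
    using x y by auto
  show "hinner gspace (hscale gspace c x) y = c * hinner gspace x y" for c
    using LIMSEQ_unique[OF ginner_limit[OF represents_scale[OF X] Y] tendsto_mult_left[OF ginner_limit[OF X Y]]]
    by simp
  show "hinner gspace x y = cnj (hinner gspace y x)"
    using LIMSEQ_unique[OF ginner_gprod_limit[OF X Y] tendsto_cnj[OF ginner_gprod_limit[OF Y X], folded gprod_commute]]
    by simp
  assume "z \<in> hcarrier gspace"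
  then obtain Z where Z: "represents Z z" by auto
  show "hinner gspace (hadd gspace x y) z = hinner gspace x z + hinner gspace y z"
    using LIMSEQ_unique[OF ginner_limit[OF represents_add[OF X Y] Z] tendsto_add[OF ginner_limit[OF X Z] ginner_limit[OF Y Z]]]
    by simp
next
  fix u :: "nat \<Rightarrow> 'a \<Rightarrow> complex"
  assume "\<forall>n. u n \<in> hcarrier gspace" "\<forall>e>0. \<exists>N. \<forall>m\<ge>N. \<forall>n\<ge>N. hdist gspace (u m) (u n) < e"
  then show "\<exists>x\<in>hcarrier gspace. (\<lambda>n. hdist gspace (u n) x) \<longlonglongrightarrow> 0"
    using gspace_complete[of u] unfolding Bex_def gspace_simps by blast
qed (auto simp: algebra_simps)

lemma ginner_grep:
  assumes "represents X g" "represents Y h"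
  shows "ginner (grep (adj b) g) h = ginner g (grep b h)"
  using LIMSEQ_unique[OF ginner_limit[OF represents_mult[OF assms(1), of "adj b"] assms(2)]]
    ginner_limit[OF assms(1) represents_mult[OF assms(2), of b]]
  by (simp add: grep_def adj_adj)

lemma gnorm_grep_le:
  assumes "represents X g"
  shows "hnorm gspace (grep b g) \<le> norm b * hnorm gspace g"
proof (rule LIMSEQ_le)
  have lim: "(\<lambda>n. gnorm (X n)) \<longlonglongrightarrow> hnorm gspace g" if "represents X g" for X g
    unfolding gnorm_def hnorm_def gspace_simps by (intro tendsto_real_sqrt tendsto_Re ginner_gprod_limit that)
  show "(\<lambda>n. gnorm (b * X n)) \<longlonglongrightarrow> hnorm gspace (grep b g)"
    using lim[OF represents_mult[OF assms, of b]] by (simp add: grep_def)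
  show "(\<lambda>n. norm b * gnorm (X n)) \<longlonglongrightarrow> norm b * hnorm gspace g"
    by (rule tendsto_mult_left[OF lim[OF assms]])
qed (use gnorm_mult_le in blast)

sublocale star_representation gspace grep
proof
  fix a b :: 'a and c :: complex and x y :: "'a \<Rightarrow> complex"
  assume x: "x \<in> hcarrier gspace"
  then obtain X where X: "represents X x" by auto
  show "grep a x \<in> hcarrier gspace"
    using represents_mult[OF X] by (auto simp: grep_def)
  show "grep a (hscale gspace c x) = hscale gspace c (grep a x)"
    by (simp add: grep_def)
  show "grep (a + b) x = hadd gspace (grep a x) (grep b x)"
    by (simp add: grep_def adj_add distrib_right represented_antilinear[OF X])
  show "grep (c *\<^sub>C a) x = hscale gspace c (grep a x)"
    by (simp add: grep_def adj_scaleC mult_scaleC_left represented_antilinear[OF X])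
  show "grep (a * b) x = grep a (grep b x)"
    by (simp add: grep_def adj_mult mult.assoc)
  assume "y \<in> hcarrier gspace"
  then obtain Y where Y: "represents Y y" by auto
  show "hinner gspace (grep (adj a) x) y = hinner gspace x (grep a y)"
    using ginner_grep[OF X Y] by simp
next
  fix a :: 'a
  show "\<exists>K. \<forall>x\<in>hcarrier gspace. hnorm gspace (grep a x) \<le> K * hnorm gspace x"
    by (rule exI[of _ "norm a"]) (use gnorm_grep_le in auto)
qed (simp add: grep_def)

end

section \<open>Primitive ideals above a proper closed ideal\<close>

text \<open>The element norm(b)^2 - \<open>adj b * b\<close> is positive, hence a square h^2, and
  positivity is used at h x. The root needs the unit, so A obtains the bound through
  \<open>embed\<close>.\<close>

lemma positive_functional_mult_bound:
  fixes x b :: "'u::{cstar_algebra,real_normed_algebra_1}"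
  assumes "positive_functional J \<phi>"
  shows "Re (\<phi> (adj (b * x) * (b * x))) \<le> (norm b)\<^sup>2 * Re (\<phi> (adj x * x))"
proof -
  have "pos ((norm b)\<^sup>2 *\<^sub>R 1 - adj b * b)"
    by (rule pos_diff_of_norm_le) (simp_all add: adj_mult adj_adj cstar_identity)
  then obtain h where h: "adj h = h" "(norm b)\<^sup>2 *\<^sub>R 1 - adj b * b = h * h"
    by (auto simp: pos_def)
  have "adj (h * x) * (h * x) = adj x * ((norm b)\<^sup>2 *\<^sub>R 1 - adj b * b) * x"
    unfolding h(2) by (simp add: adj_mult h(1) mult.assoc)
  also have "\<dots> = (norm b)\<^sup>2 *\<^sub>R (adj x * x) - adj (b * x) * (b * x)"
    by (simp add: adj_mult algebra_simps)
  finally show ?thesis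
    using positive_functionalD(4)[OF assms, of "h * x"] by (simp add: positive_functionalD[OF assms])
qed

lemma gns_unital:
  fixes \<phi> :: "'u::{cstar_algebra,real_normed_algebra_1} \<Rightarrow> complex"
  assumes "positive_functional J \<phi>" shows "gns \<phi>"
proof
  show "positive_functional {} \<phi>"
    using assms by (simp add: positive_functional_def)
qed (rule positive_functional_mult_bound[OF assms])

lemma gns_embed:
  assumes "positive_functional J \<phi>" shows "gns (\<lambda>a. \<phi> (embed a))"
proof
  show "positive_functional {} (\<lambda>a. \<phi> (embed a))"
    unfolding positive_functional_def
    by (simp add: embed_add embed_scaleC embed_adj embed_mult positive_functionalD[OF assms])
  show "Re (\<phi> (embed (adj (b * x) * (b * x)))) \<le> (norm b)\<^sup>2 * Re (\<phi> (embed (adj x * x)))" for b x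
    using positive_functional_mult_bound[OF assms, of "embed b" "embed x"] by (simp add: embed_mult embed_adj)
qed

lemma closed_ideal_embed:
  assumes "closed_ideal UNIV J" shows "closed_ideal UNIV (embed ` J)"
  unfolding closed_ideal_def
proof (intro conjI ballI)
  note J = closed_ideal_mem[OF assms]
  have "subspace J"
    using J by (auto simp: subspace_def)
  then have "complete (embed ` J)"
    using J(9) complete_eq_closed
    by (intro complete_isometric_image[of 1] bounded_linear_embed) auto
  then show "closed (embed ` J)"
    using complete_eq_closed by blast
  show "csubspace (embed ` J)"
  proof (rule complex_vector.subspaceI)
    show "0 \<in> embed ` J"
      using J(1) embed_0 by (metis image_eqI)
    show "x + y \<in> embed ` J" if "x \<in> embed ` J" "y \<in> embed ` J" for x y
      using that J(2) by (auto simp flip: embed_add)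
    show "c *\<^sub>C x \<in> embed ` J" if "x \<in> embed ` J" for c x
      using that J(6) by (auto simp flip: embed_scaleC)
  qed
  fix u j assume "j \<in> embed ` J"
  then obtain a where a: "a \<in> J" "j = embed a" by blast
  have "unit_act u a \<in> J"
    unfolding unit_act_def by (intro J(2) J(7) J(6) a UNIV_I)
  then show "u * j \<in> embed ` J"
    by (simp add: a mult_embed)
  have "a * vec_part u + scal_part u *\<^sub>C a \<in> J"
    by (intro J(2) J(8) J(6) a UNIV_I)
  then show "j * u \<in> embed ` J"
    by (simp add: a embed_mult_right)
qed auto

lemma closed_ideal_adj':
  assumes "closed_ideal UNIV J" "x \<in> J" shows "adj x \<in> J"
proof -
  have "adj (embed x) \<in> embed ` J"
    using assms by (intro closed_ideal_adj closed_ideal_embed) auto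
  then obtain y where "y \<in> J" "embed (adj x) = embed y"
    by (auto simp: embed_adj)
  then show ?thesis
    using injD[OF inj_embed, of "adj x" y] by simp
qed

text \<open>The usual cyclic vector, the class of 1, comes from the unitization. The condition on e
  says that 1 - e has seminorm 0, so the class of e can take its place.\<close>

locale pure_gns =
  fixes J :: "'a::cstar_algebra set" and \<phi> :: "'a unitization \<Rightarrow> complex" and e :: 'a
  assumes J: "closed_ideal UNIV J"
    and state: "positive_functional (embed ` J) \<phi>" "\<phi> 1 = 1"
    and e: "adj e = e" "\<phi> ((1 - embed e) * (1 - embed e)) = 0"
    and pure: "\<And>\<psi> \<psi>' x. positive_functional (embed ` J) \<psi> \<Longrightarrow> positive_functional (embed ` J) \<psi>' \<Longrightarrow>
       (\<And>x. \<phi> x = \<psi> x + \<psi>' x) \<Longrightarrow> Re (\<psi> 1) > 0 \<Longrightarrow> Re (\<psi>' 1) > 0 \<Longrightarrow> \<psi> x = complex_of_real (Re (\<psi> 1)) * \<phi> x"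
begin

sublocale gns "\<lambda>a. \<phi> (embed a)"
  by (rule gns_embed[OF state(1)])

text \<open>Cauchy-Schwarz for the state on the unitization, where 1 - e is a null vector.\<close>

lemma state_mult_e: "\<phi> (y * embed e) = \<phi> y"
proof -
  interpret U: gns \<phi>
    by (rule gns_unital[OF state(1)])
  let ?d = "1 - embed e"
  have "adj ?d = ?d" by (simp add: adj_diff e flip: embed_adj)
  then have "U.gnorm ?d = 0"
    using e(2) by (simp add: U.gnorm_def U.gprod_def)
  then have "U.gprod ?d (adj y) = 0"
    using U.gprod_Cauchy_Schwarz[of ?d "adj y"] by simp
  then show ?thesis
    by (simp add: U.gprod_def adj_adj algebra_simps U.\<Phi>_simps)
qed

lemma state_e_mult: "\<phi> (embed e * y) = \<phi> y"
  using state_mult_e[of "adj y"] positive_functionalD(3)[OF state(1), of "embed e * y"]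
    positive_functionalD(3)[OF state(1), of y]
  by (simp add: adj_mult e flip: embed_adj)

lemma grep_gprod: "grep b (gprod x) = gprod (b * x)"
  by (simp add: fun_eq_iff grep_def gprod_def adj_mult adj_adj mult.assoc)

lemma grep_cyclic: "grep x (gprod e) = gprod x"
  unfolding grep_gprod by (simp add: fun_eq_iff gprod_def embed_mult state_mult_e flip: mult.assoc)

lemma gprod_cyclic: "gprod x e = \<phi> (embed x)"
  by (simp add: gprod_def e embed_mult state_e_mult)

lemma gprod_e_e: "gprod e e = 1"
  using state_e_mult[of 1] state(2) by (simp add: gprod_cyclic)

lemma vanishes_on_ideal:
  assumes "represents X g" "k \<in> J" shows "g k = 0"
proof -
  have "gprod (X n) k = 0" for n
    using assms(2) closed_ideal_adj'[OF J] closed_ideal_mem(8)[OF J] positive_functionalD(5)[OF state(1)]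
    by (simp add: gprod_def)
  then show ?thesis
    using represents_limit[OF assms(1), of k] by (simp add: LIMSEQ_const_iff)
qed

lemma grep_ideal:
  assumes "represents X g" "j \<in> J" shows "grep j g = (\<lambda>a. 0)"
  using assms closed_ideal_adj'[OF J] closed_ideal_mem(8)[OF J] by (auto simp: grep_def vanishes_on_ideal[OF assms(1)])

text \<open>The functional u -> <u w, w>, with the representation extended to the unitization so
  that 1 acts as the identity; purity is a statement about functionals there.\<close>

definition vector_functional :: "('a \<Rightarrow> complex) \<Rightarrow> 'a unitization \<Rightarrow> complex" where
  "vector_functional w u = ginner (grep (vec_part u) w) w + scal_part u * ginner w w"

lemma positive_vector_functional:
  assumes w: "w \<in> hcarrier gspace"
  shows "positive_functional (embed ` J) (vector_functional w)"
proof -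
  obtain X where X: "represents X w" using w by auto
  have cl: "grep a w \<in> hcarrier gspace" for a
    using rep_closed[OF w] .
  have add: "ginner (grep (a + b) w) y = ginner (grep a w) y + ginner (grep b w) y"
    if "y \<in> hcarrier gspace" for a b y
    using inner_add[OF cl cl that, of a b] rep_add[OF w, of a b] by simp
  have scale: "ginner (grep (c *\<^sub>C a) w) y = c * ginner (grep a w) y" if "y \<in> hcarrier gspace" for a c y
    using inner_scale[OF cl that, of c a] rep_scale[OF w, of c a] by simp
  have adj: "ginner (grep (adj a) x) y = ginner x (grep a y)"
    if "x \<in> hcarrier gspace" "y \<in> hcarrier gspace" for a x y
    using rep_adj[OF that] by simp
  have comm: "ginner x y = cnj (ginner y x)" if "x \<in> hcarrier gspace" "y \<in> hcarrier gspace" for x y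
    using inner_commute[OF that] by simp
  have ww: "cnj (ginner w w) = ginner w w"
    using comm[OF w w] by simp
  show ?thesis
    unfolding positive_functional_def
  proof (intro conjI allI ballI)
    fix u v :: "'a unitization" and c
    show "vector_functional w (u + v) = vector_functional w u + vector_functional w v"
      by (simp add: vector_functional_def plus_unitization_def add[OF w] algebra_simps)
    show "vector_functional w (c *\<^sub>C u) = c * vector_functional w u"
      by (simp add: vector_functional_def scaleC_unitization_def scale[OF w] algebra_simps)
    show "vector_functional w (adj u) = cnj (vector_functional w u)"
      using adj[OF w w, of "vec_part u"] comm[OF w cl, of "vec_part u"] ww
      by (simp add: vector_functional_def adj_unitization_def)
    show "0 \<le> Re (vector_functional w (adj u * u))"
    proof -
      let ?a = "vec_part u" and ?l = "scal_part u"
      let ?y = "hadd gspace (grep ?a w) (hscale gspace ?l w)"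
      have y: "?y \<in> hcarrier gspace"
        by (rule add_closed[OF cl scale_closed[OF w]])
      have aa: "ginner (grep (adj ?a * ?a) w) w = ginner (grep ?a w) (grep ?a w)"
        using rep_mult[OF w, of "adj ?a" ?a] adj[OF cl w, of ?a ?a] by simp
      have "hinner gspace ?y ?y = hinner gspace (grep ?a w) (grep ?a w) + cnj ?l * hinner gspace (grep ?a w) w
          + ?l * hinner gspace w (grep ?a w) + ?l * cnj ?l * hinner gspace w w"
        by (simp add: hilbert_simps cl w algebra_simps del: gspace_simps)
      also have "\<dots> = vector_functional w (adj u * u)"
        using adj[OF w w, of ?a]
        by (simp add: vector_functional_def adj_unitization_def times_unitization_def add[OF w] scale[OF w] aa algebra_simps)
      finally show ?thesis
        using inner_ge_zero[OF y] by simp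
    qed
    fix j assume "j \<in> embed ` J"
    then obtain k where k: "k \<in> J" "j = embed k" by blast
    have "ginner (\<lambda>a. 0) w = 0"
      using inner_scale[OF zero_closed w, of 0] by simp
    then show "vector_functional w j = 0"
      using grep_ideal[OF X k(1)] by (simp add: vector_functional_def k(2))
  qed
qed

lemma dense_cyclic:
  assumes W: "closed_hsubspace gspace W" and "\<And>x. gprod x \<in> W" shows "W = hcarrier gspace"
proof
  show "W \<subseteq> hcarrier gspace"
    using W by (simp add: closed_hsubspace_def)
  show "hcarrier gspace \<subseteq> W"
  proof
    fix g assume g: "g \<in> hcarrier gspace"
    then obtain X where X: "represents X g" by auto
    define Y where "Y n = gprod (X n)" for n
    have "(\<lambda>n. hdist gspace (Y n) g) \<longlonglongrightarrow> 0"
      using hdist_gprod_tendsto[OF X] by (simp add: hdist_gspace_commute[OF X represents_const] Y_def)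
    moreover have "\<forall>n. Y n \<in> W"
      by (simp add: Y_def assms(2))
    ultimately show "g \<in> W"
      using W g unfolding closed_hsubspace_def by blast
  qed
qed

text \<open>Split the cyclic vector v into w in W and w' orthogonal to W. Then the state is the sum
  of the vector functionals of w and w'. If neither vanishes, purity makes that of w equal to t
  times the state, which yields x w = t x v for all x in A; so W contains all x v, and these are
  dense.\<close>

sublocale irreducible_representation gspace grep
proof
  have "grep e (gprod e) \<noteq> hzero gspace"
    using gprod_e_e by (auto simp: grep_cyclic dest: fun_cong[of _ _ e])
  then show "\<exists>a. \<exists>x\<in>hcarrier gspace. grep a x \<noteq> hzero gspace"
    using gprod_in_gspace by blast
  fix W assume W: "closed_hsubspace gspace W" and inv: "\<forall>a. \<forall>x\<in>W. grep a x \<in> W"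
  have WH: "x \<in> hcarrier gspace" if "x \<in> W" for x
    using W that by (auto simp: closed_hsubspace_def)
  let ?v = "gprod e"
  have v: "?v \<in> hcarrier gspace" by (rule gprod_in_gspace)
  obtain w where wW: "w \<in> W" and orth: "\<And>u. u \<in> W \<Longrightarrow> hinner gspace (hminus ?v w) u = 0"
    using orthogonal_decomposition[OF W v] by blast
  define w' where "w' = hminus ?v w"
  have w: "w \<in> hcarrier gspace" using wW WH by blast
  have w': "w' \<in> hcarrier gspace"
    unfolding w'_def by (intro add_closed scale_closed v w)
  have vw: "?v = hadd gspace w w'"
    by (simp add: w'_def fun_eq_iff)
  have o1: "ginner w' u = 0" if "u \<in> W" for u
    using orth[OF that] by (simp add: w'_def)
  have o2: "ginner u w' = 0" if "u \<in> W" for u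
    using o1[OF that] inner_commute[OF WH[OF that] w'] by simp
  have gv: "g y = ginner (grep (adj y) g) ?v" if g: "g \<in> hcarrier gspace" for g y
  proof -
    obtain X where "represents X g" using g by auto
    then have "g y = ginner g (grep y ?v)"
      by (simp add: grep_cyclic ginner_gprod)
    then show ?thesis
      using rep_adj[OF g v, of y] by simp
  qed
  have gw: "ginner u ?v = ginner u w" if "u \<in> W" for u
    using inner_add_right[OF w w' WH[OF that]] o2[OF that] vw by simp
  have decomp: "\<phi> u = vector_functional w u + vector_functional w' u" for u
  proof -
    \<comment> \<open>W is invariant and A is closed under \<open>adj\<close>, so the orthogonal
      complement of W is invariant too.\<close>
    have cross: "ginner (grep a w) w' = 0" "ginner (grep a w') w = 0" for a
      using o2[of "grep a w"] inv wW o1[of "grep (adj a) w"] rep_adj[OF w' w, of "adj a"] by (auto simp: adj_adj)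
    have "ginner (grep a ?v) ?v = ginner (grep a w) w + ginner (grep a w') w'" for a
      using inner_add_right[OF w w' rep_closed[OF v], of a] rep_vec_add[OF w w', of a] vw
        inner_add[OF rep_closed[OF w] rep_closed[OF w'] w, of a a]
        inner_add[OF rep_closed[OF w] rep_closed[OF w'] w', of a a] cross by simp
    then have 1: "\<phi> (embed a) = ginner (grep a w) w + ginner (grep a w') w'" for a
      using ginner_gprod[OF represents_const, of a e] by (simp add: grep_cyclic gprod_cyclic)
    have "ginner ?v ?v = ginner w w + ginner w' w'"
      using inner_add_right[OF w w' v] inner_add[OF w w' w] inner_add[OF w w' w'] vw o1[OF wW] o2[OF wW] by simp
    then have 2: "1 = ginner w w + ginner w' w'"
      using ginner_gprod[OF represents_const, of e e] by (simp add: gprod_e_e)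
    have "\<phi> u = \<phi> (embed (vec_part u)) + scal_part u * 1"
      using unitization_decomp[of u] positive_functionalD(1,2)[OF state(1)] state(2) by metis
    also have "\<dots> = (ginner (grep (vec_part u) w) w + ginner (grep (vec_part u) w') w')
        + scal_part u * (ginner w w + ginner w' w')"
      by (simp only: 1[of "vec_part u"] 2[symmetric])
    finally show ?thesis
      by (simp add: vector_functional_def algebra_simps)
  qed
  have vec1: "vector_functional x 1 = ginner x x" if x: "x \<in> hcarrier gspace" for x
  proof -
    obtain X where X: "represents X x" using x by auto
    have "grep 0 x = (\<lambda>a. 0)"
      using grep_ideal[OF X closed_ideal_mem(1)[OF J]] .
    moreover have "ginner (\<lambda>a. 0) x = 0"
      using inner_scale[OF zero_closed x, of 0] by simp
    ultimately show ?thesis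
      by (simp add: vector_functional_def one_unitization_def)
  qed
  have zero: "x = hzero gspace" if "x \<in> hcarrier gspace" "Re (ginner x x) \<le> 0" for x
  proof -
    have "hnorm gspace x = 0"
      using that inner_ge_zero[OF that(1)] by (simp add: hnorm_def)
    then show ?thesis using hnorm_eq_zero[OF that(1)] by blast
  qed
  show "W = {hzero gspace} \<or> W = hcarrier gspace"
  proof (cases "Re (ginner w w) \<le> 0")
    \<comment> \<open>If w = 0, then v is orthogonal to W, and the value of a vector at y is its
      inner product with y v.\<close>
    case True
    then have "w = hzero gspace" by (rule zero[OF w])
    then have 0: "ginner u w = 0" if "u \<in> W" for u
      using inner_scale_right[OF zero_closed WH[OF that], of 0] by simp
    have "u = hzero gspace" if "u \<in> W" for u
      using gv[OF WH[OF that]] gw 0 inv that by (auto simp: fun_eq_iff)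
    then show ?thesis
      using W by (auto simp: closed_hsubspace_def)
  next
    case False
    have "gprod x \<in> W" for x
    \<comment> \<open>Purity is only available when both summands are positive at 1; if w' = 0, then
      v itself lies in W.\<close>
    proof (cases "Re (ginner w' w') \<le> 0")
      case True
      then have "w' = hzero gspace" by (rule zero[OF w'])
      then have "?v = w" using vw by simp
      then show ?thesis
        using inv wW grep_cyclic[of x] by metis
    next
      case F: False
      define t where "t = complex_of_real (Re (ginner w w))"
      have "t \<noteq> 0" using False by (simp add: t_def)
      have vf: "vector_functional w u = t * \<phi> u" for u
        using pure[OF positive_vector_functional[OF w] positive_vector_functional[OF w'] decomp, of u] False F
        unfolding vec1[OF w] vec1[OF w'] t_def by simp
      have "grep x w y = t * gprod x y" for y
      proof -
        have "grep x w y = ginner (grep (adj y) (grep x w)) w"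
          using gv[OF rep_closed[OF w], of x y] gw[of "grep (adj y) (grep x w)"] inv wW by metis
        also have "\<dots> = vector_functional w (embed (adj y * x))"
          using rep_mult[OF w, of "adj y" x] by (simp add: vector_functional_def)
        finally show ?thesis by (simp add: vf gprod_def)
      qed
      then have "gprod x = hscale gspace (1 / t) (grep x w)"
        using \<open>t \<noteq> 0\<close> by (auto simp: fun_eq_iff)
      moreover have "hscale gspace (1 / t) (grep x w) \<in> W"
        using W inv wW unfolding closed_hsubspace_def by blast
      ultimately show ?thesis by metis
    qed
    then show ?thesis using dense_cyclic[OF W] by blast
  qed
qed

lemma kernel_contains_ideal: "J \<subseteq> rep_kernel gspace grep"
  using grep_ideal by (auto simp: rep_kernel_def)

lemma kernel_primitive: "rep_kernel gspace grep \<in> primitive_ideals"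
  unfolding primitive_ideals_def using irreducible_representation_axioms by blast

end

theorem proper_closed_ideal_le_primitive:
  fixes J :: "'a::cstar_algebra set"
  assumes J: "closed_ideal UNIV J" and "J \<noteq> UNIV"
  shows "\<exists>P\<in>primitive_ideals. J \<subseteq> P"
proof -
  obtain x where "x \<notin> J" using assms(2) by blast
  obtain h k where hk: "adj h = h" "adj k = k" "x = h + \<i> *\<^sub>C k"
    by (rule cartesian_decomposition)
  then have "h \<notin> J \<or> k \<notin> J"
    using \<open>x \<notin> J\<close> closed_ideal_mem(2)[OF J, of h "\<i> *\<^sub>C k"] closed_ideal_mem(6)[OF J, of k \<i>] by blast
  then obtain z where z: "adj z = z" "z \<notin> J"
    using hk by blast
  have z': "adj (embed z) = embed z" "embed z \<notin> embed ` J"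
    using z by (auto dest: injD[OF inj_embed] simp flip: embed_adj)
  obtain \<phi> :: "'a unitization \<Rightarrow> complex" and m :: real where \<phi>: "positive_functional (embed ` J) \<phi>" "\<phi> 1 = 1"
    "\<phi> ((1 - (1/m) *\<^sub>R (embed z * embed z)) * (1 - (1/m) *\<^sub>R (embed z * embed z))) = 0"
    "\<And>\<psi> \<psi>' x. positive_functional (embed ` J) \<psi> \<Longrightarrow> positive_functional (embed ` J) \<psi>' \<Longrightarrow> (\<And>x. \<phi> x = \<psi> x + \<psi>' x) \<Longrightarrow>
       Re (\<psi> 1) > 0 \<Longrightarrow> Re (\<psi>' 1) > 0 \<Longrightarrow> \<psi> x = complex_of_real (Re (\<psi> 1)) * \<phi> x"
    by (rule pure_state_exists[OF closed_ideal_embed[OF J] z']) blast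
  interpret pure_gns J \<phi> "(1/m) *\<^sub>R (z * z)"
    by unfold_locales (use J \<phi> z in \<open>auto simp: adj_mult embed_scaleR embed_mult\<close>)
  show ?thesis
    using kernel_primitive kernel_contains_ideal by blast
qed

section \<open>Primitive ideals are closed\<close>

context star_representation
begin

lemma rep_diff:
  assumes "x \<in> hcarrier H" shows "\<pi> (a - b) x = hminus (\<pi> a x) (\<pi> b x)"
  using rep_add[OF assms, of a "(-1) *\<^sub>C b"] rep_scale[OF assms, of "-1" b] scaleC_of_real[of "-1" b] by simp

text \<open>Put \<open>y = adj b * b\<close> and \<open>r = rt y\<close>. Formally 1 - y = (1 -
  r)^2, and although 1 is absent from A, the squared norm of x - r x is <x,x> - <y x,x>, where <y
  x,x> is the squared norm of b x. The constant in \<open>rep_bounded\<close> may depend on the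
  element, so it gives no continuity in the element, which closedness of the kernel needs.\<close>

lemma rep_contractive:
  assumes x: "x \<in> hcarrier H" shows "hnorm H (\<pi> a x) \<le> norm a * hnorm H x"
proof -
  have *: "hnorm H (\<pi> b x) \<le> hnorm H x" if b: "norm b \<le> 1" for b
  proof -
    define y where "y = adj b * b"
    define r where "r = rt y"
    have y: "norm y \<le> 1" "adj y = y"
      using b by (simp_all add: y_def cstar_identity power_le_one adj_mult adj_adj)
    have r: "2 *\<^sub>R r - r * r = y" "adj r = r"
      using rt_equation[OF y(1)] selfadj_rt[OF y] by (simp_all add: r_def)
    have y_eq: "y = 2 *\<^sub>C r - r * r"
      using r(1) scaleC_of_real[of 2 r] by simp
    have rr: "hinner H (\<pi> (r * r) x) x = hinner H (\<pi> r x) (\<pi> r x)"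
      using rep_mult[OF x] rep_adj[OF rep_closed[OF x] x, of r r] r(2) by simp
    have "hinner H (\<pi> y x) x = 2 * hinner H (\<pi> r x) x - hinner H (\<pi> r x) (\<pi> r x)"
      unfolding y_eq rep_diff[OF x] rr[symmetric] rep_scale[OF x]
      using x by (simp add: hilbert_simps rep_closed)
    moreover have "hinner H x (\<pi> r x) = hinner H (\<pi> r x) x"
      using rep_adj[OF x x, of r] r(2) by simp
    ultimately have "hinner H (hminus x (\<pi> r x)) (hminus x (\<pi> r x)) = hinner H x x - hinner H (\<pi> y x) x"
      using x by (simp add: hilbert_simps rep_closed)
    moreover have "hinner H (\<pi> y x) x = hinner H (\<pi> b x) (\<pi> b x)"
      unfolding y_def using rep_mult[OF x] rep_adj[OF rep_closed[OF x] x, of b b] by simp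
    moreover have "0 \<le> Re (hinner H (hminus x (\<pi> r x)) (hminus x (\<pi> r x)))"
      by (intro inner_ge_zero add_closed scale_closed rep_closed x)
    ultimately show ?thesis
      by (simp add: hnorm_def)
  qed
  show ?thesis
  proof (cases "a = 0")
    case True
    have "\<pi> a x = hscale H 0 (\<pi> a x)"
      using rep_scale[OF x, of 0 a] True by simp
    then have "hinner H (\<pi> a x) (\<pi> a x) = 0"
      using inner_scale[OF rep_closed[OF x] rep_closed[OF x], of 0 a a] by simp
    then show ?thesis using True by (simp add: hnorm_def)
  next
    case False
    define b where "b = (1 / norm a) *\<^sub>R a"
    have "norm b \<le> 1" using False by (simp add: b_def)
    have "a = complex_of_real (norm a) *\<^sub>C b"
      using False by (simp add: b_def scaleC_of_real)
    then have "\<pi> a x = hscale H (complex_of_real (norm a)) (\<pi> b x)"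
      using rep_scale[OF x, of "complex_of_real (norm a)" b] by simp
    then have "hinner H (\<pi> a x) (\<pi> a x) = complex_of_real ((norm a)\<^sup>2) * hinner H (\<pi> b x) (\<pi> b x)"
      using x by (simp add: hilbert_simps rep_closed power2_eq_square)
    then have "hnorm H (\<pi> a x) = norm a * hnorm H (\<pi> b x)"
      by (simp add: hnorm_def real_sqrt_mult)
    then show ?thesis
      using *[OF \<open>norm b \<le> 1\<close>] by (simp add: mult_left_mono)
  qed
qed

lemma closed_rep_kernel: "closed (rep_kernel H \<pi>)"
proof -
  have "a \<in> rep_kernel H \<pi>" if u: "\<And>n. u n \<in> rep_kernel H \<pi>" and lim: "u \<longlonglongrightarrow> a" for u :: "nat \<Rightarrow> 'a" and a
  proof -
    have "\<pi> a x = hzero H" if x: "x \<in> hcarrier H" for x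
    proof -
      have le: "hnorm H (\<pi> a x) \<le> norm (a - u n) * hnorm H x" for n
      proof -
        have "\<pi> (a - u n) x = hminus (\<pi> a x) (hzero H)"
          using u[of n] x by (simp add: rep_diff rep_kernel_def)
        also have "\<dots> = \<pi> a x"
          using scale_zero add_zero[OF rep_closed[OF x]] by simp
        finally show ?thesis
          using rep_contractive[OF x, of "a - u n"] by simp
      qed
      have "(\<lambda>n. norm (a - u n) * hnorm H x) \<longlonglongrightarrow> norm (a - a) * hnorm H x"
        by (intro tendsto_intros lim)
      then have "hnorm H (\<pi> a x) \<le> norm (a - a) * hnorm H x"
        by (rule LIMSEQ_le_const) (use le in blast)
      then have "hnorm H (\<pi> a x) = 0"
        using hnorm_nonneg[OF rep_closed[OF x], of a] by simp
      then show ?thesis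
        by (rule hnorm_eq_zero[OF rep_closed[OF x]])
    qed
    then show ?thesis by (simp add: rep_kernel_def)
  qed
  then show ?thesis
    unfolding closed_sequential_limits by blast
qed

end

lemma primitive_closed_ideal:
  assumes "P \<in> primitive_ideals" shows "closed_ideal UNIV P" "P \<noteq> UNIV"
proof -
  obtain H :: "('a \<Rightarrow> complex) hilbert_data" and \<pi> where "irreducible_representation H \<pi>" and P: "P = rep_kernel H \<pi>"
    using assms by (auto simp: primitive_ideals_def)
  then interpret irreducible_representation H \<pi> by simp
  have z: "hadd H (hzero H) (hzero H) = hzero H"
    using add_zero zero_closed by blast
  have "csubspace P"
  proof (rule complex_vector.subspaceI)
    show "0 \<in> P"
    proof -
      have "\<pi> 0 x = hzero H" if "x \<in> hcarrier H" for x
        using rep_diff[OF that, of 0 0] add_inverse[OF rep_closed[OF that]] by simp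
      then show ?thesis by (simp add: P rep_kernel_def)
    qed
  qed (auto simp: P rep_kernel_def rep_add rep_scale z scale_zero)
  then show "closed_ideal UNIV P"
    using closed_rep_kernel kernel_ideal by (auto simp: closed_ideal_def P)
  show "P \<noteq> UNIV"
    using kernel_proper P by simp
qed

section \<open>Local units\<close>

text \<open>Modulo \<open>J\<close>, the element \<open>c\<close> equals \<open>c * (e - b) ^ n\<close>, which tends to 0.\<close>

lemma mem_ideal_of_local_unit:
  fixes c e :: "'a::cstar_algebra"
  assumes J: "closed_ideal UNIV J" and ce: "c * e = c" and b: "b \<in> J" "norm (e - b) < 1"
  shows "c \<in> J"
proof -
  define z where "z n = ((\<lambda>x. x * (e - b)) ^^ n) c" for n
  have mem: "c - z n \<in> J" for n
  proof (induction n)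
    case 0
    show ?case using closed_ideal_mem(1)[OF J] by (simp add: z_def)
  next
    case (Suc n)
    have "c - z (Suc n) = c * b + (c - z n) * (e - b)"
      using ce by (simp add: z_def algebra_simps)
    then show ?case
      using Suc closed_ideal_mem(2,7,8)[OF J] b(1) by simp
  qed
  have lim: "(\<lambda>n. c - z n) \<longlonglongrightarrow> c"
  proof -
    have "norm (z n) \<le> norm c * norm (e - b) ^ n" for n
    proof (induction n)
      case (Suc n)
      have "norm (z (Suc n)) \<le> norm (z n) * norm (e - b)"
        by (simp add: z_def norm_mult_ineq)
      also have "\<dots> \<le> norm c * norm (e - b) ^ n * norm (e - b)"
        by (intro mult_right_mono Suc) auto
      finally show ?case by (simp add: mult_ac)
    qed (simp add: z_def)
    moreover have "(\<lambda>n. norm c * norm (e - b) ^ n) \<longlonglongrightarrow> 0"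
      using tendsto_mult_left[OF LIMSEQ_realpow_zero[OF norm_ge_zero b(2)], of "norm c"] by simp
    ultimately have "z \<longlonglongrightarrow> 0"
      by (intro Lim_null_comparison[of z "\<lambda>n. norm c * norm (e - b) ^ n"]) auto
    then show ?thesis
      using tendsto_diff[OF tendsto_const, of z 0 _ c] by simp
  qed
  show ?thesis
    by (rule closed_sequentially[OF closed_ideal_mem(9)[OF J] mem lim])
qed

text \<open>Since \<open>1 - rt (1 - k * k)\<close> is the absolute value of \<open>k\<close>, this is the positive part of \<open>h - t\<close>.\<close>

definition cut_off :: "real \<Rightarrow> 'u::{cstar_algebra,real_normed_algebra_1} \<Rightarrow> 'u" where
  "cut_off t h = 1 - rt (1 - (1/4) *\<^sub>R ((h - t *\<^sub>R 1) * (h - t *\<^sub>R 1))) + (1/2) *\<^sub>R (h - t *\<^sub>R 1)"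

context
  fixes h :: "'u::{cstar_algebra,real_normed_algebra_1}" and t :: real
  assumes h: "adj h = h" "norm h \<le> 1" and t: "0 \<le> t" "t \<le> 1"
begin

text \<open>The factor 1/4 in \<open>cut_off\<close> has its origin here: h - t has norm at most 2,
  and its half lies in the unit ball.\<close>

lemma norm_cut_off_arg: "norm (1 - (1/4) *\<^sub>R ((h - t *\<^sub>R 1) * (h - t *\<^sub>R 1))) \<le> 1"
proof -
  let ?k = "(1/2) *\<^sub>R (h - t *\<^sub>R 1)"
  have "norm (h - t *\<^sub>R 1) \<le> norm h + norm (t *\<^sub>R (1::'u))"
    by (rule norm_triangle_ineq4)
  then have "norm ?k \<le> 1"
    using h t by simp
  then have "norm (1 - ?k * ?k) \<le> 1"
    by (intro norm_one_minus_square) (simp_all add: adj_diff h)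
  then show ?thesis by simp
qed

text \<open>With k = (h - t)/2 and m its absolute value, m^2 = k^2 gives (m + k)^2 = 2 (m + k) k.
  For functions: where the positive part c of h - t is nonzero, h - c equals t. For t > 0 this makes
  (h - c)/t a local unit of c.\<close>

lemma cut_off_mult: "cut_off t h * (h - cut_off t h) = t *\<^sub>R cut_off t h"
proof -
  let ?k = "(1/2) *\<^sub>R (h - t *\<^sub>R 1)"
  let ?y = "1 - (1/4) *\<^sub>R ((h - t *\<^sub>R 1) * (h - t *\<^sub>R 1))"
  define m where "m = 1 - rt ?y"
  have y: "?y = 1 - ?k * ?k" by simp
  have "m * m = 1 - ?y"
    using rt_equation[OF norm_cut_off_arg] unfolding m_def by (simp add: algebra_simps scaleR_2)
  then have mm: "m * m = ?k * ?k"
    using y by (metis diff_diff_eq2 add_diff_cancel_left')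
  have "?k * ?y = ?y * ?k"
    by (simp add: algebra_simps)
  then have mk: "?k * m = m * ?k"
    using rt_commute[OF norm_cut_off_arg, of ?k] by (simp add: m_def algebra_simps)
  have c: "cut_off t h = m + ?k"
    by (simp add: cut_off_def m_def)
  have "(m + ?k) * (m + ?k) = 2 *\<^sub>R ((m + ?k) * ?k)"
    unfolding distrib_left distrib_right mm mk scaleR_2 by simp
  also have "\<dots> = (m + ?k) * (h - t *\<^sub>R 1)"
    by simp
  finally have "(m + ?k) * (m + ?k) = (m + ?k) * h - t *\<^sub>R (m + ?k)"
    by (simp add: right_diff_distrib)
  then show ?thesis
    unfolding c right_diff_distrib by simp
qed

end

lemma cut_off_limit:
  assumes h: "adj h = h" "norm h \<le> 1"
  shows "(\<lambda>n. cut_off (1 / real (Suc n)) h) \<longlonglongrightarrow> cut_off 0 h"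
proof -
  let ?s = "\<lambda>n. 1 / real (Suc n)"
  have s: "?s \<longlonglongrightarrow> 0"
    by (rule LIMSEQ_Suc[OF lim_1_over_n])
  let ?y = "\<lambda>t. 1 - (1/4) *\<^sub>R ((h - t *\<^sub>R 1) * (h - t *\<^sub>R 1))"
  have "(\<lambda>n. ?y (?s n)) \<longlonglongrightarrow> ?y 0"
    by (intro tendsto_intros s)
  then have "(\<lambda>n. rt (?y (?s n))) \<longlonglongrightarrow> rt (?y 0)"
    by (rule continuous_on_tendsto_compose[OF continuous_on_rt])
       (use norm_cut_off_arg[OF h, of "1 / real (Suc _)"] norm_cut_off_arg[OF h, of 0] in auto)
  then show ?thesis
    unfolding cut_off_def by (intro tendsto_intros s)
qed

text \<open>The scalar part is a character that sends a to 0, hence the positive part of a - t to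
  that of - t, which is 0. The equation for \<open>rt\<close> determines the scalar part up to sign,
  and contractivity of \<open>rt\<close> decides the sign.\<close>

lemma cut_off_embed:
  assumes a: "adj a = a" "norm a \<le> 1" and t: "0 \<le> t" "t \<le> 1"
  shows "\<exists>b. cut_off t (embed a) = embed b"
proof -
  have h: "adj (embed a) = embed a" "norm (embed a) \<le> 1"
    using a by (simp_all flip: embed_adj)
  let ?y = "1 - (1/4) *\<^sub>R ((embed a - t *\<^sub>R 1) * (embed a - t *\<^sub>R 1))"
  let ?r = "rt ?y"
  have scal: "scal_part (u * v) = scal_part u * scal_part v" "scal_part (u - v) = scal_part u - scal_part v"
    "scal_part (u + v) = scal_part u + scal_part v" "scal_part (c *\<^sub>R u) = complex_of_real c * scal_part u"
    "scal_part (1 :: 'a unitization) = 1" for u v :: "'a unitization" and c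
    by (simp_all add: times_unitization_def minus_unitization_def plus_unitization_def
        scaleR_unitization_def one_unitization_def scaleR_conv_of_real)
  define s where "s = 1 - scal_part ?r"
  have "scal_part (2 *\<^sub>R ?r - ?r * ?r) = scal_part ?y"
    using rt_equation[OF norm_cut_off_arg[OF h t]] by simp
  then have "s * s = (complex_of_real (t / 2)) * (complex_of_real (t / 2))"
    by (simp add: scal s_def field_simps)
  then have s: "s = complex_of_real (t / 2) \<or> s = - complex_of_real (t / 2)"
    by (simp only: square_eq_iff)
  have "cmod (scal_part ?r) \<le> 1"
    using norm_rt_le[OF norm_cut_off_arg[OF h t]] norm_scal_part_le order_trans by blast
  then have "0 \<le> Re s"
    using complex_Re_le_cmod[of "scal_part ?r"] by (simp add: s_def)
  then have "s = complex_of_real (t / 2)"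
    using s t by auto
  moreover have "scal_part (cut_off t (embed a)) = s - complex_of_real (t / 2)"
    by (simp add: cut_off_def scal s_def)
  ultimately have "scal_part (cut_off t (embed a)) = 0" by simp
  then show ?thesis
    by (intro exI[of _ "vec_part (cut_off t (embed a))"]) (simp add: embed_def unitization.expand)
qed

text \<open>The positive parts of a - 1/(n+1) have local units and so lie in P; they converge to the
  positive part of a, and a is the difference of the positive parts of a and - a.\<close>

theorem closed_ideal_UNIV_if_local_units:
  fixes P :: "'a::cstar_algebra set"
  assumes P: "closed_ideal UNIV P" and lu: "\<And>c e. c * e = c \<Longrightarrow> c \<in> P"
  shows "P = UNIV"
proof -
  note PD = closed_ideal_mem[OF P]
  have PE: "closed (embed ` P)"
    using closed_ideal_embed[OF P] closed_ideal_mem(9) by blast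
  have cut: "cut_off 0 (embed a) \<in> embed ` P" if a: "adj a = a" "norm a \<le> 1" for a
  proof -
    have h: "adj (embed a) = embed a" "norm (embed a) \<le> 1"
      using a by (simp_all flip: embed_adj)
    have "cut_off (1 / real (Suc n)) (embed a) \<in> embed ` P" for n
    proof -
      let ?t = "1 / real (Suc n)"
      have t: "0 \<le> ?t" "?t \<le> 1" "?t > 0" by simp_all
      obtain b where b: "cut_off ?t (embed a) = embed b"
        using cut_off_embed[OF a t(1,2)] by blast
      have "embed (b * (a - b)) = embed (?t *\<^sub>R b)"
        using cut_off_mult[OF h t(1,2)] unfolding b by (simp only: embed_mult embed_diff embed_scaleR)
      then have "b * (a - b) = ?t *\<^sub>R b"
        by (rule injD[OF inj_embed])
      then have "b * ((1 / ?t) *\<^sub>R (a - b)) = b"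
        using t(3) by simp
      then have "b \<in> P" by (rule lu)
      then show ?thesis unfolding b by (rule imageI)
    qed
    then show ?thesis
      using closed_sequentially[OF PE _ cut_off_limit[OF h]] by blast
  qed
  have sa: "a \<in> P" if a: "adj a = a" "norm a \<le> 1" for a
  proof -
    obtain b where b: "b \<in> P" "cut_off 0 (embed a) = embed b"
      using cut[OF a] by blast
    obtain b' where b': "b' \<in> P" "cut_off 0 (embed (- a)) = embed b'"
      using cut[of "- a"] a by auto
    \<comment> \<open>The absolute values in the two cut-offs agree and cancel; the two halves of a
      remain.\<close>
    have "embed a = embed b - embed b'"
      unfolding b(2)[symmetric] b'(2)[symmetric]
      by (simp add: cut_off_def embed_minus) (simp flip: scaleR_add_left)
    then have "embed a = embed (b - b')" by (simp add: embed_diff)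
    then have "a = b - b'" by (rule injD[OF inj_embed])
    then show ?thesis using PD(3)[OF b(1) b'(1)] by simp
  qed
  have sa': "a \<in> P" if a: "adj a = a" for a
  proof (cases "a = 0")
    case False
    have "(1 / norm a) *\<^sub>R a \<in> P"
      using False a by (intro sa) auto
    then have "norm a *\<^sub>R (1 / norm a) *\<^sub>R a \<in> P" by (rule PD(5))
    then show ?thesis using False by simp
  qed (use PD in simp)
  have "x \<in> P" for x
  proof -
    obtain h k where "adj h = h" "adj k = k" "x = h + \<i> *\<^sub>C k"
      by (rule cartesian_decomposition)
    then show ?thesis
      using sa' PD(2)[of h "\<i> *\<^sub>C k"] PD(6)[of k \<i>] by simp
  qed
  then show ?thesis by blast
qed

section \<open>Compactness of the primitive ideal space\<close>

lemma openin_not_mem: "openin jacobson_topology {P \<in> primitive_ideals. c \<notin> P}"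
proof -
  have "primitive_ideals - {P \<in> primitive_ideals. c \<notin> P} = {P \<in> primitive_ideals. c \<in> P}" by blast
  then show ?thesis
    by (auto simp: openin_jacobson hull_kernel_closed_def)
qed

lemma limit_in_closure:
  fixes x :: "'x::metric_space"
  assumes "\<And>n. u n \<in> S" "u \<longlonglongrightarrow> x" shows "x \<in> closure S"
  unfolding closure_sequential by (rule exI[of _ u]) (use assms in blast)

lemma closed_ideal_closure_span:
  fixes S :: "'a::cstar_algebra set"
  assumes "\<And>a x. x \<in> S \<Longrightarrow> a * x \<in> S \<and> x * a \<in> S"
  shows "closed_ideal UNIV (closure (cspan S))"
  unfolding closed_ideal_def
proof (intro conjI ballI)
  have span: "a * x \<in> cspan S \<and> x * a \<in> cspan S" if "x \<in> cspan S" for a x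
    using that
  proof (induction rule: complex_vector.span_induct_alt)
    case base
    show ?case by (simp add: complex_vector.span_zero)
  next
    case (step c x y)
    then show ?case
      using assms[of x a] by (simp add: distrib_left distrib_right mult_scaleC_left mult_scaleC_right
          complex_vector.span_add complex_vector.span_scale complex_vector.span_base)
  qed
  show "csubspace (closure (cspan S))"
  proof (rule complex_vector.subspaceI)
    show "0 \<in> closure (cspan S)"
      using closure_subset complex_vector.span_zero by blast
    show "x + y \<in> closure (cspan S)" if xy: "x \<in> closure (cspan S)" "y \<in> closure (cspan S)" for x y
    proof -
      obtain u v where uv: "\<And>n. u n \<in> cspan S" "u \<longlonglongrightarrow> x" "\<And>n. v n \<in> cspan S" "v \<longlonglongrightarrow> y"
        using xy unfolding closure_sequential by blast
      then show ?thesis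
        by (intro limit_in_closure[of "\<lambda>n. u n + v n"] complex_vector.span_add tendsto_add)
    qed
    show "c *\<^sub>C x \<in> closure (cspan S)" if x: "x \<in> closure (cspan S)" for c x
    proof -
      obtain u where u: "\<And>n. u n \<in> cspan S" "u \<longlonglongrightarrow> x"
        using x unfolding closure_sequential by blast
      then show ?thesis
        by (intro limit_in_closure[of "\<lambda>n. c *\<^sub>C u n"] complex_vector.span_scale
            bounded_linear.tendsto[OF bounded_linear_scaleC])
    qed
  qed
  fix a x assume "x \<in> closure (cspan S)"
  then obtain u where u: "\<And>n. u n \<in> cspan S" "u \<longlonglongrightarrow> x"
    unfolding closure_sequential by blast
  show "a * x \<in> closure (cspan S)"
    by (rule limit_in_closure[of "\<lambda>n. a * u n"]) (use span u in \<open>auto intro: tendsto_mult_left\<close>)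
  show "x * a \<in> closure (cspan S)"
    by (rule limit_in_closure[of "\<lambda>n. u n * a"]) (use span u in \<open>auto intro: tendsto_mult_right\<close>)
qed auto

text \<open>The ideals \<open>K U\<close> of a cover lie together in no primitive ideal, so their
  span is dense. An element of the span within distance 1 of the unit lies in no proper closed
  ideal, and its finitely many terms name a finite subcover.\<close>

theorem compact_jacobson_of_unit:
  fixes u :: "'a::cstar_algebra"
  assumes u: "\<And>a. u * a = a \<and> a * u = a"
  shows "compact_space (jacobson_topology :: 'a set topology)"
  unfolding compact_space_alt
proof (intro allI impI)
  fix \<U> :: "'a set set set"
  assume "(\<forall>U\<in>\<U>. openin jacobson_topology U) \<and> topspace jacobson_topology \<subseteq> \<Union>\<U>"
  then have op: "\<And>U. U \<in> \<U> \<Longrightarrow> hull_kernel_closed (primitive_ideals - U)" and cov: "primitive_ideals \<subseteq> \<Union>\<U>"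
    by (auto simp: openin_jacobson topspace_jacobson)
  define K :: "'a set set \<Rightarrow> 'a set" where "K U = \<Inter>(primitive_ideals - U)" for U
  define S where "S = (\<Union>U\<in>\<U>. K U)"
  have "closed_ideal UNIV (closure (cspan S))"
  proof (rule closed_ideal_closure_span)
    fix a x assume "x \<in> S"
    then obtain U where U: "U \<in> \<U>" "\<And>P. P \<in> primitive_ideals - U \<Longrightarrow> x \<in> P"
      by (auto simp: S_def K_def)
    have "a * x \<in> P" "x * a \<in> P" if "P \<in> primitive_ideals - U" for P
      using U(2)[OF that] that primitive_closed_ideal(1)[of P] closed_ideal_mem(7,8) by blast+
    then show "a * x \<in> S \<and> x * a \<in> S"
      using U(1) by (auto simp: S_def K_def)
  qed
  moreover have "\<not> closure (cspan S) \<subseteq> P" if P: "P \<in> primitive_ideals" for P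
  proof
    assume "closure (cspan S) \<subseteq> P"
    then have "S \<subseteq> P"
      using complex_vector.span_superset closure_subset by blast
    obtain U where U: "U \<in> \<U>" "P \<in> U" using cov P by blast
    have "\<Inter>(primitive_ideals - U) \<subseteq> P"
      using \<open>S \<subseteq> P\<close> U(1) by (auto simp: S_def K_def)
    then have "P \<in> primitive_ideals - U"
      using op[OF U(1)] P unfolding hull_kernel_closed_def by blast
    then show False using U by blast
  qed
  ultimately have "closure (cspan S) = UNIV"
    using proper_closed_ideal_le_primitive by blast
  then have "u \<in> closure (cspan S)" by simp
  then obtain b where b: "b \<in> cspan S" "norm (u - b) < 1"
    unfolding closure_approachable by (metis dist_norm norm_minus_commute zero_less_one)
  obtain T r where T: "finite T" "T \<subseteq> S" "b = (\<Sum>a\<in>T. r a *\<^sub>C a)"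
    using b(1) unfolding complex_vector.span_explicit by blast
  obtain W where W: "\<And>a. a \<in> T \<Longrightarrow> W a \<in> \<U> \<and> a \<in> K (W a)"
    using T(2) unfolding S_def by (metis UN_E subsetD)
  have "primitive_ideals \<subseteq> \<Union>(W ` T)"
  proof (rule ccontr)
    assume "\<not> primitive_ideals \<subseteq> \<Union>(W ` T)"
    then obtain P where P: "P \<in> primitive_ideals" "\<And>a. a \<in> T \<Longrightarrow> P \<notin> W a" by blast
    note cl = primitive_closed_ideal[OF P(1)]
    have "a \<in> P" if "a \<in> T" for a
      using W[OF that] P that by (auto simp: K_def)
    then have "b \<in> P"
      unfolding T(3) using cl(1) closed_ideal_mem(6)[OF cl(1)]
      by (intro complex_vector.subspace_sum) (auto simp: closed_ideal_def)
    \<comment> \<open>The unit is a local unit of itself.\<close>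
    then have "u \<in> P"
      using mem_ideal_of_local_unit[OF cl(1) _ _ b(2), of u] u by blast
    then have "a \<in> P" for a
      using closed_ideal_mem(7)[OF cl(1), of a u] u by simp
    then show False using cl(2) by blast
  qed
  then show "\<exists>\<F>. finite \<F> \<and> \<F> \<subseteq> \<U> \<and> topspace jacobson_topology \<subseteq> \<Union>\<F>"
    using T(1) W by (intro exI[of _ "W ` T"]) (auto simp: topspace_jacobson)
qed

theorem global_near_zero:
  fixes D :: "'g::topological_space \<Rightarrow> 'a::cstar_algebra set"
  assumes compact: "compact_space (jacobson_topology :: 'a set topology)"
    and ideal: "\<And>t. closed_ideal UNIV (D t)"
    and lower: "\<And>U. open U \<Longrightarrow> open {t. U \<inter> D t \<noteq> {}}"
    and D0: "D t0 = UNIV"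
  obtains V where "open V" "t0 \<in> V" "\<And>t. t \<in> V \<Longrightarrow> D t = UNIV"
proof -
  define L where "L = {c::'a. \<exists>e. c * e = c}"
  define nz where "nz c = {P \<in> primitive_ideals. (c::'a) \<notin> P}" for c
  have "topspace jacobson_topology \<subseteq> \<Union>(nz ` L)"
  proof
    fix P :: "'a set" assume "P \<in> topspace jacobson_topology"
    then have P: "P \<in> primitive_ideals" by (simp add: topspace_jacobson)
    then obtain c where "c \<in> L" "c \<notin> P"
      using closed_ideal_UNIV_if_local_units[of P] primitive_closed_ideal[OF P] by (auto simp: L_def)
    then show "P \<in> \<Union>(nz ` L)" using P by (auto simp: nz_def)
  qed
  moreover have "\<forall>U\<in>nz ` L. openin jacobson_topology U"
    by (auto simp: nz_def openin_not_mem)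
  ultimately obtain \<F> where \<F>: "finite \<F>" "\<F> \<subseteq> nz ` L" "topspace jacobson_topology \<subseteq> \<Union>\<F>"
    using compact unfolding compact_space_alt by meson
  then obtain F where F: "finite F" "F \<subseteq> L" "\<F> = nz ` F"
    by (meson finite_subset_image)
  have "\<forall>c\<in>L. \<exists>e. c * e = c"
    by (simp add: L_def)
  then obtain e where e: "\<And>c. c \<in> L \<Longrightarrow> c * e c = c"
    using bchoice[of L "\<lambda>c e. c * e = c"] by blast
  define V where "V = (\<Inter>c\<in>F. {t. ball (e c) 1 \<inter> D t \<noteq> {}})"
  show thesis
  proof (rule that[of V])
    show "open V"
      unfolding V_def using F(1) lower by (intro open_INT) auto
    show "t0 \<in> V"
      by (simp add: V_def D0)
    fix t assume "t \<in> V"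
    have sub: "c \<in> D t" if c: "c \<in> F" for c
    proof -
      have "ball (e c) 1 \<inter> D t \<noteq> {}"
        using \<open>t \<in> V\<close> c by (simp add: V_def)
      then obtain b where "b \<in> ball (e c) 1" "b \<in> D t" by blast
      then show ?thesis
        using mem_ideal_of_local_unit[OF ideal e, of c b t] c F(2) by (auto simp: dist_norm)
    qed
    have "\<not> D t \<subseteq> P" if P: "P \<in> primitive_ideals" for P
    proof -
      obtain c where "c \<in> F" "c \<notin> P"
        using P \<F>(3) unfolding F(3) topspace_jacobson nz_def by blast
      then show ?thesis using sub by blast
    qed
    then show "D t = UNIV"
      using proper_closed_ideal_le_primitive[OF ideal] by blast
  qed
qed

section \<open>Partial actions\<close>

lemma open_translate:
  fixes N :: "'g::topological_group_add set"
  assumes "open N" shows "open {s. - t + s \<in> N}"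
proof -
  have "continuous_on UNIV (\<lambda>s. - t + s)"
    by (intro continuous_intros)
  then show ?thesis
    using open_vimage[OF assms] by (simp add: vimage_def)
qed

text \<open>Left translates of N by points of H stay in H, and those by points outside H stay
  outside, as cosets do. Closedness settles the connected case.\<close>

lemma open_subgroup_of_nhd:
  fixes H :: "'g::topological_group_add set"
  assumes "open N" "0 \<in> N" "N \<subseteq> H"
    and add: "\<And>s t. s \<in> H \<Longrightarrow> t \<in> H \<Longrightarrow> s + t \<in> H" and neg: "\<And>t. t \<in> H \<Longrightarrow> - t \<in> H"
  shows "open_subgroup H" "closed H"
proof -
  have "\<exists>T. open T \<and> t \<in> T \<and> T \<subseteq> H" if "t \<in> H" for t
  proof (intro exI conjI)
    show "open {s. - t + s \<in> N}" by (rule open_translate[OF assms(1)])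
    show "{s. - t + s \<in> N} \<subseteq> H"
      using add[OF that] assms(3) by (metis (mono_tags, lifting) add_minus_cancel mem_Collect_eq subsetD subsetI)
  qed (simp add: assms)
  then have "open H"
    by (subst open_subopen) blast
  then show "open_subgroup H"
    using assms by (auto simp: open_subgroup_def)
  have "\<exists>T. open T \<and> t \<in> T \<and> T \<subseteq> - H" if "t \<in> - H" for t
  proof (intro exI conjI)
    show "open {s. - t + s \<in> N}" by (rule open_translate[OF assms(1)])
    show "{s. - t + s \<in> N} \<subseteq> - H"
    proof
      fix s assume "s \<in> {s. - t + s \<in> N}"
      then have "- (- t + s) \<in> H" using assms(3) neg by blast
      then have "t \<in> H" if "s \<in> H"
        using add[OF that] by (metis add.assoc add.right_neutral minus_add minus_minus add.right_inverse add_0)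
      then show "s \<in> - H" using \<open>t \<in> - H\<close> by blast
    qed
  qed (simp add: assms)
  then have "open (- H)"
    by (subst open_subopen) blast
  then show "closed H" by (simp add: closed_def)
qed

theorem corollary8p7:
  fixes D :: "'g::{topological_group_add, t2_space} \<Rightarrow> 'a::cstar_algebra set"
    and \<alpha> :: "'g \<Rightarrow> 'a \<Rightarrow> 'a"
    and \<beta> :: "'g \<Rightarrow> 'b::cstar_algebra \<Rightarrow> 'b"
  assumes "locally_compact_space (euclidean :: 'g topology)"
    and "cstar_partial_action UNIV D \<alpha>"
    and "morita_enveloping_action TYPE('e::complex_banach) UNIV D \<alpha> \<beta>"
  shows "((\<exists>u::'a. \<forall>a. u * a = a \<and> a * u = a) \<longrightarrow> compact_space (jacobson_topology :: 'a set topology)) \<and>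
    (compact_space (jacobson_topology :: 'a set topology) \<longrightarrow>
      (\<exists>H. open_subgroup H \<and> global_on H UNIV D) \<and>
      (connected (UNIV :: 'g set) \<longrightarrow> global_on UNIV UNIV D))"
proof (intro conjI impI)
  show "compact_space (jacobson_topology :: 'a set topology)" if "\<exists>u::'a. \<forall>a. u * a = a \<and> a * u = a"
    using that compact_jacobson_of_unit by blast
  assume compact: "compact_space (jacobson_topology :: 'a set topology)"
  have D0: "D 0 = UNIV" and ideal: "closed_ideal UNIV (D t)"
    and ext: "\<And>s x. x \<in> D (- t) \<Longrightarrow> \<alpha> t x \<in> D (- s) \<Longrightarrow> x \<in> D (- (s + t))"
    and lower: "open U \<Longrightarrow> open {t. U \<inter> D t \<noteq> {}}" for t U
    using assms(2) by (auto simp: cstar_partial_action_def topological_partial_action_def)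
  obtain V where V: "open V" "0 \<in> V" "\<And>t. t \<in> V \<Longrightarrow> D t = UNIV"
    using global_near_zero[OF compact ideal lower D0] by metis
  define H where "H = {t. D t = UNIV \<and> D (- t) = UNIV}"
  \<comment> \<open>V controls \<open>D t\<close> alone, and membership in H also concerns
    \<open>D (- t)\<close>; hence the symmetric neighbourhood.\<close>
  define N where "N = V \<inter> uminus -` V"
  have N: "open N" "0 \<in> N" "N \<subseteq> H"
    using V by (auto simp: N_def H_def intro!: open_Int open_vimage continuous_intros)
  have neg: "- t \<in> H" if "t \<in> H" for t
    using that by (auto simp: H_def)
  \<comment> \<open>Both maps are defined everywhere, so the composite is, and the map for s + t
    extends it.\<close>
  have half: "D (- (s + t)) = UNIV" if "s \<in> H" "t \<in> H" for s t
    using that ext[of _ t s] by (auto simp: H_def)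
  \<comment> \<open>The remaining half is \<open>half\<close> for \<open>- t\<close> and
    \<open>- s\<close>, whose sum has the inverse s + t.\<close>
  have add: "s + t \<in> H" if "s \<in> H" "t \<in> H" for s t
    using half[OF that] half[OF neg[OF that(2)] neg[OF that(1)]] by (simp add: H_def minus_add)
  note sub = open_subgroup_of_nhd[OF N add neg]
  have glob: "global_on H UNIV D"
    by (auto simp: global_on_def H_def)
  show "\<exists>H. open_subgroup H \<and> global_on H UNIV D"
    using sub(1) glob by blast
  show "global_on UNIV UNIV D" if "connected (UNIV :: 'g set)"
  proof -
    have "H = {} \<or> H = UNIV"
      using that sub by (auto simp: connected_clopen open_subgroup_def)
    then show ?thesis
      using glob N by auto
  qed
qed

end
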